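(* Let $S$ be a countably infinite set, $k\ge1$, and let $K=(K_i)_{i=0}^k$ be a $k$-palette. For every exchangeable random $K$-coloured directed hypergraph $\mu$ on $S$ there is a sequence of (directed) ingredients $$(Z_0,\kappa_0,\mu_0),\ (Z_1,\kappa_1,P_1),\ \ldots,\ (Z_{k-1},\kappa_{k-1},P_{k-1}),\ (K_k,P_k)$$ which yields $\mu$ upon following the standard (directed) recipe.
   Context: A $k$-palette is a sequence $K=(K_i)_{i=0}^k$ of standard Borel spaces. $[i]=\{1,\ldots,i\}$; $\mathrm{Inj}([i],S)$ is the set of injections $[i]\to S$ (a single point when $i=0$). Put $K^{(S)}:=\prod_{i=0}^k K_i^{\mathrm{Inj}([i],S)}$. $\mathrm{Sym}_0(S)$ is the group of finitely-supported permutations of $S$. An exchangeable random $K$-coloured directed hypergraph on $S$ is a Borel probability measure on $K^{(S)}$ invariant under the action $\tau^g((\omega_\phi)_\phi)=(\omega_{g\circ\phi})_\phi$, $g\in\mathrm{Sym}_0(S)$. A probability kernel $P:Y\rightsquigarrow X$ between standard Borel spaces is a map $(y,A)\mapsto P(y,A)$ that is measurable in $y$ for each measurable $A\subseteq X$ and a probability measure on $X$ in $A$ for each $y$. A sequence of ingredients consists of standard Borel spaces $Z_0,\ldots,Z_{k-1}$, a probability measure $\mu_0$ on $Z_0$, Borel maps $\kappa_i:Z_i\to K_i$ for $0\le i\le k-1$ and, setting $Z_k:=K_k$, for each $i=1,\ldots,k$ a probability kernel $$P_i:Z_0\times Z_1^{\mathrm{Inj}([1],[i])}\times Z_2^{\mathrm{Inj}([2],[i])}\times\cdots\times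 Z_{i-1}^{\mathrm{Inj}([i-1],[i])}\rightsquigarrow Z_i^{\mathrm{Sym}([i])}$$ that is covariant under the natural coordinate-permuting actions of $\mathrm{Sym}([i])$ on domain and target (i.e. for $\sigma\in\mathrm{Sym}([i])$, acting by $(z_\phi)_\phi\mapsto(z_{\sigma\circ\phi})_\phi$ on both sides, $P_i(\sigma\cdot z,\cdot)$ is the image of $P_i(z,\cdot)$ under the action of $\sigma$). By this covariance, identifying an $i$-element set $u$ with $[i]$ by any enumeration, one obtains a well-defined law $P_i(z_\emptyset,(z_s)_{s\in u},\ldots,(z_\psi)_{\psi\in\mathrm{Inj}([i-1],u)},\cdot)$ on $Z_i^{\mathrm{Inj}([i],u)}$. The standard recipe picks a random $(\omega_\phi)_{\phi\in\bigcup_{i\le k}\mathrm{Inj}([i],S)}\in K^{(S)}$ as follows. Choose $z_\emptyset\in Z_0$ with law $\mu_0$ and set $\omega_\emptyset:=\kappa_0(z_\emptyset)$. Successively for $i=1,\ldots,k-1$, conditionally on all previous choices, choose for each $u\in\binom{S}{i}$ (the $i$-element subsets of $S$) an $i!$-tuple $(z_\phi)_{\phi\in\mathrm{Inj}([i],u)}\in Z_i^{\mathrm{Inj}([i],u)}$, independently for different $u$, with law $P_i(z_\emptyset,(z_s)_{s\in u},\ldots,(z_\psi)_{\psi\in\mathrm{Inj}([i-1],u)},\cdot)$, and set $\omega_\phi:=\kappa_i(z_\phi)$ for all $\phi\in\mathrm{Inj}([i],S)$. Finally, conditionally on all previous choices, choose for each $e\in\binom{S}{k}$ a $k!$-tuple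 $(\omega_\phi)_{\phi\in\mathrm{Inj}([k],e)}\in K_k^{\mathrm{Inj}([k],e)}$, independently for different $e$, with law $P_k(z_\emptyset,(z_s)_{s\in e},\ldots,(z_\psi)_{\psi\in\mathrm{Inj}([k-1],e)},\cdot)$. The ingredients yield $\mu$ if $\mu$ is the law of the resulting $(\omega_\phi)_\phi$. *)

theory Defs
  imports "HOL-Probability.Probability" "HOL-Combinatorics.Permutations" "HOL-Library.Ramsey"
begin

definition standard_borel :: "'a measure \<Rightarrow> bool" where
  "standard_borel M \<longleftrightarrow>
    (\<exists>X. completely_metrizable_space X \<and> separable_space X \<and> topspace X = space M \<and>
         sets M = sigma_sets (topspace X) {U. openin X U})"

text \<open>
  An injection \<open>\<phi> : [i] \<rightarrow> S\<close> is encoded as the list \<open>[\<phi>(1), \<dots>, \<phi>(i)]\<close> of its values, so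
  \<open>g \<circ> \<phi>\<close> is \<open>map g \<phi>\<close>, the domain of \<open>\<phi>\<close> is \<open>[length \<phi>]\<close>, and the image of \<open>\<phi>\<close> is \<open>set \<phi>\<close>.
  (Functions with extensional domain \<open>{1..i}\<close> would not do as indices, since functions for
  different \<open>i\<close> could coincide.) In particular \<open>Sym([i])\<close> is \<open>Injs i {1..i}\<close>.
\<close>

definition Injs :: "nat \<Rightarrow> 's set \<Rightarrow> 's list set" where
  "Injs i S = {\<phi>. length \<phi> = i \<and> distinct \<phi> \<and> set \<phi> \<subseteq> S}"

lemma bij_betw_injections_Injs:
  "bij_betw (\<lambda>f. map f [1..<Suc i]) {f \<in> {1..i} \<rightarrow>\<^sub>E S. inj_on f {1..i}} (Injs i S)"
proof (rule bij_betw_byWitness[where f' = "\<lambda>\<phi>. \<lambda>j\<in>{1..i}. \<phi> ! (j - 1)"], goal_cases)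
  case 1
  have "(\<lambda>j\<in>{1..i}. map f [1..<Suc i] ! (j - 1)) = f" if "f \<in> {1..i} \<rightarrow>\<^sub>E S" for f
  proof (rule extensionalityI[of _ "{1..i}"])
    show "f \<in> extensional {1..i}" using that by (simp add: PiE_def)
    show "(\<lambda>j\<in>{1..i}. map f [1..<Suc i] ! (j - 1)) j = f j" if j: "j \<in> {1..i}" for j
    proof -
      have *: "j - 1 < Suc i - 1" "1 + (j - 1) = j" using j by auto
      have "map f [1..<Suc i] ! (j - 1) = f j" using nth_map_upt[OF *(1), of f] unfolding *(2) .
      with j show ?thesis by (simp only: restrict_def if_True)
    qed
  qed simp
  then show ?case by blast
next
  case 2
  have "map (\<lambda>j\<in>{1..i}. \<phi> ! (j - 1)) [1..<Suc i] = \<phi>" if "\<phi> \<in> Injs i S" for \<phi>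
    using that by (intro nth_equalityI) (simp_all add: Injs_def del: upt_Suc)
  then show ?case by blast
next
  case 3
  show ?case
    by (auto simp: Injs_def distinct_map atLeastLessThanSuc_atLeastAtMost PiE_iff simp del: upt_Suc)
next
  case 4
  have "(\<lambda>j\<in>{1..i}. \<phi> ! (j - 1)) \<in> {1..i} \<rightarrow>\<^sub>E S"
    and "inj_on (\<lambda>j\<in>{1..i}. \<phi> ! (j - 1)) {1..i}" if "\<phi> \<in> Injs i S" for \<phi>
  proof -
    have *: "length \<phi> = i" "distinct \<phi>" "set \<phi> \<subseteq> S" using that by (auto simp: Injs_def)
    have "\<phi> ! (j - 1) \<in> S" if "j \<in> {1..i}" for j
      using * that by (auto intro!: subsetD[OF *(3)] nth_mem)
    then show "(\<lambda>j\<in>{1..i}. \<phi> ! (j - 1)) \<in> {1..i} \<rightarrow>\<^sub>E S" by simp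
    show "inj_on (\<lambda>j\<in>{1..i}. \<phi> ! (j - 1)) {1..i}"
      using * by (auto intro!: inj_onI simp: nth_eq_iff_index_eq)
  qed
  then show ?case by blast
qed

text \<open>\<open>\<Prod>\<^sub>i\<^sub>\<in>\<^sub>I Z\<^sub>i\<^bsup>Inj([i],S)\<^esup>\<close>; thus \<open>K\<^bsup>(S)\<^esup>\<close> is \<open>colourings K {..k} S\<close>.\<close>

definition colourings :: "(nat \<Rightarrow> 'a measure) \<Rightarrow> nat set \<Rightarrow> 's set \<Rightarrow> ('s list \<Rightarrow> 'a) measure" where
  "colourings Z I S = PiM (\<Union>i\<in>I. Injs i S) (\<lambda>\<phi>. Z (length \<phi>))"

definition relabel :: "('t \<Rightarrow> 's) \<Rightarrow> nat set \<Rightarrow> 't set \<Rightarrow> ('s list \<Rightarrow> 'a) \<Rightarrow> 't list \<Rightarrow> 'a" where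
  "relabel g I T \<omega> = (\<lambda>\<phi>\<in>(\<Union>i\<in>I. Injs i T). \<omega> (map g \<phi>))"

text \<open>All \<open>K\<^sub>i\<close> live on subsets of one arbitrary type.\<close>

definition palette :: "nat \<Rightarrow> (nat \<Rightarrow> 'a measure) \<Rightarrow> bool" where
  "palette k K \<longleftrightarrow> (\<forall>i\<le>k. standard_borel (K i))"

definition exchangeable_hypergraph ::
    "nat \<Rightarrow> (nat \<Rightarrow> 'a measure) \<Rightarrow> 's set \<Rightarrow> ('s list \<Rightarrow> 'a) measure \<Rightarrow> bool" where
  "exchangeable_hypergraph k K S \<mu> \<longleftrightarrow>
    prob_space \<mu> \<and> sets \<mu> = sets (colourings K {..k} S) \<and>
    (\<forall>g. g permutes S \<and> finite {x. g x \<noteq> x} \<longrightarrow>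
         distr \<mu> (colourings K {..k} S) (relabel g {..k} S) = \<mu>)"

text \<open>
  The target space \<open>T\<close> of a kernel is a separate argument because it is \<open>Z i\<close> for
  \<open>i < k\<close> but \<open>K k\<close> for \<open>i = k\<close>, over different types.
\<close>

definition covariant_kernel ::
    "(nat \<Rightarrow> 'z measure) \<Rightarrow> nat \<Rightarrow> 't measure \<Rightarrow> ((nat list \<Rightarrow> 'z) \<Rightarrow> (nat list \<Rightarrow> 't) measure) \<Rightarrow> bool"
where
  "covariant_kernel Z i T P \<longleftrightarrow>
    P \<in> colourings Z {..<i} {1..i} \<rightarrow>\<^sub>M prob_algebra (colourings (\<lambda>_. T) {i} {1..i}) \<and>
    (\<forall>\<sigma> z. \<sigma> permutes {1..i} \<and> z \<in> space (colourings Z {..<i} {1..i}) \<longrightarrow>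
      P (relabel \<sigma> {..<i} {1..i} z) =
        distr (P z) (colourings (\<lambda>_. T) {i} {1..i}) (relabel \<sigma> {i} {1..i}))"

text \<open>
  \<open>Z i\<close>, \<open>\<kappa> i\<close> matter only for \<open>i < k\<close>, and \<open>P i\<close> only for \<open>1 \<le> i < k\<close>; \<open>Pk\<close> is \<open>P\<^sub>k\<close>.
  Where ingredients are asserted to exist, \<open>'z\<close> can be taken to be \<open>real\<close>, as every standard Borel
  space is Borel isomorphic to a Borel subset of the real line.
\<close>

definition ingredients ::
    "nat \<Rightarrow> (nat \<Rightarrow> 'a measure) \<Rightarrow> (nat \<Rightarrow> 'z measure) \<Rightarrow> (nat \<Rightarrow> 'z \<Rightarrow> 'a) \<Rightarrow> 'z measure \<Rightarrow>
     (nat \<Rightarrow> (nat list \<Rightarrow> 'z) \<Rightarrow> (nat list \<Rightarrow> 'z) measure) \<Rightarrow>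
     ((nat list \<Rightarrow> 'z) \<Rightarrow> (nat list \<Rightarrow> 'a) measure) \<Rightarrow> bool" where
  "ingredients k K Z \<kappa> \<mu>0 P Pk \<longleftrightarrow>
    (\<forall>i<k. standard_borel (Z i)) \<and>
    prob_space \<mu>0 \<and> sets \<mu>0 = sets (Z 0) \<and>
    (\<forall>i<k. \<kappa> i \<in> Z i \<rightarrow>\<^sub>M K i) \<and>
    (\<forall>i\<in>{1..<k}. covariant_kernel Z i (Z i) (P i)) \<and>
    covariant_kernel Z k (K k) Pk"

text \<open>
  The law \<open>P\<^sub>i(z\<^sub>\<emptyset>, (z\<^sub>s)\<^sub>s\<^sub>\<in>\<^sub>u, \<dots>)\<close> on \<open>T\<^bsup>Inj([i],u)\<^esup>\<close>, transported along an enumeration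
  \<open>e : [i] \<rightarrow> u\<close>. Lemma \<open>law_on_eq\<close> below shows that the choice of \<open>e\<close> is immaterial.
\<close>

definition transported_law ::
    "nat \<Rightarrow> 't measure \<Rightarrow> ((nat list \<Rightarrow> 'z) \<Rightarrow> (nat list \<Rightarrow> 't) measure) \<Rightarrow> 's set \<Rightarrow> (nat \<Rightarrow> 's) \<Rightarrow>
     ('s list \<Rightarrow> 'z) \<Rightarrow> ('s list \<Rightarrow> 't) measure" where
  "transported_law i T P u e z =
    distr (P (relabel e {..<i} {1..i} z)) (colourings (\<lambda>_. T) {i} u)
      (relabel (inv_into {1..i} e) {i} u)"

definition law_on ::
    "nat \<Rightarrow> 't measure \<Rightarrow> ((nat list \<Rightarrow> 'z) \<Rightarrow> (nat list \<Rightarrow> 't) measure) \<Rightarrow> 's set \<Rightarrow>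
     ('s list \<Rightarrow> 'z) \<Rightarrow> ('s list \<Rightarrow> 't) measure" where
  "law_on i T P u = transported_law i T P u (SOME e. bij_betw e {1..i} u)"

lemma map_in_Injs: "inj_on e A \<Longrightarrow> e ` A \<subseteq> B \<Longrightarrow> \<phi> \<in> Injs i A \<Longrightarrow> map e \<phi> \<in> Injs i B"
  by (auto simp: Injs_def distinct_map intro: inj_on_subset)

lemma relabel_measurable:
  assumes "inj_on e A" "e ` A \<subseteq> B"
  shows "relabel e I A \<in> colourings Z I B \<rightarrow>\<^sub>M colourings Z I A"
  unfolding colourings_def relabel_def
proof (rule measurable_restrict)
  fix \<phi> assume "\<phi> \<in> (\<Union>i\<in>I. Injs i A)"
  then have "map e \<phi> \<in> (\<Union>i\<in>I. Injs i B)" using map_in_Injs[OF assms] by blast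
  from measurable_component_singleton[OF this, of "\<lambda>\<phi>. Z (length \<phi>)"]
  show "(\<lambda>x. x (map e \<phi>)) \<in> PiM (\<Union>i\<in>I. Injs i B) (\<lambda>\<phi>. Z (length \<phi>)) \<rightarrow>\<^sub>M Z (length \<phi>)"
    by simp
qed

lemma relabel_relabel:
  assumes "inj_on e A" "e ` A \<subseteq> B"
  shows "relabel e I A (relabel f I B z) = relabel (f \<circ> e) I A z"
  unfolding relabel_def using map_in_Injs[OF assms] by (auto simp: fun_eq_iff restrict_def)

lemma relabel_cong:
  assumes "\<And>x. x \<in> A \<Longrightarrow> e x = f x"
  shows "relabel e I A z = relabel f I A z"
proof -
  have *: "map e \<phi> = map f \<phi>" if "\<phi> \<in> (\<Union>i\<in>I. Injs i A)" for \<phi>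
    using that assms by (auto simp: Injs_def)
  show ?thesis unfolding relabel_def by (rule restrict_ext) (simp only: *)
qed

lemma transported_law_eq:
  fixes T :: "'t measure"
  assumes P: "covariant_kernel Z i T P"
    and e: "bij_betw e {1..i} u" and f: "bij_betw f {1..i} u"
    and u: "u \<subseteq> S" and z: "z \<in> space (colourings Z {..<i} S)"
  shows "transported_law i T P u e z = transported_law i T P u f z"
proof -
  define \<sigma> where "\<sigma> = (\<lambda>x. if x \<in> {1..i} then inv_into {1..i} e (f x) else x)"
  have bij: "bij_betw (inv_into {1..i} e \<circ> f) {1..i} {1..i}"
    using bij_betw_trans[OF f bij_betw_inv_into[OF e]] .
  have "bij_betw \<sigma> {1..i} {1..i}"
    by (rule bij_betw_cong[THEN iffD1, OF _ bij]) (simp add: \<sigma>_def)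
  then have \<sigma>: "\<sigma> permutes {1..i}"
    by (rule bij_imp_permutes) (auto simp: \<sigma>_def)
  have \<sigma>': "inj_on \<sigma> {1..i}" "\<sigma> ` {1..i} \<subseteq> {1..i}"
    by (rule permutes_inj_on[OF \<sigma>], rule equalityD1[OF permutes_image[OF \<sigma>]])
  have e\<sigma>: "e (\<sigma> x) = f x" if x: "x \<in> {1..i}" for x
  proof -
    have "f x \<in> e ` {1..i}"
      using bij_betw_apply[OF f x] bij_betw_imp_surj_on[OF e] by simp
    from f_inv_into_f[OF this] show ?thesis using x unfolding \<sigma>_def by (simp only: if_True)
  qed
  define y where "y = relabel e {..<i} {1..i} z"
  have y: "y \<in> space (colourings Z {..<i} {1..i})"
    unfolding y_def
    by (rule measurable_space[OF relabel_measurable z]) (use e u in \<open>simp_all add: bij_betw_def\<close>)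
  have fy: "relabel f {..<i} {1..i} z = relabel \<sigma> {..<i} {1..i} y"
    unfolding y_def relabel_relabel[OF \<sigma>'] by (rule relabel_cong) (simp add: e\<sigma>)
  have cov: "P (relabel \<sigma> {..<i} {1..i} y) =
      distr (P y) (colourings (\<lambda>_. T) {i} {1..i}) (relabel \<sigma> {i} {1..i})"
    using P \<sigma> y by (auto simp: covariant_kernel_def)
  have "P y \<in> space (prob_algebra (colourings (\<lambda>_. T) {i} {1..i}))"
    using P y by (auto simp: covariant_kernel_def dest: measurable_space)
  then have sets: "sets (P y) = sets (colourings (\<lambda>_. T) {i} {1..i})"
    by (simp add: space_prob_algebra)
  have inv_f: "bij_betw (inv_into {1..i} f) u {1..i}"
    using f by (rule bij_betw_inv_into)
  then have inv_f': "inj_on (inv_into {1..i} f) u" "inv_into {1..i} f ` u \<subseteq> {1..i}"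
    unfolding bij_betw_def by blast+
  have comp: "relabel (inv_into {1..i} f) {i} u (relabel \<sigma> {i} {1..i} w) =
      relabel (inv_into {1..i} e) {i} u w" for w :: "nat list \<Rightarrow> 't"
    unfolding relabel_relabel[OF inv_f']
  proof (rule relabel_cong)
    fix x assume x: "x \<in> u"
    have "inv_into {1..i} f x \<in> {1..i}" "f (inv_into {1..i} f x) = x"
      using bij_betw_apply[OF inv_f x] bij_betw_inv_into_right[OF f x] by blast+
    then show "(\<sigma> \<circ> inv_into {1..i} f) x = inv_into {1..i} e x"
      unfolding \<sigma>_def comp_def by (simp only: if_True)
  qed
  have "transported_law i T P u f z =
      distr (distr (P y) (colourings (\<lambda>_. T) {i} {1..i}) (relabel \<sigma> {i} {1..i}))
        (colourings (\<lambda>_. T) {i} u) (relabel (inv_into {1..i} f) {i} u)"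
    unfolding transported_law_def fy cov ..
  also have "\<dots> = distr (P y) (colourings (\<lambda>_. T) {i} u)
      (relabel (inv_into {1..i} f) {i} u \<circ> relabel \<sigma> {i} {1..i})"
    by (rule distr_distr[OF relabel_measurable[OF inv_f']])
       (simp only: measurable_cong_sets[OF sets refl] relabel_measurable[OF \<sigma>'])
  also have "\<dots> = transported_law i T P u e z"
    unfolding transported_law_def y_def[symmetric] comp_def comp ..
  finally show ?thesis ..
qed

lemma law_on_eq:
  assumes "covariant_kernel Z i T P" "bij_betw e {1..i} u" "u \<subseteq> S" "z \<in> space (colourings Z {..<i} S)"
  shows "law_on i T P u z = transported_law i T P u e z"
  unfolding law_on_def
  using assms(1) someI[of "\<lambda>e. bij_betw e {1..i} u", OF assms(2)] assms(2-4)
  by (rule transported_law_eq)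

text \<open>
  One step of the recipe: given the previous choices \<open>z\<close>, the joint law of the \<open>i!\<close>-tuples attached
  to the \<open>i\<close>-subsets \<open>u\<close> of \<open>S\<close>, independent for different \<open>u\<close>. An injection \<open>\<phi>\<close> with image \<open>u\<close>
  reads its value from the tuple \<open>w u\<close>.
\<close>

definition step_law ::
    "nat \<Rightarrow> 't measure \<Rightarrow> ((nat list \<Rightarrow> 'z) \<Rightarrow> (nat list \<Rightarrow> 't) measure) \<Rightarrow> 's set \<Rightarrow>
     ('s list \<Rightarrow> 'z) \<Rightarrow> ('s list \<Rightarrow> 't) measure" where
  "step_law i T P S z =
    distr (PiM (nsets S i) (\<lambda>u. law_on i T P u z)) (colourings (\<lambda>_. T) {i} S)
      (\<lambda>w. \<lambda>\<phi>\<in>Injs i S. w (set \<phi>) \<phi>)"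

text \<open>The joint law of all \<open>z\<^sub>\<phi>\<close> with \<open>\<phi> \<in> Inj([j],S)\<close>, \<open>j \<le> i\<close>.\<close>

primrec z_law ::
    "(nat \<Rightarrow> 'z measure) \<Rightarrow> 'z measure \<Rightarrow>
     (nat \<Rightarrow> (nat list \<Rightarrow> 'z) \<Rightarrow> (nat list \<Rightarrow> 'z) measure) \<Rightarrow> 's set \<Rightarrow> nat \<Rightarrow>
     ('s list \<Rightarrow> 'z) measure" where
  "z_law Z \<mu>0 P S 0 = distr \<mu>0 (colourings Z {..0} S) (\<lambda>z. \<lambda>\<phi>\<in>Injs 0 S. z)"
| "z_law Z \<mu>0 P S (Suc i) =
    z_law Z \<mu>0 P S i \<bind>
      (\<lambda>z. distr (step_law (Suc i) (Z (Suc i)) (P (Suc i)) S z) (colourings Z {..Suc i} S)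
        (\<lambda>w. merge (\<Union>j\<in>{..i}. Injs j S) (Injs (Suc i) S) (z, w)))"

text \<open>The law of \<open>(\<omega>\<^sub>\<phi>)\<^sub>\<phi>\<close>, for \<open>k \<ge> 1\<close>.\<close>

definition recipe_law ::
    "nat \<Rightarrow> (nat \<Rightarrow> 'a measure) \<Rightarrow> (nat \<Rightarrow> 'z measure) \<Rightarrow> (nat \<Rightarrow> 'z \<Rightarrow> 'a) \<Rightarrow> 'z measure \<Rightarrow>
     (nat \<Rightarrow> (nat list \<Rightarrow> 'z) \<Rightarrow> (nat list \<Rightarrow> 'z) measure) \<Rightarrow>
     ((nat list \<Rightarrow> 'z) \<Rightarrow> (nat list \<Rightarrow> 'a) measure) \<Rightarrow> 's set \<Rightarrow> ('s list \<Rightarrow> 'a) measure" where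
  "recipe_law k K Z \<kappa> \<mu>0 P Pk S =
    z_law Z \<mu>0 P S (k - 1) \<bind>
      (\<lambda>z. distr (step_law k (K k) Pk S z) (colourings K {..k} S)
        (\<lambda>w. merge (\<Union>j\<in>{..<k}. Injs j S) (Injs k S) (\<lambda>\<phi>. \<kappa> (length \<phi>) (z \<phi>), w)))"

definition yields ::
    "nat \<Rightarrow> (nat \<Rightarrow> 'a measure) \<Rightarrow> (nat \<Rightarrow> 'z measure) \<Rightarrow> (nat \<Rightarrow> 'z \<Rightarrow> 'a) \<Rightarrow> 'z measure \<Rightarrow>
     (nat \<Rightarrow> (nat list \<Rightarrow> 'z) \<Rightarrow> (nat list \<Rightarrow> 'z) measure) \<Rightarrow>
     ((nat list \<Rightarrow> 'z) \<Rightarrow> (nat list \<Rightarrow> 'a) measure) \<Rightarrow> 's set \<Rightarrow> ('s list \<Rightarrow> 'a) measure \<Rightarrow> bool" where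
  "yields k K Z \<kappa> \<mu>0 P Pk S \<mu> \<longleftrightarrow> recipe_law k K Z \<kappa> \<mu>0 P Pk S = \<mu>"

end

(*
  Adjoin to S countably many auxiliary vertices and extend \<mu> to an exchangeable colouring of the
  larger vertex set; this is possible because the law of an exchangeable colouring pulled back along
  an injection does not depend on the injection. To an i-tuple \<phi> in S attach, as z_\<phi>, the whole
  colouring seen from the vertices of \<phi> and the auxiliary vertices (a point of a standard Borel
  space, hence encodable by a real number), and let P_i be the conditional law of the i!-tuple
  attached to an i-set u given the z_\<psi> of lower rank in u, averaged over Sym([i]) to make it exactly
  covariant. What has to be shown is that the tuple of u is conditionally independent, given these
  lower z_\<psi>, of all colours of tuples that do not contain u. An event about u and finitely many
  auxiliary vertices is unchanged by an injection that fixes these and moves all other vertices into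
  the auxiliary ones; this injection turns the larger conditioning \<sigma>-algebra into a subalgebra of
  the smaller one without changing the joint law, and comparing second moments shows that both
  conditional probabilities coincide.
*)

theory Submission
  imports Defs
begin

text \<open>The code at a tuple repeats all that its subtuples see. Given the lower codes, what is
  new at an i-set \<open>u\<close> is therefore only the colours of tuples running through all of
  \<open>u\<close>. Hiding exactly these and conditioning on all the rest reduces independence for
  different sets to a statement about a single \<open>u\<close>.

  The auxiliary vertices serve two ends. Every code sees all of them, so a vertex outside
  \<open>u\<close> that is pushed among them becomes visible to the codes of proper subtuples of
  \<open>u\<close>. And there are infinitely many, so the whole rest of the vertex set fits in while
  the finitely many used by an event stay fixed. The push is injective but not onto, which is why
  invariance is first extended from finitely supported permutations to arbitrary injections.

  Codes are real numbers: conditional laws are built on the line from distribution functions and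
  carried to the spaces of colourings by a pair of Borel maps, one a left inverse of the
  other.\<close>

section \<open>Borel retracts of the real line\<close>

text \<open>A one-sided inverse is the right notion here: such pairs compose and pass to products,
  \<open>f\<close> codes points of \<open>M\<close>, and conditional laws on \<open>N\<close> are
  pushed back to \<open>M\<close> along \<open>g\<close>.\<close>

definition borel_retract :: "'a measure \<Rightarrow> 'b measure \<Rightarrow> bool" where
  "borel_retract M N \<longleftrightarrow>
    (\<exists>f g. f \<in> M \<rightarrow>\<^sub>M N \<and> g \<in> N \<rightarrow>\<^sub>M M \<and> (\<forall>x\<in>space M. g (f x) = x))"

lemma borel_retractI:
  "f \<in> M \<rightarrow>\<^sub>M N \<Longrightarrow> g \<in> N \<rightarrow>\<^sub>M M \<Longrightarrow> (\<And>x. x \<in> space M \<Longrightarrow> g (f x) = x) \<Longrightarrow> borel_retract M N"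
  unfolding borel_retract_def by blast

lemma borel_retract_trans:
  assumes "borel_retract L M" "borel_retract M N"
  shows "borel_retract L N"
proof -
  obtain f g f' g' where *: "f \<in> L \<rightarrow>\<^sub>M M" "g \<in> M \<rightarrow>\<^sub>M L" "\<forall>x\<in>space L. g (f x) = x"
    "f' \<in> M \<rightarrow>\<^sub>M N" "g' \<in> N \<rightarrow>\<^sub>M M" "\<forall>x\<in>space M. g' (f' x) = x"
    using assms unfolding borel_retract_def by blast
  show ?thesis
  proof (rule borel_retractI)
    show "f' \<circ> f \<in> L \<rightarrow>\<^sub>M N" "g \<circ> g' \<in> N \<rightarrow>\<^sub>M L" using * by auto
    show "(g \<circ> g') ((f' \<circ> f) x) = x" if "x \<in> space L" for x
      using * that measurable_space[OF *(1) that] by simp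
  qed
qed

lemma borel_retract_PiM:
  assumes "\<And>i. i \<in> I \<Longrightarrow> borel_retract (M i) (N i)"
  shows "borel_retract (PiM I M) (PiM I N)"
proof -
  have "\<forall>i. \<exists>f g. i \<in> I \<longrightarrow> f \<in> M i \<rightarrow>\<^sub>M N i \<and> g \<in> N i \<rightarrow>\<^sub>M M i \<and> (\<forall>x\<in>space (M i). g (f x) = x)"
    using assms unfolding borel_retract_def by blast
  then obtain f g where *: "\<And>i. i \<in> I \<Longrightarrow> f i \<in> M i \<rightarrow>\<^sub>M N i" "\<And>i. i \<in> I \<Longrightarrow> g i \<in> N i \<rightarrow>\<^sub>M M i"
    "\<And>i x. i \<in> I \<Longrightarrow> x\<in>space (M i) \<Longrightarrow> g i (f i x) = x"
    by metis
  show ?thesis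
  proof (rule borel_retractI)
    show "(\<lambda>x. \<lambda>i\<in>I. f i (x i)) \<in> PiM I M \<rightarrow>\<^sub>M PiM I N"
      using * by (intro measurable_restrict measurable_compose[OF measurable_component_singleton]) auto
    show "(\<lambda>x. \<lambda>i\<in>I. g i (x i)) \<in> PiM I N \<rightarrow>\<^sub>M PiM I M"
      using * by (intro measurable_restrict measurable_compose[OF measurable_component_singleton]) auto
    show "(\<lambda>i\<in>I. g i ((\<lambda>i\<in>I. f i (x i)) i)) = x" if "x \<in> space (PiM I M)" for x
      using that * by (auto simp: space_PiM PiE_iff extensional_def fun_eq_iff)
  qed
qed

definition cantor :: "(nat \<Rightarrow> bool) measure" where
  "cantor = PiM UNIV (\<lambda>_. count_space UNIV)"

text \<open>A family of reals is coded by its rational cuts: one bit for each index and each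
  rational \<open>q\<close> tells whether the coordinate lies below \<open>q\<close>, and the
  infimum of these \<open>q\<close> recovers the coordinate.\<close>

lemma borel_retract_real_PiM_cantor:
  fixes I :: "'i set"
  assumes "countable I"
  shows "borel_retract (PiM I (\<lambda>_. borel :: real measure)) cantor"
proof -
  define c :: "'i \<times> rat \<Rightarrow> nat" where "c = to_nat_on (I \<times> UNIV)"
  have inj: "inj_on c (I \<times> UNIV)" unfolding c_def by (rule inj_on_to_nat_on) (use assms in auto)
  define d where "d = inv_into (I \<times> UNIV) c"
  have dc: "d (c (i, q)) = (i, q)" if "i \<in> I" for i q
    unfolding d_def using inj that by (intro inv_into_f_f) auto
  define f where "f x n \<longleftrightarrow> fst (d n) \<in> I \<and> x (fst (d n)) < of_rat (snd (d n))" for x :: "'i \<Rightarrow> real" and n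
  \<comment> \<open>An arbitrary bit sequence need not come from cuts. The infimum in the extended
    reals still exists and is Borel; \<open>real_of_ereal\<close> turns an infinite value into a
    real default.\<close>
  define g where "g b = (\<lambda>i\<in>I. real_of_ereal (INF q::rat. if b (c (i, q)) then ereal (of_rat q) else \<infinity>))" for b
  show ?thesis
  proof (rule borel_retractI)
    show "f \<in> PiM I (\<lambda>_. borel :: real measure) \<rightarrow>\<^sub>M cantor"
      unfolding cantor_def
    proof (rule measurable_PiM_single')
      fix n :: nat
      show "(\<lambda>x. f x n) \<in> PiM I (\<lambda>_. borel :: real measure) \<rightarrow>\<^sub>M count_space UNIV"
        unfolding f_def by (cases "fst (d n) \<in> I") (simp_all, measurable)
    qed (auto simp: space_PiM)
    show "g \<in> cantor \<rightarrow>\<^sub>M PiM I (\<lambda>_. borel :: real measure)"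
      unfolding cantor_def g_def by (rule measurable_restrict) measurable
    show "g (f x) = x" if x: "x \<in> space (PiM I (\<lambda>_. borel :: real measure))" for x
    proof
      fix i
      show "g (f x) i = x i"
      proof (cases "i \<in> I")
        case True
        have "(INF q::rat. if f x (c (i, q)) then ereal (of_rat q) else \<infinity>) = ereal (x i)"
        proof (rule antisym)
          show "ereal (x i) \<le> (INF q::rat. if f x (c (i, q)) then ereal (of_rat q) else \<infinity>)"
            by (rule INF_greatest) (auto simp: f_def dc True)
          show "(INF q::rat. if f x (c (i, q)) then ereal (of_rat q) else \<infinity>) \<le> ereal (x i)"
          proof (rule dense_ge)
            fix y assume y: "ereal (x i) < y"
            obtain r where r: "ereal (x i) < ereal r" "ereal r < y" using ereal_dense2[OF y] by blast
            then obtain q where q: "x i < of_rat q" "of_rat q < r" using of_rat_dense[of "x i" r] by auto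
            have "(INF q::rat. if f x (c (i, q)) then ereal (of_rat q) else \<infinity>)
               \<le> (if f x (c (i, q)) then ereal (of_rat q) else \<infinity>)" by (rule INF_lower) simp
            also have "\<dots> = ereal (of_rat q)" using q by (simp add: f_def dc True)
            also have "\<dots> \<le> ereal r" using q by simp
            also have "\<dots> \<le> y" using r by simp
            finally show "(INF q::rat. if f x (c (i, q)) then ereal (of_rat q) else \<infinity>) \<le> y" .
          qed
        qed
        then show ?thesis by (simp add: g_def True)
      next
        case False
        then show ?thesis using x by (simp add: g_def space_PiM PiE_iff extensional_def)
      qed
    qed
  qed
qed

text \<open>
  Base 3 avoids the ambiguity of dyadic expansions: with digits in \<open>{0, 1}\<close> the first digit is \<open>1\<close>
  iff the number is at least \<open>1/3\<close>.
\<close>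

lemma borel_retract_cantor_real: "borel_retract cantor (borel :: real measure)"
proof -
  define f where "f b = (\<Sum>n. of_bool (b n) * (1/3) ^ Suc n :: real)" for b :: "nat \<Rightarrow> bool"
  \<comment> \<open>\<open>s\<close> deletes the leading digit. Since \<open>f\<close> takes values
    in [0, 1/2], a leading digit 0 leaves a value of at most 1/6, safely below the threshold
    1/3.\<close>
  define s where "s x = (if x \<ge> 1/3 then 3 * x - 1 else 3 * x)" for x :: real
  define g where "g x n \<longleftrightarrow> (s ^^ n) x \<ge> 1/3" for x n
  have sm: "summable (\<lambda>n. of_bool (b n) * (1/3) ^ Suc n :: real)" for b :: "nat \<Rightarrow> bool"
    by (rule summable_comparison_test'[where g="\<lambda>n. (1/3) ^ Suc n" and N=0])
       (auto intro!: summable_mult2 summable_geometric simp: of_bool_def)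
  have sm3: "summable (\<lambda>n. (1/3) ^ Suc n :: real)" by (simp add: summable_geometric)
  have s3: "(\<Sum>n. (1/3) ^ Suc n :: real) = 1/2"
    using suminf_geometric[of "1/3::real"] suminf_mult[OF summable_geometric[of "1/3::real"], of "1/3"]
    by simp
  have f0: "0 \<le> f b" for b unfolding f_def by (rule suminf_nonneg[OF sm]) (auto simp: of_bool_def)
  have f1: "f b \<le> 1/2" for b
    unfolding f_def s3[symmetric] by (rule suminf_le[OF _ sm sm3]) (auto simp: of_bool_def)
  have shift: "f b = of_bool (b 0) / 3 + f (\<lambda>n. b (Suc n)) / 3" for b
  proof -
    have "f b = (\<Sum>n. of_bool (b (Suc n)) * (1/3) ^ Suc (Suc n)) + of_bool (b 0) * (1/3) ^ Suc 0"
      unfolding f_def using suminf_split_head[OF sm[of b]] by (simp del: power_Suc)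
    also have "(\<Sum>n. of_bool (b (Suc n)) * (1/3) ^ Suc (Suc n) :: real) = (\<Sum>n. (1/3) * (of_bool (b (Suc n)) * (1/3) ^ Suc n))"
      by (simp add: mult.commute mult.left_commute)
    also have "\<dots> = (1/3) * f (\<lambda>n. b (Suc n))"
      unfolding f_def by (rule suminf_mult[OF sm])
    finally show ?thesis by simp
  qed
  have dig: "f b \<ge> 1/3 \<longleftrightarrow> b 0" for b
    using shift[of b] f0[of "\<lambda>n. b (Suc n)"] f1[of "\<lambda>n. b (Suc n)"] by (cases "b 0") auto
  have sf: "s (f b) = f (\<lambda>n. b (Suc n))" for b
    using dig[of b] shift[of b] unfolding s_def by (cases "b 0") auto
  have it: "(s ^^ n) (f b) = f (\<lambda>m. b (m + n))" for n b
    by (induction n) (simp_all add: sf)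
  have [measurable]: "s \<in> borel_measurable borel" unfolding s_def by measurable
  have [measurable]: "(s ^^ n) \<in> borel_measurable borel" for n
    by (induction n) (simp_all add: id_def measurable_comp)
  show ?thesis
  proof (rule borel_retractI)
    show "f \<in> borel_measurable cantor"
      unfolding f_def cantor_def by measurable
    show "g \<in> borel \<rightarrow>\<^sub>M cantor"
      unfolding cantor_def
    proof (rule measurable_PiM_single')
      show "(\<lambda>x. g x n) \<in> borel \<rightarrow>\<^sub>M count_space UNIV" for n
        unfolding g_def by measurable
    qed (auto simp: space_PiM)
    show "g (f b) = b" for b
      by (rule ext) (use dig[of "\<lambda>m. b (m + _)"] in \<open>simp add: g_def it\<close>)
  qed
qed

lemma borel_retract_real_PiM:
  "countable I \<Longrightarrow> borel_retract (PiM I (\<lambda>_. borel :: real measure)) (borel :: real measure)"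
  by (rule borel_retract_trans[OF borel_retract_real_PiM_cantor borel_retract_cantor_real])

section \<open>Complete separable metric spaces as Borel retracts of the line\<close>

text \<open>A point is coded by its distances to a dense sequence \<open>a\<close>. Completeness
  shows that the image is exactly \<open>I\<close>, which is cut out by countably many Borel
  conditions; off the image decoding returns \<open>a 0\<close>, available because the space is
  nonempty.\<close>

lemma standard_borel_borel_retract_real:
  assumes M: "standard_borel M" and ne: "space M \<noteq> {}"
  shows "borel_retract M (borel :: real measure)"
proof -
  obtain Ms d where met: "Metric_space Ms d" and compl: "Metric_space.mcomplete Ms d"
    and sep: "separable_space (Metric_space.mtopology Ms d)"
    and sp: "topspace (Metric_space.mtopology Ms d) = space M"
    and sets: "sets M = sigma_sets (space M) {U. openin (Metric_space.mtopology Ms d) U}"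
    using M unfolding standard_borel_def completely_metrizable_space_def by auto
  interpret Metric_space Ms d by (rule met)
  have spM: "space M = Ms" using sp by simp
  obtain C where C: "countable C" "C \<subseteq> Ms" "mtopology closure_of C = Ms"
    using sep unfolding separable_space_def by auto
  have "C \<noteq> {}" using C ne spM by auto
  define a where "a = from_nat_into C"
  have aC: "a n \<in> C" for n unfolding a_def using \<open>C \<noteq> {}\<close> by (rule from_nat_into)
  have aM: "a n \<in> Ms" for n using aC C by blast
  have dense: "\<exists>n. d x (a n) < r" if "x \<in> Ms" "r > 0" for x r
  proof -
    have "\<exists>y\<in>C. y \<in> mball x r"
      using that C(3) unfolding metric_closure_of by blast
    then obtain y where y: "y \<in> C" "d x y < r" by auto
    obtain n where "a n = y" unfolding a_def using y(1) C(1) \<open>C \<noteq> {}\<close> from_nat_into_surj by metis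
    then show ?thesis using y by blast
  qed
  \<comment> \<open>\<open>y\<close> is in \<open>I\<close> if for every precision some
    \<open>a n\<close> looks like an approximation of a point with distances \<open>y\<close>:
    \<open>y n\<close> is small, and the distances from \<open>a n\<close> are uniformly close to
    \<open>y\<close>. Such approximations form a Cauchy sequence whose limit has distances
    \<open>y\<close>.\<close>
  define I where "I = {y :: nat \<Rightarrow> real. \<forall>m. \<exists>n. y n < 1 / Suc m \<and> (\<forall>j. \<bar>y j - d (a n) (a j)\<bar> \<le> 1 / Suc m)}"
  define e where "e x = (\<lambda>j. d x (a j))" for x
  let ?R = "PiM UNIV (\<lambda>_::nat. borel :: real measure)"
  have eI: "e x \<in> I" if x: "x \<in> Ms" for x
    unfolding I_def
  proof safe
    fix m
    obtain n where n: "d x (a n) < 1 / Suc m" using dense[OF x, of "1 / Suc m"] by auto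
    have "\<bar>e x j - d (a n) (a j)\<bar> \<le> 1 / Suc m" for j
      using n triangle[OF x aM[of n] aM[of j]] triangle[OF aM[of n] x aM[of j]] commute[of x "a n"] commute[of "a j" "a n"]
      unfolding e_def by auto
    then show "\<exists>n. e x n < 1 / Suc m \<and> (\<forall>j. \<bar>e x j - d (a n) (a j)\<bar> \<le> 1 / Suc m)"
      using n unfolding e_def by blast
  qed
  have Ie: "\<exists>x\<in>Ms. e x = y" if y: "y \<in> I" for y
  proof -
    obtain N where N: "\<And>m. y (N m) < 1 / Suc m" "\<And>m j. \<bar>y j - d (a (N m)) (a j)\<bar> \<le> 1 / Suc m"
      using y unfolding I_def by simp metis
    have dN: "d (a (N m)) (a (N l)) \<le> 1 / Suc m + 1 / Suc l" for m l
      using N(1)[of m] N(2)[of "N m" l] commute[of "a (N m)" "a (N l)"] by linarith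
    have "MCauchy (\<lambda>m. a (N m))"
      unfolding MCauchy_def
    proof safe
      fix \<epsilon> :: real assume "\<epsilon> > 0"
      then obtain k where k: "1 / Suc k < \<epsilon> / 2" using nat_approx_posE[of "\<epsilon>/2"] by auto
      have "d (a (N m)) (a (N l)) < \<epsilon>" if "k \<le> m" "k \<le> l" for m l
      proof -
        have "1 / Suc m \<le> 1 / Suc k" "1 / Suc l \<le> 1 / Suc k" using that by (auto simp: frac_le)
        then show ?thesis using dN[of m l] k by linarith
      qed
      then show "\<exists>k. \<forall>n n'. k \<le> n \<longrightarrow> k \<le> n' \<longrightarrow> d (a (N n)) (a (N n')) < \<epsilon>" by blast
    qed (use aM in auto)
    then obtain x where x: "limitin mtopology (\<lambda>m. a (N m)) x sequentially"
      using compl unfolding mcomplete_def by blast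
    have xM: "x \<in> Ms" using x by (simp add: limit_metric_sequentially)
    have "d x (a j) = y j" for j
    proof (rule ccontr)
      assume "d x (a j) \<noteq> y j"
      then have pos: "\<bar>d x (a j) - y j\<bar> / 2 > 0" by simp
      obtain k0 where k0: "\<And>m. m \<ge> k0 \<Longrightarrow> d (a (N m)) x < \<bar>d x (a j) - y j\<bar> / 2"
        using x pos unfolding limit_metric_sequentially by blast
      obtain k1 where k1: "1 / Suc k1 < \<bar>d x (a j) - y j\<bar> / 2" using nat_approx_posE[OF pos] by auto
      define m where "m = max k0 k1"
      have "1 / Suc m \<le> 1 / Suc k1" unfolding m_def by (auto simp: frac_le)
      moreover have "d (a (N m)) x < \<bar>d x (a j) - y j\<bar> / 2" using k0[of m] unfolding m_def by simp
      ultimately show False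
        using N(2)[of j m] k1 triangle[OF xM aM[of "N m"] aM[of j]] triangle[OF aM[of "N m"] xM aM[of j]]
          commute[of x "a (N m)"] by (smt (verit) field_sum_of_halves)
    qed
    then show ?thesis using xM unfolding e_def by auto
  qed
  have inj: "x = x'" if x: "x \<in> Ms" "x' \<in> Ms" "e x = e x'" for x x'
  proof (rule ccontr)
    assume "x \<noteq> x'"
    then have "d x x' / 2 > 0" using x by simp
    then obtain n where "d x (a n) < d x x' / 2" using dense x by blast
    moreover have "d x' (a n) = d x (a n)" using x(3) unfolding e_def by metis
    ultimately show False using triangle[OF x(1) aM x(2), of n] commute[of x' "a n"] by linarith
  qed
  define g where "g y = (if y \<in> I then (THE x. x \<in> Ms \<and> e x = y) else a 0)" for y
  have ge: "g (e x) = x" if "x \<in> Ms" for x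
    unfolding g_def using eI[OF that] that inj by (auto intro!: the_equality)
  have gM: "g y \<in> Ms" for y
  proof (cases "y \<in> I")
    case True
    obtain x where x: "x \<in> Ms" "e x = y" using Ie[OF True] by (elim bexE)
    then show ?thesis using ge[OF x(1)] by simp
  qed (simp add: g_def aM)
  have I_sets: "I \<in> sets ?R"
  proof -
    have "Measurable.pred ?R (\<lambda>y. \<forall>m. \<exists>n. y n < 1 / Suc m \<and> (\<forall>j. \<bar>y j - d (a n) (a j)\<bar> \<le> 1 / Suc m))"
      by measurable
    then show ?thesis unfolding I_def pred_def by (simp add: space_PiM)
  qed
  show ?thesis
  proof (rule borel_retract_trans[OF _ borel_retract_real_PiM], rule borel_retractI)
    show "e \<in> M \<rightarrow>\<^sub>M ?R"
    proof (rule measurable_PiM_single')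
      fix j :: nat
      show "(\<lambda>x. e x j) \<in> borel_measurable M"
      proof (rule borel_measurableI_less)
        fix r
        have "{x \<in> space M. e x j < r} = mball (a j) r"
          using aM commute[of "a j"] by (auto simp: spM e_def)
        then show "{x \<in> space M. e x j < r} \<in> sets M" unfolding sets by (auto intro: sigma_sets.Basic)
      qed
    qed (auto simp: space_PiM)
    show "g \<in> ?R \<rightarrow>\<^sub>M M"
    proof (rule measurable_sigma_sets[OF sets])
      show "{U. openin mtopology U} \<subseteq> Pow (space M)" 
        unfolding spM by (auto dest!: openin_subset)
      show "g \<in> space ?R \<rightarrow> space M" unfolding spM using gM by (intro funcsetI)
      fix U assume "U \<in> {U. openin mtopology U}"
      then have U: "openin mtopology U" by simp
      \<comment> \<open>An open set is the union of the balls with rational radius around points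
        \<open>a n\<close> that it contains, so membership in \<open>U\<close> is a countable
        condition on the distances.\<close>
      define W where "W = {(n, q :: rat). mball (a n) (of_rat q) \<subseteq> U}"
      have eq: "x \<in> U \<longleftrightarrow> (\<exists>p\<in>W. d x (a (fst p)) < of_rat (snd p))" if x: "x \<in> Ms" for x
      proof
        assume "x \<in> U"
        then obtain r where r: "r > 0" "mball x r \<subseteq> U" using U unfolding openin_mtopology by blast
        have "(0 :: real) < r / 2" using r by simp
        from of_rat_dense[OF this] obtain q where q: "0 < real_of_rat q" "real_of_rat q < r / 2" by blast
        obtain n where n: "d x (a n) < of_rat q" using dense[OF x q(1)] by blast
        have "mball (a n) (of_rat q) \<subseteq> mball x r"
        proof
          fix z assume z: "z \<in> mball (a n) (of_rat q)"
          then show "z \<in> mball x r" using x triangle[OF x aM[of n], of z] n q by auto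
        qed
        then have "(n, q) \<in> W" using r by (auto simp: W_def)
        then show "\<exists>p\<in>W. d x (a (fst p)) < of_rat (snd p)" using n by force
      next
        assume "\<exists>p\<in>W. d x (a (fst p)) < of_rat (snd p)"
        then obtain n q where "mball (a n) (of_rat q) \<subseteq> U" "d x (a n) < of_rat q"
          unfolding W_def by auto
        then show "x \<in> U" using x aM[of n] commute[of x "a n"] by auto
      qed
      have "g -` U \<inter> space ?R = (I \<inter> (\<Union>p\<in>W. {y \<in> space ?R. y (fst p) < of_rat (snd p)})) \<union>
         (if a 0 \<in> U then space ?R - I else {})"
      proof -
        have "g y \<in> U \<longleftrightarrow> (\<exists>p\<in>W. y (fst p) < of_rat (snd p))" if y: "y \<in> I" for y
        proof -
          obtain x where x: "x \<in> Ms" "e x = y" using Ie[OF y] by (elim bexE)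
          have "g y = x" using ge[OF x(1)] x(2) by simp
          moreover have "d x (a n) = y n" for n using x(2) by (auto simp: e_def)
          ultimately show ?thesis using eq[OF x(1)] by simp
        qed
        moreover have "g y = a 0" if "y \<notin> I" for y using that by (simp add: g_def)
        ultimately have gU: "g y \<in> U \<longleftrightarrow> (if y \<in> I then \<exists>p\<in>W. y (fst p) < of_rat (snd p) else a 0 \<in> U)" for y
          by presburger
        show ?thesis by (rule set_eqI) (simp add: space_PiM gU)
      qed
      also have "\<dots> \<in> sets ?R"
      proof -
        have "{y \<in> space ?R. y (fst p) < of_rat (snd p)} \<in> sets ?R" for p by measurable
        then have "(\<Union>p\<in>W. {y \<in> space ?R. y (fst p) < of_rat (snd p)}) \<in> sets ?R"
          by (intro sets.countable_UN'') auto
        then show ?thesis using I_sets by auto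
      qed
      finally show "g -` U \<inter> space ?R \<in> sets ?R" .
    qed
    show "g (e x) = x" if "x \<in> space M" for x using that ge spM by simp
  qed simp
qed

section \<open>Conditional laws\<close>

text \<open>A regular conditional law of \<open>Y\<close> given \<open>X\<close>: \<open>K y\<close>
  is a probability measure for every \<open>y\<close>, not just for almost every \<open>y\<close>.
  The identity is imposed on rectangles; \<open>cond_law_bind\<close> extends it to jointly
  measurable functions.\<close>

definition cond_law ::
    "'w measure \<Rightarrow> ('w \<Rightarrow> 'n) \<Rightarrow> 'n measure \<Rightarrow> ('w \<Rightarrow> 't) \<Rightarrow> 't measure \<Rightarrow> ('n \<Rightarrow> 't measure) \<Rightarrow> bool" where
  "cond_law M X N Y T K \<longleftrightarrow> K \<in> N \<rightarrow>\<^sub>M prob_algebra T \<and>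
    (\<forall>A\<in>sets N. \<forall>B\<in>sets T. emeasure M {\<omega> \<in> space M. X \<omega> \<in> A \<and> Y \<omega> \<in> B} =
      (\<integral>\<^sup>+\<omega>. indicator A (X \<omega>) * emeasure (K (X \<omega>)) B \<partial>M))"

lemma cond_lawD:
  assumes "cond_law M X N Y T K"
  shows "K \<in> N \<rightarrow>\<^sub>M prob_algebra T"
    and "A \<in> sets N \<Longrightarrow> B \<in> sets T \<Longrightarrow> emeasure M {\<omega> \<in> space M. X \<omega> \<in> A \<and> Y \<omega> \<in> B} =
      (\<integral>\<^sup>+\<omega>. indicator A (X \<omega>) * emeasure (K (X \<omega>)) B \<partial>M)"
  using assms unfolding cond_law_def by auto

lemma kernel_emeasure_measurable:
  "K \<in> N \<rightarrow>\<^sub>M prob_algebra T \<Longrightarrow> B \<in> sets T \<Longrightarrow> (\<lambda>y. emeasure (K y) B) \<in> borel_measurable N"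
  by (rule measurable_compose[OF measurable_prob_algebraD measurable_emeasure_subprob_algebra])

lemma kernel_space:
  assumes "K \<in> N \<rightarrow>\<^sub>M prob_algebra T" "y \<in> space N"
  shows "prob_space (K y)" "sets (K y) = sets T" "space (K y) = space T"
proof -
  have "K y \<in> space (prob_algebra T)" by (rule measurable_space[OF assms])
  then show "prob_space (K y)" "sets (K y) = sets T" by (auto simp: space_prob_algebra)
  then show "space (K y) = space T" by (auto dest: sets_eq_imp_space_eq)
qed

text \<open>A pi-lambda argument in \<open>B\<close> with \<open>A\<close> fixed. The complement
  step subtracts in the extended nonnegative reals, which is legitimate because the subtracted
  integral equals a probability.\<close>

lemma cond_law_generated:
  assumes M: "prob_space M" and X: "X \<in> M \<rightarrow>\<^sub>M N" and Y: "Y \<in> M \<rightarrow>\<^sub>M T" and K: "K \<in> N \<rightarrow>\<^sub>M prob_algebra T"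
    and gen: "sets T = sigma_sets (space T) G" "Int_stable G" "G \<subseteq> Pow (space T)"
    and eq: "\<And>A B. A \<in> sets N \<Longrightarrow> B \<in> G \<Longrightarrow> emeasure M {\<omega> \<in> space M. X \<omega> \<in> A \<and> Y \<omega> \<in> B} =
      (\<integral>\<^sup>+\<omega>. indicator A (X \<omega>) * emeasure (K (X \<omega>)) B \<partial>M)"
  shows "cond_law M X N Y T K"
  unfolding cond_law_def
proof (intro conjI K ballI)
  interpret prob_space M by fact
  fix A B assume A: "A \<in> sets N" and B: "B \<in> sets T"
  note [measurable] = A X Y
  have Km: "(\<lambda>\<omega>. emeasure (K (X \<omega>)) B) \<in> borel_measurable M" if "B \<in> sets T" for B
    by (rule measurable_compose[OF X kernel_emeasure_measurable[OF K that]])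
  have ms: "{\<omega> \<in> space M. X \<omega> \<in> A \<and> Y \<omega> \<in> B} \<in> sets M" if [measurable]: "B \<in> sets T" for B
    by measurable
  let ?P = "\<lambda>B. emeasure M {\<omega> \<in> space M. X \<omega> \<in> A \<and> Y \<omega> \<in> B} =
      (\<integral>\<^sup>+\<omega>. indicator A (X \<omega>) * emeasure (K (X \<omega>)) B \<partial>M)"
  show "?P B"
    using gen(2,3) B[unfolded gen(1)]
  proof (induction B rule: sigma_sets_induct_disjoint)
    case (basic B)
    then show ?case by (rule eq[OF A])
  next
    case (compl B)
    note B = compl(1)[folded gen(1)]
    let ?d = "\<integral>\<^sup>+\<omega>. indicator A (X \<omega>) * emeasure (K (X \<omega>)) B \<partial>M"
    have fin: "?d \<noteq> top" unfolding compl(2)[symmetric] by simp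
    have "emeasure M {\<omega> \<in> space M. X \<omega> \<in> A \<and> Y \<omega> \<in> B} + emeasure M {\<omega> \<in> space M. X \<omega> \<in> A \<and> Y \<omega> \<in> space T - B}
       = emeasure M {\<omega> \<in> space M. X \<omega> \<in> A}"
      by (subst plus_emeasure) (use ms[OF B] ms[of "space T - B"] B measurable_space[OF Y] in
        \<open>auto intro!: arg_cong[of _ _ "emeasure M"]\<close>)
    also have "\<dots> = (\<integral>\<^sup>+\<omega>. indicator A (X \<omega>) \<partial>M)"
    proof -
      have "emeasure M {\<omega> \<in> space M. X \<omega> \<in> A} = (\<integral>\<^sup>+\<omega>. indicator {\<omega> \<in> space M. X \<omega> \<in> A} \<omega> \<partial>M)"
        by (rule nn_integral_indicator[symmetric]) measurable
      then show ?thesis by (simp add: indicator_def cong: nn_integral_cong)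
    qed
    also have "\<dots> = (\<integral>\<^sup>+\<omega>. indicator A (X \<omega>) * emeasure (K (X \<omega>)) B + indicator A (X \<omega>) * emeasure (K (X \<omega>)) (space T - B) \<partial>M)"
    proof (rule nn_integral_cong)
      fix \<omega> assume "\<omega> \<in> space M"
      then have x: "X \<omega> \<in> space N" by (rule measurable_space[OF X])
      interpret K: prob_space "K (X \<omega>)" by (rule kernel_space[OF K x])
      have "emeasure (K (X \<omega>)) B + emeasure (K (X \<omega>)) (space T - B) = emeasure (K (X \<omega>)) (space T)"
        using B kernel_space[OF K x] sets.sets_into_space[OF B]
        by (subst plus_emeasure) (auto intro!: arg_cong[of _ _ "emeasure (K (X \<omega>))"])
      also have "\<dots> = 1" using K.emeasure_space_1 kernel_space[OF K x] by simp
      finally show "indicator A (X \<omega>) = indicator A (X \<omega>) * emeasure (K (X \<omega>)) B + indicator A (X \<omega>) * emeasure (K (X \<omega>)) (space T - B)"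
        by (simp add: distrib_left[symmetric])
    qed
    also have "\<dots> = ?d + (\<integral>\<^sup>+\<omega>. indicator A (X \<omega>) * emeasure (K (X \<omega>)) (space T - B) \<partial>M)"
      using B by (intro nn_integral_add borel_measurable_times_ennreal Km) auto
    finally show ?case unfolding compl(2) using fin by (simp add: ennreal_add_left_cancel)
  next
    case (union F)
    have F: "F i \<in> sets T" for i using union(2) gen(1) by auto
    have "emeasure M {\<omega> \<in> space M. X \<omega> \<in> A \<and> Y \<omega> \<in> (\<Union>i. F i)} = emeasure M (\<Union>i. {\<omega> \<in> space M. X \<omega> \<in> A \<and> Y \<omega> \<in> F i})"
      by (auto intro!: arg_cong[of _ _ "emeasure M"])
    also have "\<dots> = (\<Sum>i. emeasure M {\<omega> \<in> space M. X \<omega> \<in> A \<and> Y \<omega> \<in> F i})"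
      by (rule suminf_emeasure[symmetric]) (use ms[OF F] union(1) in \<open>auto simp: disjoint_family_on_def\<close>)
    also have "\<dots> = (\<Sum>i. \<integral>\<^sup>+\<omega>. indicator A (X \<omega>) * emeasure (K (X \<omega>)) (F i) \<partial>M)"
      by (simp only: union(3))
    also have "\<dots> = (\<integral>\<^sup>+\<omega>. (\<Sum>i. indicator A (X \<omega>) * emeasure (K (X \<omega>)) (F i)) \<partial>M)"
      by (rule nn_integral_suminf[symmetric]) (intro borel_measurable_times_ennreal Km F, measurable)
    also have "\<dots> = (\<integral>\<^sup>+\<omega>. indicator A (X \<omega>) * emeasure (K (X \<omega>)) (\<Union>i. F i) \<partial>M)"
    proof (rule nn_integral_cong)
      fix \<omega> assume "\<omega> \<in> space M"
      then have x: "X \<omega> \<in> space N" by (rule measurable_space[OF X])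
      show "(\<Sum>i. indicator A (X \<omega>) * emeasure (K (X \<omega>)) (F i)) = indicator A (X \<omega>) * emeasure (K (X \<omega>)) (\<Union>i. F i)"
        using F kernel_space(2)[OF K x] union(1)
        by (subst suminf_emeasure[symmetric]) auto
    qed
    finally show ?case .
  qed simp
qed

text \<open>Tested on the set where \<open>g < f\<close>: the integral of \<open>g\<close> there is
  finite and cancels, which leaves \<open>f - g\<close> with integral zero.\<close>

lemma AE_le_of_set_nn_integral_le:
  assumes [measurable]: "f \<in> borel_measurable D" "g \<in> borel_measurable D"
    and le: "\<And>A. A \<in> sets D \<Longrightarrow> (\<integral>\<^sup>+y. indicator A y * f y \<partial>D) \<le> (\<integral>\<^sup>+y. indicator A y * g y \<partial>D)"
    and fin: "(\<integral>\<^sup>+y. g y \<partial>D) < \<infinity>"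
  shows "AE y in D. f y \<le> g y"
proof -
  define A where "A = {y \<in> space D. g y < f y}"
  have A[measurable]: "A \<in> sets D" unfolding A_def by measurable
  have "(\<integral>\<^sup>+y. indicator A y * g y \<partial>D) \<le> (\<integral>\<^sup>+y. g y \<partial>D)"
    by (intro nn_integral_mono) (auto simp: indicator_def)
  then have fin: "(\<integral>\<^sup>+y. indicator A y * g y \<partial>D) \<noteq> \<infinity>" using fin by auto
  have "(\<integral>\<^sup>+y. indicator A y * f y \<partial>D) = (\<integral>\<^sup>+y. indicator A y * g y + indicator A y * (f y - g y) \<partial>D)"
  proof (intro nn_integral_cong)
    fix y assume "y \<in> space D"
    have "f y = g y + (f y - g y)" if "g y < f y"
      using diff_add_cancel_ennreal[OF less_imp_le[OF that]] by (metis add.commute)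
    then show "indicator A y * f y = indicator A y * g y + indicator A y * (f y - g y)"
      by (simp add: indicator_def A_def)
  qed
  also have "\<dots> = (\<integral>\<^sup>+y. indicator A y * g y \<partial>D) + (\<integral>\<^sup>+y. indicator A y * (f y - g y) \<partial>D)"
    by (rule nn_integral_add) auto
  finally have "(\<integral>\<^sup>+y. indicator A y * g y \<partial>D) + (\<integral>\<^sup>+y. indicator A y * (f y - g y) \<partial>D) \<le> (\<integral>\<^sup>+y. indicator A y * g y \<partial>D) + 0"
    using le[OF A] by simp
  then have "(\<integral>\<^sup>+y. indicator A y * (f y - g y) \<partial>D) = 0"
    using fin by (simp add: ennreal_add_left_cancel_le)
  then have "AE y in D. indicator A y * (f y - g y) = 0"
    by (subst (asm) nn_integral_0_iff_AE) auto
  then show ?thesis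
  proof (rule AE_mp[OF _ AE_I2], intro impI)
    fix y assume y: "y \<in> space D" "indicator A y * (f y - g y) = 0"
    then show "f y \<le> g y"
      by (cases "g y < f y") (auto simp: A_def diff_eq_0_iff_ennreal split: split_indicator_asm)
  qed
qed

text \<open>The Radon-Nikodym derivative of the image under \<open>X\<close> of \<open>M\<close>
  restricted to \<open>F\<close>, with respect to the image of \<open>M\<close>.\<close>

lemma conditional_probability_exists:
  assumes M: "prob_space M" and X[measurable]: "X \<in> M \<rightarrow>\<^sub>M N" and F[measurable]: "F \<in> sets M"
  shows "\<exists>f\<in>borel_measurable N. \<forall>A\<in>sets N.
    emeasure M {\<omega> \<in> F. X \<omega> \<in> A} = (\<integral>\<^sup>+y. indicator A y * f y \<partial>distr M N X)"
proof -
  interpret prob_space M by fact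
  let ?D = "distr M N X"
  interpret D: prob_space ?D by (rule prob_space_distr[OF X])
  let ?E = "distr (density M (indicator F)) N X"
  have X': "X \<in> density M (indicator F) \<rightarrow>\<^sub>M N" using X by simp
  have E: "emeasure ?E A = emeasure M {\<omega> \<in> F. X \<omega> \<in> A}" if [measurable]: "A \<in> sets N" for A
  proof -
    have "emeasure ?E A = (\<integral>\<^sup>+\<omega>. indicator F \<omega> * indicator (X -` A \<inter> space M) \<omega> \<partial>M)"
      by (subst emeasure_distr[OF X' that]) (simp add: emeasure_density)
    also have "\<dots> = (\<integral>\<^sup>+\<omega>. indicator {\<omega> \<in> F. X \<omega> \<in> A} \<omega> \<partial>M)"
      by (intro nn_integral_cong) (auto simp: indicator_def)
    also have "\<dots> = emeasure M {\<omega> \<in> F. X \<omega> \<in> A}"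
    proof (rule nn_integral_indicator)
      have "{\<omega> \<in> F. X \<omega> \<in> A} = F \<inter> (X -` A \<inter> space M)" using sets.sets_into_space[OF F] by auto
      also have "\<dots> \<in> sets M" by measurable
      finally show "{\<omega> \<in> F. X \<omega> \<in> A} \<in> sets M" .
    qed
    finally show ?thesis .
  qed
  have "absolutely_continuous ?D ?E"
    unfolding absolutely_continuous_def
  proof
    fix A assume "A \<in> null_sets ?D"
    then have A: "A \<in> sets N" and 0: "emeasure M (X -` A \<inter> space M) = 0"
      by (auto simp: null_sets_def emeasure_distr)
    have "emeasure ?E A \<le> emeasure M (X -` A \<inter> space M)"
      unfolding E[OF A] using A sets.sets_into_space[OF F] by (intro emeasure_mono) auto
    then show "A \<in> null_sets ?E" using A 0 by (simp add: null_sets_def)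
  qed
  then obtain f where f: "f \<in> borel_measurable ?D" "density ?D f = ?E"
    using D.Radon_Nikodym[of ?E] by auto
  show ?thesis
  proof (rule bexI[of _ f], intro ballI)
    fix A assume A: "A \<in> sets N"
    have "emeasure M {\<omega> \<in> F. X \<omega> \<in> A} = emeasure (density ?D f) A" using E[OF A] f(2) by simp
    also have "\<dots> = (\<integral>\<^sup>+y. indicator A y * f y \<partial>?D)"
      using f(1) A by (subst emeasure_density) (auto simp: mult.commute)
    finally show "emeasure M {\<omega> \<in> F. X \<omega> \<in> A} = (\<integral>\<^sup>+y. indicator A y * f y \<partial>?D)" .
  qed (use f in simp)
qed

section \<open>Regular conditional laws\<close>

text \<open>Conditional distribution functions: values at rational arguments come from Radon-Nikodym
  and have the right order and limits outside a null set. There they are made right-continuous and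
  yield an interval measure; on the null set a fixed law is substituted.\<close>

lemma cond_law_real_exists:
  fixes Y :: "'w \<Rightarrow> real"
  assumes M: "prob_space M" and X[measurable]: "X \<in> M \<rightarrow>\<^sub>M N" and Y[measurable]: "Y \<in> borel_measurable M"
  shows "\<exists>K. cond_law M X N Y borel K"
proof -
  interpret prob_space M by fact
  let ?D = "distr M N X"
  interpret D: prob_space ?D by (rule prob_space_distr[OF X])
  define pr where "pr A x = emeasure M {\<omega> \<in> space M. X \<omega> \<in> A \<and> Y \<omega> \<le> x}" for A x
  have "\<exists>f\<in>borel_measurable N. \<forall>A\<in>sets N. pr A (of_rat q) = (\<integral>\<^sup>+y. indicator A y * f y \<partial>?D)" for q
  proof -
    have "{\<omega> \<in> space M. Y \<omega> \<le> of_rat q} \<in> sets M" by measurable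
    from conditional_probability_exists[OF M X this] show ?thesis
      by (simp add: pr_def conj_commute conj_left_commute)
  qed
  then obtain f where f[measurable]: "\<And>q. f q \<in> borel_measurable N"
    and f_eq: "\<And>q A. A \<in> sets N \<Longrightarrow> pr A (of_rat q) = (\<integral>\<^sup>+y. indicator A y * f q y \<partial>?D)"
    by metis
  have pr_mono: "pr A x \<le> pr A y" if [measurable]: "A \<in> sets N" and "x \<le> y" for A x y
    unfolding pr_def by (rule emeasure_mono) (use that(2) in auto)
  have pr_A: "pr A x \<le> emeasure ?D A" if [measurable]: "A \<in> sets N" for A x
    unfolding pr_def by (subst emeasure_distr) (auto intro!: emeasure_mono)
  have one: "(\<integral>\<^sup>+y. indicator A y * (1::ennreal) \<partial>?D) = emeasure ?D A" if "A \<in> sets N" for A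
    using that by simp
  have f_fin: "(\<integral>\<^sup>+y. f q y \<partial>?D) < \<infinity>" for q
  proof -
    have "(\<integral>\<^sup>+y. f q y \<partial>?D) = pr (space N) (of_rat q)"
      by (subst f_eq) (auto intro!: nn_integral_cong)
    also have "\<dots> \<le> 1" using pr_A[of "space N"] D.emeasure_space_1 by simp
    finally show ?thesis by (simp add: le_less_trans)
  qed
  have AE_mono: "AE y in ?D. f q y \<le> f r y" if "q \<le> r" for q r
  proof (rule AE_le_of_set_nn_integral_le)
    fix A assume "A \<in> sets ?D"
    then show "(\<integral>\<^sup>+y. indicator A y * f q y \<partial>?D) \<le> (\<integral>\<^sup>+y. indicator A y * f r y \<partial>?D)"
      using pr_mono[of A "of_rat q" "of_rat r"] that by (simp add: f_eq of_rat_less_eq)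
  qed (use f_fin in simp_all)
  have AE_le1: "AE y in ?D. f q y \<le> 1" for q
  proof (rule AE_le_of_set_nn_integral_le)
    fix A assume "A \<in> sets ?D"
    then show "(\<integral>\<^sup>+y. indicator A y * f q y \<partial>?D) \<le> (\<integral>\<^sup>+y. indicator A y * 1 \<partial>?D)"
      using pr_A[of A "of_rat q"] one by (simp add: f_eq)
  qed (use D.emeasure_space_1 in simp_all)
  have AE_top: "AE y in ?D. 1 \<le> (SUP n::nat. f (of_nat n) y)"
  proof (rule AE_le_of_set_nn_integral_le)
    fix A assume "A \<in> sets ?D"
    then have A[measurable]: "A \<in> sets N" by simp
    have "emeasure ?D A = emeasure M (\<Union>n::nat. {\<omega> \<in> space M. X \<omega> \<in> A \<and> Y \<omega> \<le> n})"
      by (subst emeasure_distr) (auto intro!: arg_cong[of _ _ "emeasure M"] simp: real_arch_simple)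
    also have "\<dots> = (SUP n::nat. pr A n)"
      unfolding pr_def by (rule SUP_emeasure_incseq[symmetric]) (auto simp: incseq_def)
    also have "\<dots> = (SUP n::nat. \<integral>\<^sup>+y. indicator A y * f (of_nat n) y \<partial>?D)"
      using f_eq[OF A, of "of_nat n" for n] by simp
    also have "\<dots> \<le> (\<integral>\<^sup>+y. indicator A y * (SUP n::nat. f (of_nat n) y) \<partial>?D)"
      by (intro SUP_least nn_integral_mono mult_left_mono SUP_upper) auto
    finally show "(\<integral>\<^sup>+y. indicator A y * 1 \<partial>?D) \<le> (\<integral>\<^sup>+y. indicator A y * (SUP n::nat. f (of_nat n) y) \<partial>?D)"
      using one[OF A] by simp
  next
    have "AE y in ?D. \<forall>n::nat. f (of_nat n) y \<le> 1" using AE_le1 by (simp add: AE_all_countable)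
    then have "(\<integral>\<^sup>+y. (SUP n::nat. f (of_nat n) y) \<partial>?D) \<le> (\<integral>\<^sup>+y. 1 \<partial>?D)"
      by (intro nn_integral_mono_AE) (auto intro: SUP_least elim: eventually_mono)
    then show "(\<integral>\<^sup>+y. (SUP n::nat. f (of_nat n) y) \<partial>?D) < \<infinity>"
      using D.emeasure_space_1 by (auto simp: le_less_trans)
  qed simp_all
  have AE_bot: "AE y in ?D. (INF n::nat. f (- of_nat n) y) \<le> 0"
  proof (rule AE_le_of_set_nn_integral_le)
    fix A assume "A \<in> sets ?D"
    then have A[measurable]: "A \<in> sets N" by simp
    have "(\<integral>\<^sup>+y. indicator A y * (INF n::nat. f (- of_nat n) y) \<partial>?D)
      \<le> (INF n::nat. \<integral>\<^sup>+y. indicator A y * f (- of_nat n) y \<partial>?D)"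
      by (intro INF_greatest nn_integral_mono mult_left_mono INF_lower) auto
    also have "\<dots> = (INF n::nat. pr A (- real n))"
      using f_eq[OF A, of "- of_nat n" for n] by (simp add: of_rat_minus)
    also have "\<dots> = emeasure M (\<Inter>n::nat. {\<omega> \<in> space M. X \<omega> \<in> A \<and> Y \<omega> \<le> - n})"
      unfolding pr_def by (rule INF_emeasure_decseq) (auto simp: decseq_def)
    also have "(\<Inter>n::nat. {\<omega> \<in> space M. X \<omega> \<in> A \<and> Y \<omega> \<le> - n}) = {}"
    proof -
      have "\<exists>n::nat. \<not> Y \<omega> \<le> - n" for \<omega>
      proof -
        obtain n :: nat where "- Y \<omega> < n" using reals_Archimedean2 by blast
        then show ?thesis by (intro exI[of _ n]) simp
      qed
      then show ?thesis by auto
    qed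
    finally show "(\<integral>\<^sup>+y. indicator A y * (INF n::nat. f (- of_nat n) y) \<partial>?D) \<le> (\<integral>\<^sup>+y. indicator A y * 0 \<partial>?D)"
      by simp
  qed simp_all
  \<comment> \<open>Countably many conditions, each holding almost everywhere, that make the
    rational values \<open>f q y\<close> monotone in \<open>q\<close> with limits 0 and 1.\<close>
  define G where "G y \<longleftrightarrow> (\<forall>q r. q \<le> r \<longrightarrow> f q y \<le> f r y) \<and> (\<forall>q. f q y \<le> 1) \<and>
    1 \<le> (SUP n::nat. f (of_nat n) y) \<and> (INF n::nat. f (- of_nat n) y) \<le> 0" for y
  have [measurable]: "Measurable.pred N G" unfolding G_def by measurable
  have AE_G: "AE y in ?D. G y"
    unfolding G_def using AE_mono AE_le1 AE_top AE_bot
    by (intro AE_conjI) (simp_all add: AE_all_countable)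
  \<comment> \<open>Taking the infimum over rationals strictly above \<open>x\<close> forces
    right-continuity. Off \<open>G\<close> the function \<open>F\<close> introduced next is the
    distribution function of the point mass at 0.\<close>
  define h where "h y x = (INF q. if x < of_rat q then f q y else top)" for y and x :: real
  define F where "F y x = (if G y then enn2real (h y x) else of_bool (0 \<le> x))" for y x
  have h_lower: "h y x \<le> f q y" if "x < of_rat q" for y x q
    unfolding h_def by (rule INF_lower2[of q]) (use that in auto)
  have h_upper: "f q y \<le> h y x" if "G y" "of_rat q \<le> x" for y x q
    unfolding h_def
  proof (intro INF_greatest)
    fix r :: rat
    have "q \<le> r" if "x < of_rat r"
    proof -
      have "real_of_rat q \<le> of_rat r" using \<open>of_rat q \<le> x\<close> that by linarith
      then show ?thesis by (simp add: of_rat_less_eq)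
    qed
    then show "f q y \<le> (if x < of_rat r then f r y else top)" using \<open>G y\<close> by (auto simp: G_def)
  qed
  have h_le1: "h y x \<le> 1" if "G y" for y x
  proof -
    obtain q where "x < of_rat q" using of_rat_dense[of x "x + 1"] by auto
    from h_lower[OF this, of y] that show ?thesis unfolding G_def by (meson order_trans)
  qed
  have hF: "ennreal (F y x) = h y x" if "G y" for y x
    using h_le1[OF that, of x] that by (auto simp: F_def less_top[symmetric] intro!: ennreal_enn2real order.strict_trans1[OF h_le1])
  have F0: "0 \<le> F y x" for y x by (simp add: F_def)
  have F1: "F y x \<le> 1" for y x
    using h_le1[of y x] by (auto simp: F_def enn2real_leI)
  have F_mono: "F y x \<le> F y x'" if "x \<le> x'" for y x x'
  proof (cases "G y")
    case True
    have "h y x \<le> h y x'"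
      unfolding h_def using that by (intro INF_mono) auto
    then show ?thesis using hF[OF True] F0 ennreal_le_iff[of "F y x'" "F y x"] by simp
  next
    case False
    then show ?thesis using that by (auto simp: F_def)
  qed
  have F_lower: "F y x \<le> enn2real (f q y)" if "G y" "x < of_rat q" for y x q
  proof -
    have "f q y < top" using that(1) unfolding G_def by (meson ennreal_one_less_top le_less_trans)
    then show ?thesis using h_lower[OF that(2), of y] that(1) unfolding F_def by (simp add: enn2real_mono)
  qed
  have F_right: "continuous (at_right a) (F y)" for a y
    unfolding continuous_within
  proof (rule order_tendstoI)
    fix c assume "c < F y a"
    then have "\<And>x. a < x \<Longrightarrow> c < F y x" using F_mono[of a _ y] by (meson less_imp_le less_le_trans)
    then show "eventually (\<lambda>x. c < F y x) (at_right a)"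
      using eventually_at_right_less[of a] by (auto elim!: eventually_mono)
  next
    fix c assume c: "F y a < c"
    have "\<exists>b>a. F y b < c"
    proof (cases "G y")
      case True
      have "h y a < ennreal c" using c hF[OF True, of a] F0 by (metis ennreal_lessI le_less_trans)
      then obtain q where q: "(if a < of_rat q then f q y else top) < ennreal c"
        unfolding h_def INF_less_iff by auto
      then have aq: "a < of_rat q" "f q y < ennreal c" by (auto split: if_splits)
      obtain b where b: "a < b" "b < of_rat q" using dense[OF aq(1)] by blast
      have "ennreal (F y b) < ennreal c" using h_lower[OF b(2), of y] aq hF[OF True] by (simp add: le_less_trans)
      then show ?thesis using b F0 by (auto simp: ennreal_less_iff)
    next
      case False
      then show ?thesis using c by (intro exI[of _ "if a < 0 then a / 2 else a + 1"]) (auto simp: F_def split: if_splits)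
    qed
    then obtain b where b: "a < b" "F y b < c" by blast
    show "eventually (\<lambda>x. F y x < c) (at_right a)"
      unfolding eventually_at_right_field using b F_mono[of _ b y] by (auto intro!: exI[of _ b] elim!: le_less_trans[rotated])
  qed
  have F_top: "(F y \<longlongrightarrow> 1) at_top" for y
  proof (rule order_tendstoI)
    fix c :: real assume c: "c < 1"
    have "\<exists>b. c < F y b"
    proof (cases "G y")
      case True
      have "ennreal c < (SUP n::nat. f (of_nat n) y)"
        using c True unfolding G_def by (metis ennreal_1 ennreal_lessI less_le_trans zero_less_one)
      then obtain n :: nat where "ennreal c < f (of_nat n) y" unfolding less_SUP_iff by auto
      then have "ennreal c < ennreal (F y (real n))" using h_upper[OF True, of "of_nat n" "real n"] hF[OF True] by simp
      then show ?thesis by (metis F0 ennreal_leI not_le)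
    qed (use c in \<open>auto simp: F_def\<close>)
    then obtain b where "c < F y b" by blast
    then show "eventually (\<lambda>x. c < F y x) at_top"
      unfolding eventually_at_top_linorder using F_mono[of b _ y] by (meson less_le_trans)
  next
    fix c :: real assume c: "1 < c"
    then show "eventually (\<lambda>x. F y x < c) at_top"
      using F1 by (intro always_eventually) (auto intro: le_less_trans)
  qed
  have F_bot: "(F y \<longlongrightarrow> 0) at_bot" for y
  proof (rule order_tendstoI)
    fix c :: real assume c: "0 < c"
    have "\<exists>b. F y b < c"
    proof (cases "G y")
      case True
      have "(INF n::nat. f (- of_nat n) y) < ennreal c"
        using c True unfolding G_def by (simp add: le_less_trans)
      then obtain n :: nat where n: "f (- of_nat n) y < ennreal c" unfolding INF_less_iff by auto
      have "h y (- real n - 1) \<le> f (- of_nat n) y" by (rule h_lower) (simp add: of_rat_minus)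
      then have "ennreal (F y (- real n - 1)) < ennreal c" using n hF[OF True] by (simp add: le_less_trans)
      then show ?thesis by (metis F0 ennreal_less_iff)
    next
      case False
      then show ?thesis using c by (intro exI[of _ "-1"]) (simp add: F_def)
    qed
    then obtain b where b: "F y b < c" by blast
    have "F y x < c" if "x \<le> b" for x using F_mono[OF that, of y] b by linarith
    then show "eventually (\<lambda>x. F y x < c) at_bot"
      unfolding eventually_at_bot_linorder by blast
  next
    fix c :: real assume c: "c < 0"
    then show "eventually (\<lambda>x. c < F y x) at_bot"
      using F0 by (intro always_eventually) (auto intro: less_le_trans)
  qed
  define K where "K y = interval_measure (F y)" for y
  have K_Iic: "emeasure (K y) {..x} = F y x" for y x
    unfolding K_def by (rule emeasure_interval_measure_Iic[OF F_mono F_right F_bot])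
  have K_dist: "real_distribution (K y)" for y
    unfolding K_def by (rule real_distribution_interval_measure[OF F_mono F_right F_bot F_top])
  define R where "R = range (\<lambda>x::real. {..x})"
  have gen: "sets (borel :: real measure) = sigma_sets (space borel) R"
    unfolding R_def borel_eq_atMost by (simp add: sets_measure_of space_measure_of)
  have R: "Int_stable R" "R \<subseteq> Pow (space borel)" unfolding R_def Int_stable_def by auto
  have [measurable]: "(\<lambda>y. F y x) \<in> borel_measurable N" for x unfolding F_def h_def by measurable
  have K: "K \<in> N \<rightarrow>\<^sub>M prob_algebra borel"
  proof (rule measurable_prob_algebra_generated[OF gen R])
    fix y
    show "prob_space (K y)" by (rule real_distribution.axioms(1)[OF K_dist])
    show "sets (K y) = sets borel" by (simp add: K_def)
  next
    fix B assume "B \<in> R"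
    then obtain x where "B = {..x}" unfolding R_def by auto
    then show "(\<lambda>y. emeasure (K y) B) \<in> borel_measurable N" by (simp add: K_Iic)
  qed
  have "cond_law M X N Y borel K"
  proof (rule cond_law_generated[OF M X Y K gen R])
    fix A B assume A[measurable]: "A \<in> sets N" and "B \<in> R"
    then obtain x where B: "B = {..x}" unfolding R_def by auto
    define L where "L = (\<integral>\<^sup>+y. indicator A y * ennreal (F y x) \<partial>?D)"
    \<comment> \<open>At a real \<open>x\<close> no conditional probability has been chosen so far:
      a version \<open>g\<close> is taken here and compared with all \<open>f q\<close> for
      \<open>q\<close> above \<open>x\<close>. The reverse inequality lets \<open>q\<close> decrease
      to \<open>x\<close> and uses continuity of \<open>M\<close> from above.\<close>
    have "pr A x \<le> L"
    proof -
      have "{\<omega> \<in> space M. Y \<omega> \<le> x} \<in> sets M" by measurable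
      from conditional_probability_exists[OF M X this] obtain g where g[measurable]: "g \<in> borel_measurable N"
        and g_eq: "\<And>A. A \<in> sets N \<Longrightarrow> pr A x = (\<integral>\<^sup>+y. indicator A y * g y \<partial>?D)"
        by (auto simp add: pr_def conj_commute conj_left_commute)
      have "AE y in ?D. g y \<le> f q y" if "x < of_rat q" for q
      proof (rule AE_le_of_set_nn_integral_le)
        fix A assume "A \<in> sets ?D"
        then show "(\<integral>\<^sup>+y. indicator A y * g y \<partial>?D) \<le> (\<integral>\<^sup>+y. indicator A y * f q y \<partial>?D)"
          using pr_mono[of A x "of_rat q"] that by (simp add: f_eq[symmetric] g_eq[symmetric])
      qed (use f_fin in simp_all)
      then have "AE y in ?D. \<forall>q. x < of_rat q \<longrightarrow> g y \<le> f q y"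
        by (simp add: AE_all_countable)
      then have "AE y in ?D. g y \<le> F y x"
        using AE_G
      proof eventually_elim
        case (elim y)
        then have "g y \<le> h y x" unfolding h_def by (intro INF_greatest) auto
        then show ?case using hF[OF elim(2)] by simp
      qed
      then show ?thesis
        unfolding g_eq[OF A] L_def by (intro nn_integral_mono_AE) (auto elim!: eventually_mono intro!: mult_left_mono)
    qed
    moreover have "L \<le> pr A x"
    proof -
      have le: "L \<le> pr A (x + 1 / Suc n)" for n
      proof -
        obtain q where q: "x < of_rat q" "of_rat q < x + 1 / Suc n" using of_rat_dense[of x "x + 1 / Suc n"] by auto
        have "L \<le> (\<integral>\<^sup>+y. indicator A y * f q y \<partial>?D)"
          unfolding L_def using AE_G h_lower[OF q(1)] hF
          by (intro nn_integral_mono_AE) (auto elim!: eventually_mono intro!: mult_left_mono)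
        also have "\<dots> = pr A (of_rat q)" by (rule f_eq[OF A, symmetric])
        also have "\<dots> \<le> pr A (x + 1 / Suc n)" using q by (intro pr_mono A) simp
        finally show ?thesis .
      qed
      have "L \<le> (INF n. pr A (x + 1 / Suc n))" by (intro INF_greatest le)
      also have "\<dots> = emeasure M (\<Inter>n. {\<omega> \<in> space M. X \<omega> \<in> A \<and> Y \<omega> \<le> x + 1 / Suc n})"
        unfolding pr_def
      proof (rule INF_emeasure_decseq)
        have "1 / real (Suc n) \<le> 1 / real (Suc m)" if "m \<le> n" for m n using that by (auto simp: frac_le)
        then show "decseq (\<lambda>n. {\<omega> \<in> space M. X \<omega> \<in> A \<and> Y \<omega> \<le> x + 1 / Suc n})"
          by (force simp: decseq_def)
      qed auto
      also have "(\<Inter>n. {\<omega> \<in> space M. X \<omega> \<in> A \<and> Y \<omega> \<le> x + 1 / Suc n}) = {\<omega> \<in> space M. X \<omega> \<in> A \<and> Y \<omega> \<le> x}"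
      proof -
        have "Y \<omega> \<le> x" if *: "\<And>n. Y \<omega> \<le> x + 1 / Suc n" for \<omega>
        proof (rule ccontr)
          assume "\<not> Y \<omega> \<le> x"
          then obtain n where "1 / Suc n < Y \<omega> - x" using nat_approx_posE[of "Y \<omega> - x"] by auto
          then show False using *[of n] by linarith
        qed
        moreover have "Y \<omega> \<le> x + 1 / Suc n" if "Y \<omega> \<le> x" for \<omega> n
          using that by (simp add: add_increasing2)
        ultimately show ?thesis by blast
      qed
      finally show ?thesis by (simp add: pr_def)
    qed
    ultimately have "pr A x = (\<integral>\<^sup>+y. indicator A y * ennreal (F y x) \<partial>?D)" unfolding L_def by simp
    also have "\<dots> = (\<integral>\<^sup>+\<omega>. indicator A (X \<omega>) * ennreal (F (X \<omega>) x) \<partial>M)"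
      by (subst nn_integral_distr) auto
    finally show "emeasure M {\<omega> \<in> space M. X \<omega> \<in> A \<and> Y \<omega> \<in> B} =
      (\<integral>\<^sup>+\<omega>. indicator A (X \<omega>) * emeasure (K (X \<omega>)) B \<partial>M)"
      by (simp add: B K_Iic pr_def)
  qed
  then show ?thesis by blast
qed

lemma cond_law_distr:
  assumes K: "cond_law M X N Y T K" and g[measurable]: "g \<in> T \<rightarrow>\<^sub>M T'" and X: "X \<in> M \<rightarrow>\<^sub>M N" and Y: "Y \<in> M \<rightarrow>\<^sub>M T"
  shows "cond_law M X N (\<lambda>\<omega>. g (Y \<omega>)) T' (\<lambda>y. distr (K y) T' g)"
  unfolding cond_law_def
proof (intro conjI ballI)
  have Km: "K \<in> N \<rightarrow>\<^sub>M prob_algebra T" using K unfolding cond_law_def by blast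
  show "(\<lambda>y. distr (K y) T' g) \<in> N \<rightarrow>\<^sub>M prob_algebra T'"
    by (rule measurable_compose[OF Km measurable_distr_prob_space[OF g]])
  fix A B assume A: "A \<in> sets N" and B: "B \<in> sets T'"
  have gB: "g -` B \<inter> space T \<in> sets T" using B by measurable
  have "emeasure M {\<omega> \<in> space M. X \<omega> \<in> A \<and> g (Y \<omega>) \<in> B} = emeasure M {\<omega> \<in> space M. X \<omega> \<in> A \<and> Y \<omega> \<in> g -` B \<inter> space T}"
    using measurable_space[OF Y] by (auto intro!: arg_cong[of _ _ "emeasure M"])
  also have "\<dots> = (\<integral>\<^sup>+\<omega>. indicator A (X \<omega>) * emeasure (K (X \<omega>)) (g -` B \<inter> space T) \<partial>M)"
    using K A gB unfolding cond_law_def by blast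
  also have "\<dots> = (\<integral>\<^sup>+\<omega>. indicator A (X \<omega>) * emeasure (distr (K (X \<omega>)) T' g) B \<partial>M)"
  proof (rule nn_integral_cong)
    fix \<omega> assume "\<omega> \<in> space M"
    then have x: "X \<omega> \<in> space N" by (rule measurable_space[OF X])
    have "g \<in> K (X \<omega>) \<rightarrow>\<^sub>M T'" using g kernel_space(2)[OF Km x] by (simp cong: measurable_cong_sets)
    then show "indicator A (X \<omega>) * emeasure (K (X \<omega>)) (g -` B \<inter> space T) = indicator A (X \<omega>) * emeasure (distr (K (X \<omega>)) T' g) B"
      using B kernel_space(3)[OF Km x] by (simp add: emeasure_distr)
  qed
  finally show "emeasure M {\<omega> \<in> space M. X \<omega> \<in> A \<and> g (Y \<omega>) \<in> B} =
     (\<integral>\<^sup>+\<omega>. indicator A (X \<omega>) * emeasure (distr (K (X \<omega>)) T' g) B \<partial>M)" .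
qed

text \<open>The conditional law of the real code of \<open>Y\<close>, pushed forward by the decoding
  map.\<close>

lemma cond_law_exists:
  assumes M: "prob_space M" and X[measurable]: "X \<in> M \<rightarrow>\<^sub>M N" and Y[measurable]: "Y \<in> M \<rightarrow>\<^sub>M T"
    and T: "borel_retract T (borel :: real measure)"
  shows "\<exists>K. cond_law M X N Y T K"
proof -
  obtain e d where e[measurable]: "e \<in> borel_measurable T" and d[measurable]: "d \<in> (borel :: real measure) \<rightarrow>\<^sub>M T"
    and de: "\<And>x. x \<in> space T \<Longrightarrow> d (e x) = x"
    using T unfolding borel_retract_def by blast
  have "(\<lambda>\<omega>. e (Y \<omega>)) \<in> borel_measurable M" by measurable
  from cond_law_real_exists[OF M X this] obtain K where "cond_law M X N (\<lambda>\<omega>. e (Y \<omega>)) borel K" by blast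
  from cond_law_distr[OF this d X] have "cond_law M X N (\<lambda>\<omega>. d (e (Y \<omega>))) T (\<lambda>y. distr (K y) T d)"
    by simp
  moreover have "{\<omega> \<in> space M. X \<omega> \<in> A \<and> d (e (Y \<omega>)) \<in> B} = {\<omega> \<in> space M. X \<omega> \<in> A \<and> Y \<omega> \<in> B}" for A B
    using de measurable_space[OF Y] by auto
  ultimately show ?thesis unfolding cond_law_def by auto
qed

section \<open>Comparing conditional probabilities through second moments\<close>

text \<open>Each side is the integral of \<open>g\<close> against the image of \<open>M\<close>
  weighted by \<open>\<phi>\<close>, respectively \<open>\<phi>'\<close>; the hypothesis says that
  the two image measures agree on every set.\<close>

lemma nn_integral_eq_of_set_integral_eq:
  assumes X[measurable]: "X \<in> M \<rightarrow>\<^sub>M N" "X' \<in> M \<rightarrow>\<^sub>M N"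
    and \<phi>[measurable]: "\<phi> \<in> borel_measurable M" "\<phi>' \<in> borel_measurable M"
    and eq: "\<And>A. A \<in> sets N \<Longrightarrow>
      (\<integral>\<^sup>+\<omega>. indicator A (X \<omega>) * \<phi> \<omega> \<partial>M) = (\<integral>\<^sup>+\<omega>. indicator A (X' \<omega>) * \<phi>' \<omega> \<partial>M)"
    and g[measurable]: "g \<in> borel_measurable N"
  shows "(\<integral>\<^sup>+\<omega>. g (X \<omega>) * \<phi> \<omega> \<partial>M) = (\<integral>\<^sup>+\<omega>. g (X' \<omega>) * \<phi>' \<omega> \<partial>M)"
proof -
  have *: "emeasure (distr (density M \<phi>) N X) A = (\<integral>\<^sup>+\<omega>. indicator A (X \<omega>) * \<phi> \<omega> \<partial>M)"
    if [measurable]: "A \<in> sets N" "X \<in> M \<rightarrow>\<^sub>M N" "\<phi> \<in> borel_measurable M" for X \<phi> A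
    by (subst emeasure_distr)
      (auto simp: emeasure_density indicator_def intro!: nn_integral_cong)
  have "distr (density M \<phi>) N X = distr (density M \<phi>') N X'"
    by (rule measure_eqI) (simp_all add: * eq)
  then have "(\<integral>\<^sup>+y. g y \<partial>distr (density M \<phi>) N X) = (\<integral>\<^sup>+y. g y \<partial>distr (density M \<phi>') N X')" by simp
  then show ?thesis by (simp add: nn_integral_distr nn_integral_density mult.commute)
qed

lemma ennreal_cancel_le:
  fixes x a b c :: ennreal
  assumes "x + a \<le> b" "b \<le> a" "a < \<infinity>"
  shows "x = 0"
proof -
  have "a + x \<le> a + 0" using assms by (simp add: add.commute order_trans)
  then show ?thesis using assms(3) by (auto simp: ennreal_add_left_cancel_le)
qed

text \<open>
  The event \<open>F\<close> has the same joint law with \<open>X\<close> and with \<open>X'\<close>, so its conditional probabilities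
  \<open>q X\<close> and \<open>q X'\<close> have the same second moment. As \<open>X'\<close> is a function of \<open>Y\<close>, which in turn is a
  function of \<open>X\<close>, that moment is also squeezed against the one of \<open>p Y\<close>; hence \<open>q X = p Y\<close>
  almost surely.
\<close>

lemma conditional_probability_enlarge:
  fixes p :: "'d \<Rightarrow> real"
  assumes M: "prob_space M"
    and X[measurable]: "X \<in> M \<rightarrow>\<^sub>M N" "X' \<in> M \<rightarrow>\<^sub>M N" and Y[measurable]: "Y \<in> M \<rightarrow>\<^sub>M D"
    and F[measurable]: "F \<in> sets M"
    and \<Delta>[measurable]: "\<Delta> \<in> D \<rightarrow>\<^sub>M N" and X': "\<And>\<omega>. \<omega> \<in> space M \<Longrightarrow> X' \<omega> = \<Delta> (Y \<omega>)"
    and \<Gamma>[measurable]: "\<Gamma> \<in> N \<rightarrow>\<^sub>M D" and Y': "\<And>\<omega>. \<omega> \<in> space M \<Longrightarrow> Y \<omega> = \<Gamma> (X \<omega>)"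
    and inv: "\<And>A. A \<in> sets N \<Longrightarrow>
      (\<integral>\<^sup>+\<omega>. indicator A (X \<omega>) \<partial>M) = (\<integral>\<^sup>+\<omega>. indicator A (X' \<omega>) \<partial>M)"
    and invF: "\<And>A. A \<in> sets N \<Longrightarrow>
      (\<integral>\<^sup>+\<omega>. indicator A (X \<omega>) * indicator F \<omega> \<partial>M) = (\<integral>\<^sup>+\<omega>. indicator A (X' \<omega>) * indicator F \<omega> \<partial>M)"
    and p[measurable]: "p \<in> borel_measurable D" and p01: "\<And>y. 0 \<le> p y" "\<And>y. p y \<le> 1"
    and p_eq: "\<And>A. A \<in> sets D \<Longrightarrow>
      (\<integral>\<^sup>+\<omega>. indicator A (Y \<omega>) * indicator F \<omega> \<partial>M) = (\<integral>\<^sup>+\<omega>. indicator A (Y \<omega>) * ennreal (p (Y \<omega>)) \<partial>M)"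
    and A: "A \<in> sets N"
  shows "(\<integral>\<^sup>+\<omega>. indicator A (X \<omega>) * indicator F \<omega> \<partial>M) = (\<integral>\<^sup>+\<omega>. indicator A (X \<omega>) * ennreal (p (Y \<omega>)) \<partial>M)"
proof -
  interpret prob_space M by fact
  have "(indicator F :: 'a \<Rightarrow> real) \<in> borel_measurable M" by measurable
  from cond_law_real_exists[OF M X(1) this] obtain \<kappa>
    where \<kappa>: "cond_law M X N (indicator F) (borel :: real measure) \<kappa>" by blast
  then have \<kappa>m: "\<kappa> \<in> N \<rightarrow>\<^sub>M prob_algebra (borel :: real measure)" unfolding cond_law_def by blast
  \<comment> \<open>Reading the probability as the mass at 1 of a conditional law of
    \<open>indicator F\<close> keeps it at most 1 at every point of \<open>space N\<close>, and the
    default 0 extends the bounds to all arguments.\<close>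
  define q where "q y = (if y \<in> space N then measure (\<kappa> y) {1} else 0)" for y
  have q01: "0 \<le> q y" "q y \<le> 1" for y
    using kernel_space(1)[OF \<kappa>m, of y] prob_space.prob_le_1 by (auto simp: q_def)
  have qm[measurable]: "q \<in> borel_measurable N"
  proof -
    have "(\<lambda>y. measure (\<kappa> y) {1}) \<in> borel_measurable N"
      by (rule measurable_compose[OF \<kappa>m measurable_measure_prob_algebra]) simp
    then show ?thesis by (rule measurable_cong[THEN iffD1, rotated]) (simp add: q_def)
  qed
  have q_eq: "(\<integral>\<^sup>+\<omega>. indicator A (X \<omega>) * indicator F \<omega> \<partial>M) = (\<integral>\<^sup>+\<omega>. indicator A (X \<omega>) * ennreal (q (X \<omega>)) \<partial>M)"
    if [measurable]: "A \<in> sets N" for A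
  proof -
    have "(\<integral>\<^sup>+\<omega>. indicator A (X \<omega>) * indicator F \<omega> \<partial>M) = (\<integral>\<^sup>+\<omega>. indicator {\<omega> \<in> space M. X \<omega> \<in> A \<and> indicator F \<omega> \<in> {1::real}} \<omega> \<partial>M)"
      by (intro nn_integral_cong) (auto simp: indicator_def)
    also have "\<dots> = emeasure M {\<omega> \<in> space M. X \<omega> \<in> A \<and> indicator F \<omega> \<in> {1::real}}"
      by (rule nn_integral_indicator) measurable
    also have "\<dots> = (\<integral>\<^sup>+\<omega>. indicator A (X \<omega>) * emeasure (\<kappa> (X \<omega>)) {1} \<partial>M)"
      by (rule cond_lawD(2)[OF \<kappa> that]) simp
    also have "\<dots> = (\<integral>\<^sup>+\<omega>. indicator A (X \<omega>) * ennreal (q (X \<omega>)) \<partial>M)"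
    proof (rule nn_integral_cong)
      fix \<omega> assume "\<omega> \<in> space M"
      then have x: "X \<omega> \<in> space N" by (rule measurable_space[OF X(1)])
      interpret K: prob_space "\<kappa> (X \<omega>)" by (rule kernel_space[OF \<kappa>m x])
      show "indicator A (X \<omega>) * emeasure (\<kappa> (X \<omega>)) {1} = indicator A (X \<omega>) * ennreal (q (X \<omega>))"
        using x by (simp add: q_def K.emeasure_eq_measure indicator_def)
    qed
    finally show ?thesis .
  qed
  have q_ext: "(\<integral>\<^sup>+\<omega>. g (X \<omega>) * indicator F \<omega> \<partial>M) = (\<integral>\<^sup>+\<omega>. g (X \<omega>) * ennreal (q (X \<omega>)) \<partial>M)"
    if "g \<in> borel_measurable N" for g
    by (rule nn_integral_eq_of_set_integral_eq[OF X(1) X(1) _ _ q_eq that]) measurable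
  have p_ext: "(\<integral>\<^sup>+\<omega>. g (Y \<omega>) * indicator F \<omega> \<partial>M) = (\<integral>\<^sup>+\<omega>. g (Y \<omega>) * ennreal (p (Y \<omega>)) \<partial>M)"
    if "g \<in> borel_measurable D" for g
    by (rule nn_integral_eq_of_set_integral_eq[OF Y Y _ _ p_eq that]) measurable
  define a where "a = (\<integral>\<^sup>+\<omega>. ennreal (q (X \<omega>)) * q (X \<omega>) \<partial>M)"
  define b where "b = (\<integral>\<^sup>+\<omega>. ennreal (p (Y \<omega>)) * p (Y \<omega>) \<partial>M)"
  have bnd: "(\<integral>\<^sup>+\<omega>. ennreal (f \<omega>) * ennreal (g \<omega>) \<partial>M) < \<infinity>"
    if "\<And>\<omega>. 0 \<le> f \<omega>" "\<And>\<omega>. f \<omega> \<le> 1" "\<And>\<omega>. 0 \<le> g \<omega>" "\<And>\<omega>. g \<omega> \<le> 1" for f g :: "'a \<Rightarrow> real"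
  proof -
    have "ennreal (f \<omega>) * ennreal (g \<omega>) \<le> 1" for \<omega>
      using mult_mono[of "ennreal (f \<omega>)" 1 "ennreal (g \<omega>)" 1] that by (simp add: ennreal_le_1)
    then have "(\<integral>\<^sup>+\<omega>. ennreal (f \<omega>) * ennreal (g \<omega>) \<partial>M) \<le> (\<integral>\<^sup>+\<omega>. 1 \<partial>M)" by (intro nn_integral_mono)
    also have "\<dots> = 1" using emeasure_space_1 by simp
    finally show ?thesis by (simp add: le_less_trans)
  qed
  have afin: "a < \<infinity>" and bfin: "b < \<infinity>" unfolding a_def b_def by (intro bnd q01 p01)+
  have a': "(\<integral>\<^sup>+\<omega>. ennreal (q (X' \<omega>)) * q (X' \<omega>) \<partial>M) = a"
    using nn_integral_eq_of_set_integral_eq[OF X(1,2), of "\<lambda>_. 1" "\<lambda>_. 1" "\<lambda>y. ennreal (q y) * q y"] inv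
    unfolding a_def by simp
  \<comment> \<open>The event replaces one factor \<open>q X\<close>, the equality of joint laws
    exchanges \<open>X\<close> for \<open>X'\<close>, and since \<open>X'\<close> is a function of
    \<open>Y\<close> the event may then be replaced by \<open>p Y\<close>.\<close>
  have aF: "a = (\<integral>\<^sup>+\<omega>. ennreal (q (X' \<omega>)) * p (Y \<omega>) \<partial>M)"
  proof -
    have "a = (\<integral>\<^sup>+\<omega>. ennreal (q (X \<omega>)) * indicator F \<omega> \<partial>M)"
      unfolding a_def by (rule q_ext[symmetric], rule measurable_compose[OF qm measurable_ennreal])
    also have "\<dots> = (\<integral>\<^sup>+\<omega>. ennreal (q (X' \<omega>)) * indicator F \<omega> \<partial>M)"
      by (rule nn_integral_eq_of_set_integral_eq[OF X _ _ invF]; measurable)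
    also have "\<dots> = (\<integral>\<^sup>+\<omega>. ennreal (q (\<Delta> (Y \<omega>))) * indicator F \<omega> \<partial>M)"
      by (intro nn_integral_cong) (simp add: X')
    also have "\<dots> = (\<integral>\<^sup>+\<omega>. ennreal (q (\<Delta> (Y \<omega>))) * p (Y \<omega>) \<partial>M)"
      by (rule p_ext) measurable
    also have "\<dots> = (\<integral>\<^sup>+\<omega>. ennreal (q (X' \<omega>)) * p (Y \<omega>) \<partial>M)"
      by (intro nn_integral_cong) (simp add: X')
    finally show ?thesis .
  qed
  have bF: "b = (\<integral>\<^sup>+\<omega>. ennreal (q (X \<omega>)) * p (Y \<omega>) \<partial>M)"
  proof -
    have "b = (\<integral>\<^sup>+\<omega>. ennreal (p (Y \<omega>)) * indicator F \<omega> \<partial>M)"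
      unfolding b_def by (rule p_ext[symmetric]) measurable
    also have "\<dots> = (\<integral>\<^sup>+\<omega>. ennreal (p (\<Gamma> (X \<omega>))) * indicator F \<omega> \<partial>M)"
      by (intro nn_integral_cong) (simp add: Y')
    also have "\<dots> = (\<integral>\<^sup>+\<omega>. ennreal (p (\<Gamma> (X \<omega>))) * q (X \<omega>) \<partial>M)"
      by (rule q_ext) measurable
    also have "\<dots> = (\<integral>\<^sup>+\<omega>. ennreal (q (X \<omega>)) * p (Y \<omega>) \<partial>M)"
      by (intro nn_integral_cong) (simp add: Y' mult.commute)
    finally show ?thesis .
  qed
  \<comment> \<open>From \<open>2xy \<le> x^2 + y^2\<close> with \<open>x = q X'\<close> and
    \<open>y = p Y\<close>: integration gives \<open>2a \<le> a + b\<close>, because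
    \<open>q X'\<close> has the same second moment as \<open>q X\<close>.\<close>
  have "a \<le> b"
  proof -
    have "a + a = (\<integral>\<^sup>+\<omega>. ennreal (q (X' \<omega>)) * p (Y \<omega>) + ennreal (q (X' \<omega>)) * p (Y \<omega>) \<partial>M)"
      by (subst (1 2) aF) (rule nn_integral_add[symmetric]; measurable)
    also have "\<dots> \<le> (\<integral>\<^sup>+\<omega>. ennreal (q (X' \<omega>)) * q (X' \<omega>) + ennreal (p (Y \<omega>)) * p (Y \<omega>) \<partial>M)"
    proof (rule nn_integral_mono)
      fix \<omega>
      have "q (X' \<omega>) * p (Y \<omega>) + q (X' \<omega>) * p (Y \<omega>) \<le> q (X' \<omega>) * q (X' \<omega>) + p (Y \<omega>) * p (Y \<omega>)"
        using sum_squares_bound[of "q (X' \<omega>)" "p (Y \<omega>)"] by (simp add: power2_eq_square ac_simps)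
      then show "ennreal (q (X' \<omega>)) * p (Y \<omega>) + ennreal (q (X' \<omega>)) * p (Y \<omega>)
          \<le> ennreal (q (X' \<omega>)) * q (X' \<omega>) + ennreal (p (Y \<omega>)) * p (Y \<omega>)"
        using q01 p01 by (simp add: ennreal_mult[symmetric] ennreal_plus[symmetric] del: ennreal_plus)
    qed
    also have "\<dots> = a + b" unfolding b_def a'[symmetric] by (rule nn_integral_add) measurable
    finally show ?thesis using afin by (auto simp: ennreal_add_left_cancel_le)
  qed
  \<comment> \<open>The second moment of \<open>q X - p Y\<close> is \<open>a - 2b + b\<close>,
    written additively to avoid subtraction of extended reals. Together with
    \<open>a \<le> b\<close> it must vanish.\<close>
  have "(\<integral>\<^sup>+\<omega>. ennreal ((q (X \<omega>) - p (Y \<omega>))\<^sup>2) \<partial>M) + (b + b) = a + b"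
  proof -
    have "(\<integral>\<^sup>+\<omega>. ennreal ((q (X \<omega>) - p (Y \<omega>))\<^sup>2) \<partial>M) + (b + b) =
      (\<integral>\<^sup>+\<omega>. ennreal ((q (X \<omega>) - p (Y \<omega>))\<^sup>2) + (ennreal (q (X \<omega>)) * p (Y \<omega>) + ennreal (q (X \<omega>)) * p (Y \<omega>)) \<partial>M)"
      by (subst (1 2) bF) (simp add: nn_integral_add)
    also have "\<dots> = (\<integral>\<^sup>+\<omega>. ennreal (q (X \<omega>)) * q (X \<omega>) + ennreal (p (Y \<omega>)) * p (Y \<omega>) \<partial>M)"
    proof (rule nn_integral_cong)
      fix \<omega>
      have "(q (X \<omega>) - p (Y \<omega>))\<^sup>2 + (q (X \<omega>) * p (Y \<omega>) + q (X \<omega>) * p (Y \<omega>)) = q (X \<omega>) * q (X \<omega>) + p (Y \<omega>) * p (Y \<omega>)"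
        by (simp add: power2_eq_square algebra_simps)
      then show "ennreal ((q (X \<omega>) - p (Y \<omega>))\<^sup>2) + (ennreal (q (X \<omega>)) * p (Y \<omega>) + ennreal (q (X \<omega>)) * p (Y \<omega>))
          = ennreal (q (X \<omega>)) * q (X \<omega>) + ennreal (p (Y \<omega>)) * p (Y \<omega>)"
        using q01 p01 by (simp add: ennreal_mult[symmetric] ennreal_plus[symmetric] del: ennreal_plus)
    qed
    also have "\<dots> = a + b" unfolding a_def b_def by (rule nn_integral_add) measurable
    finally show ?thesis .
  qed
  then have "(\<integral>\<^sup>+\<omega>. ennreal ((q (X \<omega>) - p (Y \<omega>))\<^sup>2) \<partial>M) = 0"
  proof (rule ennreal_cancel_le[OF eq_refl])
    show "a + b \<le> b + b" using \<open>a \<le> b\<close> by (rule add_right_mono)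
    show "b + b < \<infinity>" using bfin by simp
  qed
  then have "AE \<omega> in M. ennreal ((q (X \<omega>) - p (Y \<omega>))\<^sup>2) = 0"
    by (subst (asm) nn_integral_0_iff_AE) measurable
  then have "AE \<omega> in M. q (X \<omega>) = p (Y \<omega>)" by (rule eventually_mono) (simp add: ennreal_eq_0_iff)
  then have "(\<integral>\<^sup>+\<omega>. indicator A (X \<omega>) * ennreal (q (X \<omega>)) \<partial>M) = (\<integral>\<^sup>+\<omega>. indicator A (X \<omega>) * ennreal (p (Y \<omega>)) \<partial>M)"
    by (intro nn_integral_cong_AE) (auto elim!: eventually_mono)
  then show ?thesis using q_eq[OF A] by simp
qed

section \<open>From finitely supported permutations to arbitrary injections\<close>

text \<open>The bijection from \<open>?A\<close> to \<open>?B\<close> prescribed by \<open>g\<close>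
  and \<open>h\<close> is closed up to a permutation of \<open>?A \<union> ?B\<close> by any
  bijection from \<open>?B - ?A\<close> to \<open>?A - ?B\<close>, two finite sets of the same
  size.\<close>

lemma finite_partial_injection_extends:
  assumes F: "finite F" and g: "inj_on g F" and h: "inj_on h F" and S: "g ` F \<subseteq> S" "h ` F \<subseteq> S"
  shows "\<exists>\<pi>. \<pi> permutes S \<and> finite {x. \<pi> x \<noteq> x} \<and> (\<forall>x\<in>F. \<pi> (g x) = h x)"
proof -
  let ?A = "g ` F" and ?B = "h ` F"
  have fin: "finite ?A" "finite ?B" using F by auto
  have "card ?A = card ?B" using g h by (simp add: card_image)
  then have "card (?B - ?A) = card (?A - ?B)"
    using fin by (metis card_Diff_subset_Int Int_commute finite_Int)
  then obtain r where r: "bij_betw r (?B - ?A) (?A - ?B)"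
    using fin by (meson finite_Diff finite_same_card_bij)
  have p: "bij_betw (h \<circ> inv_into F g) ?A ?B"
    using bij_betw_trans[OF bij_betw_inv_into[OF inj_on_imp_bij_betw[OF g]] inj_on_imp_bij_betw[OF h]] .
  define \<pi> where "\<pi> x = (if x \<in> ?A then (h \<circ> inv_into F g) x else if x \<in> ?B then r x else x)" for x
  have "bij_betw \<pi> ?A ?B" by (rule bij_betw_cong[THEN iffD1, OF _ p]) (simp add: \<pi>_def)
  moreover have "bij_betw \<pi> (?B - ?A) (?A - ?B)" by (rule bij_betw_cong[THEN iffD1, OF _ r]) (auto simp: \<pi>_def)
  ultimately have "bij_betw \<pi> (?A \<union> (?B - ?A)) (?B \<union> (?A - ?B))" by (rule bij_betw_combine) auto
  then have "bij_betw \<pi> (?A \<union> ?B) (?A \<union> ?B)" by (simp add: Un_commute)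
  then have \<pi>: "\<pi> permutes (?A \<union> ?B)" by (rule bij_imp_permutes) (auto simp: \<pi>_def)
  have "\<pi> permutes S" by (rule permutes_subset[OF \<pi>]) (use S in auto)
  moreover have "finite {x. \<pi> x \<noteq> x}"
    by (rule finite_subset[of _ "?A \<union> ?B"]) (use fin in \<open>auto simp: \<pi>_def\<close>)
  moreover have "\<forall>x\<in>F. \<pi> (g x) = h x" using g by (auto simp: \<pi>_def)
  ultimately show ?thesis by blast
qed

lemma relabel_apply: "\<psi> \<in> (\<Union>i\<in>I. Injs i X) \<Longrightarrow> relabel g I X \<omega> \<psi> = \<omega> (map g \<psi>)"
  by (simp add: relabel_def)

text \<open>A finite cylinder looks at finitely many vertices only, and on these \<open>h\<close>
  equals \<open>\<pi> \<circ> g\<close> for some finitely supported permutation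
  \<open>\<pi>\<close>. A law on the product is determined by its finite cylinders.\<close>

lemma exchangeable_relabel_injection:
  fixes X :: "'t set"
  assumes ex: "exchangeable_hypergraph k K S \<mu>"
    and g: "inj_on g X" "g ` X \<subseteq> S" and h: "inj_on h X" "h ` X \<subseteq> S"
  shows "distr \<mu> (colourings K {..k} X) (relabel g {..k} X) = distr \<mu> (colourings K {..k} X) (relabel h {..k} X)"
proof -
  interpret prob_space \<mu> using ex by (simp add: exchangeable_hypergraph_def)
  have s\<mu>: "sets \<mu> = sets (colourings K {..k} S)" using ex by (simp add: exchangeable_hypergraph_def)
  have m: "relabel e {..k} X \<in> \<mu> \<rightarrow>\<^sub>M colourings K {..k} X" if "inj_on e X" "e ` X \<subseteq> S" for e
    using relabel_measurable[OF that, of "{..k}" K] by (simp cong: measurable_cong_sets[OF s\<mu> refl])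
  let ?I = "\<Union>i\<in>{..k}. Injs i X" and ?M = "\<lambda>\<phi>::'t list. K (length \<phi>)"
  show ?thesis
  proof (rule measure_eqI_PiM_infinite[where I = ?I and M = ?M])
    show "finite_measure (distr \<mu> (colourings K {..k} X) (relabel g {..k} X))"
      by (rule finite_measure_distr[OF m[OF g]])
    fix J A assume J: "finite J" "J \<subseteq> ?I" and A: "\<And>i. i \<in> J \<Longrightarrow> A i \<in> sets (?M i)"
    let ?E = "prod_emb ?I ?M J (Pi\<^sub>E J A)"
    have E: "?E \<in> sets (colourings K {..k} X)" unfolding colourings_def
      by (rule sets_PiM_I) (use J A in auto)
    define F where "F = (\<Union>\<psi>\<in>J. set \<psi>)"
    have "finite F" unfolding F_def using J by auto
    have "F \<subseteq> X" using J(2) by (auto simp: F_def Injs_def)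
    obtain \<pi> where \<pi>: "\<pi> permutes S" "finite {x. \<pi> x \<noteq> x}" "\<And>x. x \<in> F \<Longrightarrow> \<pi> (g x) = h x"
      using finite_partial_injection_extends[OF \<open>finite F\<close> inj_on_subset[OF g(1) \<open>F \<subseteq> X\<close>] inj_on_subset[OF h(1) \<open>F \<subseteq> X\<close>], of S]
        g(2) h(2) \<open>F \<subseteq> X\<close> by blast
    have inv: "distr \<mu> (colourings K {..k} S) (relabel \<pi> {..k} S) = \<mu>"
      using ex \<pi> by (simp add: exchangeable_hypergraph_def)
    have \<pi>m: "relabel \<pi> {..k} S \<in> \<mu> \<rightarrow>\<^sub>M colourings K {..k} S"
      using relabel_measurable[OF permutes_inj_on[OF \<pi>(1)] equalityD1[OF permutes_image[OF \<pi>(1)]], of "{..k}" K]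
      by (simp cong: measurable_cong_sets[OF s\<mu> refl])
    have sp: "space \<mu> = space (colourings K {..k} S)" using s\<mu> by (rule sets_eq_imp_space_eq)
    have eqE: "relabel h {..k} X \<omega> \<in> ?E \<longleftrightarrow> relabel g {..k} X (relabel \<pi> {..k} S \<omega>) \<in> ?E" if \<omega>: "\<omega> \<in> space \<mu>" for \<omega>
    proof -
      have "relabel h {..k} X \<omega> \<in> space (PiM ?I ?M)"
        using measurable_space[OF m[OF h] \<omega>] by (simp add: colourings_def)
      moreover have "relabel g {..k} X (relabel \<pi> {..k} S \<omega>) \<in> space (PiM ?I ?M)"
        using measurable_space[OF relabel_measurable[OF g] measurable_space[OF \<pi>m \<omega>]] by (simp add: colourings_def)
      moreover have "relabel h {..k} X \<omega> \<psi> = relabel g {..k} X (relabel \<pi> {..k} S \<omega>) \<psi>" if "\<psi> \<in> J" for \<psi>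
      proof -
        have "\<psi> \<in> ?I" using that J by blast
        moreover have "\<pi> (g x) = h x" if "x \<in> set \<psi>" for x
          using \<pi>(3)[of x] that \<open>\<psi> \<in> J\<close> by (auto simp: F_def)
        then have "map h \<psi> = map (\<pi> \<circ> g) \<psi>" by simp
        ultimately show ?thesis unfolding relabel_relabel[OF g] by (simp only: relabel_apply)
      qed
      ultimately show ?thesis
        using J(2) by (auto simp: prod_emb_def space_PiM PiE_iff restrict_def extensional_def)
    qed
    have "emeasure (distr \<mu> (colourings K {..k} X) (relabel h {..k} X)) ?E
       = emeasure \<mu> (relabel h {..k} X -` ?E \<inter> space \<mu>)"
      by (rule emeasure_distr[OF m[OF h] E])
    also have "relabel h {..k} X -` ?E \<inter> space \<mu> = relabel \<pi> {..k} S -` (relabel g {..k} X -` ?E \<inter> space \<mu>) \<inter> space \<mu>"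
      using eqE measurable_space[OF \<pi>m] sp by auto
    also have "emeasure \<mu> \<dots> = emeasure (distr \<mu> (colourings K {..k} S) (relabel \<pi> {..k} S)) (relabel g {..k} X -` ?E \<inter> space \<mu>)"
      using measurable_sets[OF m[OF g] E] s\<mu> by (intro emeasure_distr[symmetric] \<pi>m) simp
    also have "\<dots> = emeasure \<mu> (relabel g {..k} X -` ?E \<inter> space \<mu>)" unfolding inv ..
    also have "\<dots> = emeasure (distr \<mu> (colourings K {..k} X) (relabel g {..k} X)) ?E"
      by (rule emeasure_distr[OF m[OF g] E, symmetric])
    finally show "emeasure (distr \<mu> (colourings K {..k} X) (relabel g {..k} X)) ?E
        = emeasure (distr \<mu> (colourings K {..k} X) (relabel h {..k} X)) ?E" ..
  qed (simp_all add: colourings_def)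
qed

section \<open>Exchangeable colourings with auxiliary vertices\<close>

lemma countable_Injs: "countable X \<Longrightarrow> countable (\<Union>i\<in>I. Injs i X)"
  by (rule countable_subset[of _ "lists X"]) (auto simp: Injs_def)

lemma relabel_in_space:
  "inj_on e A \<Longrightarrow> e ` A \<subseteq> B \<Longrightarrow> \<omega> \<in> space (colourings Z I B) \<Longrightarrow> relabel e I A \<omega> \<in> space (colourings Z I A)"
  by (rule measurable_space[OF relabel_measurable])

lemma relabel_ident:
  assumes "\<omega> \<in> space (colourings Z I A)" "\<And>x. x \<in> A \<Longrightarrow> e x = x"
  shows "relabel e I A \<omega> = \<omega>"
proof
  fix \<phi>
  show "relabel e I A \<omega> \<phi> = \<omega> \<phi>"
  proof (cases "\<phi> \<in> (\<Union>i\<in>I. Injs i A)")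
    case True
    then have "map e \<phi> = \<phi>" using assms(2) by (intro map_idI) (auto simp: Injs_def)
    then show ?thesis using True by (simp only: relabel_apply)
  next
    case False
    then show ?thesis using assms(1) by (simp add: relabel_def colourings_def space_PiM PiE_iff extensional_def)
  qed
qed

section \<open>Auxiliary vertices and what is read off at a tuple\<close>

definition augment :: "'s set \<Rightarrow> ('s + nat) set" where
  "augment X = X <+> UNIV"

abbreviation lift :: "('s \<Rightarrow> 't) \<Rightarrow> 's + nat \<Rightarrow> 't + nat" where
  "lift g \<equiv> map_sum g id"

text \<open>Identifies the standard vertex set \<open>augment {1..i}\<close> with the vertices of
  \<open>\<phi>\<close> and the auxiliary ones. Positions count from 1 and list indices from 0,
  hence \<open>j - 1\<close>.\<close>

definition vertex_at :: "'s list \<Rightarrow> nat + nat \<Rightarrow> 's + nat" where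
  "vertex_at \<phi> = lift (\<lambda>j. \<phi> ! (j - 1))"

lemma countable_augment: "countable X \<Longrightarrow> countable (augment X)"
  by (simp add: augment_def)

lemma lift_augment:
  "inj_on g X \<Longrightarrow> inj_on (lift g) (augment X)"
  "g ` X \<subseteq> Y \<Longrightarrow> lift g ` augment X \<subseteq> augment Y"
proof -
  show "inj_on (lift g) (augment X)" if g: "inj_on g X"
  proof (rule inj_onI)
    fix x y assume "x \<in> augment X" "y \<in> augment X" "lift g x = lift g y"
    then show "x = y" by (cases x; cases y) (auto simp: augment_def dest: inj_onD[OF g])
  qed
  show "lift g ` augment X \<subseteq> augment Y" if g: "g ` X \<subseteq> Y"
  proof (rule image_subsetI)
    fix x assume "x \<in> augment X"
    then show "lift g x \<in> augment Y" using g by (cases x) (auto simp: augment_def)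
  qed
qed

lemma vertex_at_augment:
  assumes "\<phi> \<in> Injs i X"
  shows "inj_on (vertex_at \<phi>) (augment {1..i})" "vertex_at \<phi> ` augment {1..i} \<subseteq> augment (set \<phi>)"
    "vertex_at \<phi> ` augment {1..i} \<subseteq> augment X"
proof -
  have "inj_on (\<lambda>j. \<phi> ! (j - 1)) {1..i}"
    using assms by (auto simp: Injs_def inj_on_def nth_eq_iff_index_eq)
  then show "inj_on (vertex_at \<phi>) (augment {1..i})" unfolding vertex_at_def by (rule lift_augment)
  have *: "(\<lambda>j. \<phi> ! (j - 1)) ` {1..i} \<subseteq> set \<phi>" using assms by (auto simp: Injs_def)
  then show "vertex_at \<phi> ` augment {1..i} \<subseteq> augment (set \<phi>)" unfolding vertex_at_def by (rule lift_augment)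
  have "(\<lambda>j. \<phi> ! (j - 1)) ` {1..i} \<subseteq> X" using * assms by (auto simp: Injs_def)
  then show "vertex_at \<phi> ` augment {1..i} \<subseteq> augment X" unfolding vertex_at_def by (rule lift_augment)
qed

lemma lift_vertex_at: "\<phi> \<in> Injs i X \<Longrightarrow> x \<in> augment {1..i} \<Longrightarrow> lift g (vertex_at \<phi> x) = vertex_at (map g \<phi>) x"
proof (cases x)
  case (Inl j)
  assume "\<phi> \<in> Injs i X" "x \<in> augment {1..i}"
  then have "j - 1 < length \<phi>" using Inl by (auto simp: augment_def Injs_def)
  then show ?thesis using Inl by (simp add: vertex_at_def)
qed (simp add: vertex_at_def)

text \<open>
  The data read off at \<open>\<phi>\<close> is a function of the colouring seen from the vertices of \<open>\<phi>\<close>, numbered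
  \<open>1, \<dots>, i\<close>, together with all of the auxiliary vertices \<open>Inr n\<close>.
\<close>

definition readings ::
    "nat \<Rightarrow> (nat \<Rightarrow> ((nat + nat) list \<Rightarrow> 'a) \<Rightarrow> 't) \<Rightarrow> nat set \<Rightarrow> 's set \<Rightarrow> (('s + nat) list \<Rightarrow> 'a) \<Rightarrow> 's list \<Rightarrow> 't" where
  "readings k r I X \<omega> = (\<lambda>\<phi>\<in>(\<Union>i\<in>I. Injs i X). r (length \<phi>) (relabel (vertex_at \<phi>) {..k} (augment {1..length \<phi>}) \<omega>))"

lemma readings_measurable:
  assumes r: "\<And>i. i \<in> I \<Longrightarrow> r i \<in> colourings K {..k} (augment {1..i}) \<rightarrow>\<^sub>M T i"
  shows "readings k r I X \<in> colourings K {..k} (augment X) \<rightarrow>\<^sub>M colourings T I X"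
  unfolding readings_def colourings_def[of T]
proof (rule measurable_restrict)
  fix \<phi> assume "\<phi> \<in> (\<Union>i\<in>I. Injs i X)"
  then obtain i where i: "i \<in> I" "\<phi> \<in> Injs i X" by blast
  then have [simp]: "length \<phi> = i" by (simp add: Injs_def)
  show "(\<lambda>x. r (length \<phi>) (relabel (vertex_at \<phi>) {..k} (augment {1..length \<phi>}) x)) \<in> colourings K {..k} (augment X) \<rightarrow>\<^sub>M T (length \<phi>)"
    using measurable_compose[OF relabel_measurable[OF vertex_at_augment(1,3)[OF i(2)]] r[OF i(1)]] by simp
qed

text \<open>Since \<open>lift g\<close> fixes the auxiliary vertices, looking from
  \<open>\<phi>\<close> after relabelling is looking from \<open>map g \<phi>\<close>. This
  equivariance is the source of the covariance of the kernels.\<close>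

lemma readings_relabel:
  assumes g: "inj_on g X" "g ` X \<subseteq> Y"
  shows "readings k r I X (relabel (lift g) {..k} (augment X) \<omega>) = relabel g I X (readings k r I Y \<omega>)"
proof
  fix \<phi>
  show "readings k r I X (relabel (lift g) {..k} (augment X) \<omega>) \<phi> = relabel g I X (readings k r I Y \<omega>) \<phi>"
  proof (cases "\<phi> \<in> (\<Union>i\<in>I. Injs i X)")
    case True
    then obtain i where i: "i \<in> I" "\<phi> \<in> Injs i X" by blast
    then have l: "length \<phi> = i" by (simp add: Injs_def)
    have m: "map g \<phi> \<in> (\<Union>i\<in>I. Injs i Y)" using map_in_Injs[OF g i(2)] i(1) by blast
    have "relabel (vertex_at \<phi>) {..k} (augment {1..i}) (relabel (lift g) {..k} (augment X) \<omega>)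
        = relabel (lift g \<circ> vertex_at \<phi>) {..k} (augment {1..i}) \<omega>"
      by (rule relabel_relabel[OF vertex_at_augment(1,3)[OF i(2)]])
    also have "\<dots> = relabel (vertex_at (map g \<phi>)) {..k} (augment {1..i}) \<omega>"
      by (rule relabel_cong) (simp add: lift_vertex_at[OF i(2)])
    finally show ?thesis using True m l by (simp add: readings_def relabel_apply)
  next
    case False
    then show ?thesis by (simp add: readings_def relabel_def)
  qed
qed

text \<open>The mixture of the kernels under the uniform distribution on \<open>P\<close>; written
  as a bind it is a probability measure at once.\<close>

lemma kernel_average_exists:
  assumes P: "finite P" "P \<noteq> {}" and K: "\<And>\<sigma>. \<sigma> \<in> P \<Longrightarrow> K \<sigma> \<in> N \<rightarrow>\<^sub>M prob_algebra T"
  shows "\<exists>L. L \<in> N \<rightarrow>\<^sub>M prob_algebra T \<and>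
    (\<forall>y\<in>space N. \<forall>B\<in>sets T. emeasure (L y) B = (\<Sum>\<sigma>\<in>P. emeasure (K \<sigma> y) B) / of_nat (card P))"
proof -
  obtain \<sigma>0 where \<sigma>0: "\<sigma>0 \<in> P" using P by blast
  \<comment> \<open>The uniform distribution lives on the whole index type, so indices outside
    \<open>P\<close>, which have mass zero, are given the kernel of some \<open>\<sigma>0\<close> in
    \<open>P\<close>.\<close>
  define K' where "K' \<sigma> = K (if \<sigma> \<in> P then \<sigma> else \<sigma>0)" for \<sigma>
  have K': "K' \<sigma> \<in> N \<rightarrow>\<^sub>M prob_algebra T" for \<sigma> using K \<sigma>0 by (simp add: K'_def)
  define L where "L y = measure_pmf (pmf_of_set P) \<bind> (\<lambda>\<sigma>. K' \<sigma> y)" for y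
  have sp: "K' \<sigma> y \<in> space (prob_algebra T)" if "y \<in> space N" for \<sigma> y
    by (rule measurable_space[OF K' that])
  have ks: "(\<lambda>\<sigma>. K' \<sigma> y) \<in> measure_pmf (pmf_of_set P) \<rightarrow>\<^sub>M prob_algebra T" if "y \<in> space N" for y
    using sp[OF that] by simp
  have em: "emeasure (L y) B = (\<Sum>\<sigma>\<in>P. emeasure (K \<sigma> y) B) / of_nat (card P)" if y: "y \<in> space N" and B: "B \<in> sets T" for y B
  proof -
    have "emeasure (L y) B = (\<integral>\<^sup>+\<sigma>. emeasure (K' \<sigma> y) B \<partial>measure_pmf (pmf_of_set P))"
      unfolding L_def by (rule emeasure_bind[OF _ measurable_prob_algebraD[OF ks[OF y]] B]) simp
    also have "\<dots> = (\<Sum>\<sigma>\<in>P. emeasure (K' \<sigma> y) B) / of_nat (card P)"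
      using P by (simp add: nn_integral_pmf_of_set ennreal_of_nat_eq_real_of_nat)
    finally show ?thesis by (simp add: K'_def)
  qed
  have "L \<in> N \<rightarrow>\<^sub>M prob_algebra T"
  proof (rule measurable_prob_algebra_generated[OF sets.sigma_sets_eq[symmetric] sets.Int_stable sets.space_closed])
    fix y assume y: "y \<in> space N"
    have "measure_pmf (pmf_of_set P) \<in> space (prob_algebra (count_space UNIV))"
      by (simp add: space_prob_algebra measure_pmf.prob_space_axioms)
    then show "prob_space (L y)"
      unfolding L_def by (rule prob_space_bind'[where N = T]) (use sp[OF y] in auto)
    show "sets (L y) = sets T"
      unfolding L_def by (rule sets_bind) (use sp[OF y] in \<open>simp_all add: space_prob_algebra\<close>)
  next
    fix B assume B: "B \<in> sets T"
    have "(\<lambda>y. (\<Sum>\<sigma>\<in>P. emeasure (K \<sigma> y) B) / of_nat (card P)) \<in> borel_measurable N"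
      using K B by (intro borel_measurable_divide_ennreal borel_measurable_sum borel_measurable_const kernel_emeasure_measurable)
    then show "(\<lambda>y. emeasure (L y) B) \<in> borel_measurable N"
      by (rule measurable_cong[THEN iffD1, rotated]) (simp add: em B)
  qed
  then show ?thesis using em by blast
qed

declare One_nat_def [simp del]

section \<open>Compatible laws on all countable vertex sets, and covariant conditional laws\<close>

locale exchangeable_colouring =
  fixes k :: nat and K :: "nat \<Rightarrow> 'a measure" and S :: "'s set" and \<mu> :: "('s list \<Rightarrow> 'a) measure"
  assumes countable_S: "countable S" and infinite_S: "infinite S"
    and palette: "palette k K" and exchangeable: "exchangeable_hypergraph k K S \<mu>"
begin

abbreviation Col :: "'x set \<Rightarrow> ('x list \<Rightarrow> 'a) measure" where
  "Col X \<equiv> colourings K {..k} X"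

lemma prob_space_\<mu>: "prob_space \<mu>" and sets_\<mu>: "sets \<mu> = sets (Col S)"
  using exchangeable by (auto simp: exchangeable_hypergraph_def)

text \<open>A standard Borel space may be empty. Here it is not, because \<open>\<mu>\<close> is a
  probability measure on a product in which \<open>K i\<close> occurs as a factor: \<open>S\<close>
  is infinite and so has an i-tuple.\<close>

lemma K_nonempty: "i \<le> k \<Longrightarrow> space (K i) \<noteq> {}"
proof -
  assume i: "i \<le> k"
  obtain A where A: "A \<subseteq> S" "finite A" "card A = i"
    using infinite_arbitrarily_large[OF infinite_S] by blast
  obtain \<phi> where \<phi>: "set \<phi> = A" "distinct \<phi>" using finite_distinct_list[OF A(2)] by blast
  have "\<phi> \<in> Injs i S" using \<phi> A distinct_card[OF \<phi>(2)] by (simp add: Injs_def)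
  then have m: "\<phi> \<in> (\<Union>i\<in>{..k}. Injs i S)" using i by blast
  obtain \<omega> where "\<omega> \<in> space (Col S)"
    using prob_space.not_empty[OF prob_space_\<mu>] sets_eq_imp_space_eq[OF sets_\<mu>] by blast
  then have "\<omega> \<phi> \<in> space (K (length \<phi>))" using m by (auto simp: colourings_def space_PiM PiE_iff)
  then show ?thesis using \<open>\<phi> \<in> Injs i S\<close> by (auto simp: Injs_def)
qed

lemma borel_retract_Col:
  assumes "countable X"
  shows "borel_retract (Col X) (borel :: real measure)"
proof -
  have "borel_retract (Col X) (PiM (\<Union>i\<in>{..k}. Injs i X) (\<lambda>_. borel :: real measure))"
    unfolding colourings_def
  proof (rule borel_retract_PiM)
    fix \<phi> assume "\<phi> \<in> (\<Union>i\<in>{..k}. Injs i X)"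
    then have "length \<phi> \<le> k" by (auto simp: Injs_def)
    then show "borel_retract (K (length \<phi>)) (borel :: real measure)"
      using palette K_nonempty unfolding palette_def by (intro standard_borel_borel_retract_real) auto
  qed
  then show ?thesis
    by (rule borel_retract_trans[OF _ borel_retract_real_PiM[OF countable_Injs[OF assms]]])
qed

text \<open>Defined for every vertex set at once, so that \<open>S\<close>, \<open>augment S\<close>
  and \<open>augment {1..i}\<close>, which have different types, carry laws that are compatible
  under relabelling. The chosen injection is immaterial by \<open>law_eq\<close>.\<close>

definition law :: "'x set \<Rightarrow> ('x list \<Rightarrow> 'a) measure" where
  "law X = distr \<mu> (Col X) (relabel (SOME g. inj_on g X \<and> g ` X \<subseteq> S) {..k} X)"

lemma sets_law [measurable_cong, simp]: "sets (law X) = sets (Col X)"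
  by (simp add: law_def)

lemma space_law [simp]: "space (law X) = space (Col X)"
  by (simp add: law_def)

lemma relabel_measurable_\<mu>: "inj_on g X \<Longrightarrow> g ` X \<subseteq> S \<Longrightarrow> relabel g {..k} X \<in> \<mu> \<rightarrow>\<^sub>M Col X"
  using relabel_measurable[of g X S "{..k}" K] by (simp cong: measurable_cong_sets[OF sets_\<mu> refl])

lemma relabel_measurable_law:
  "inj_on g X \<Longrightarrow> g ` X \<subseteq> Y \<Longrightarrow> relabel g {..k} X \<in> law Y \<rightarrow>\<^sub>M Col X"
  using relabel_measurable[of g X Y "{..k}" K] by (simp cong: measurable_cong_sets[OF sets_law refl])

lemma law_eq:
  assumes "inj_on g X" "g ` X \<subseteq> S"
  shows "law X = distr \<mu> (Col X) (relabel g {..k} X)"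
proof -
  have "inj_on (SOME g. inj_on g X \<and> g ` X \<subseteq> S) X \<and> (SOME g. inj_on g X \<and> g ` X \<subseteq> S) ` X \<subseteq> S"
    by (rule someI[of _ g]) (use assms in simp)
  then show ?thesis unfolding law_def
    by (intro exchangeable_relabel_injection[OF exchangeable] assms) auto
qed

lemma injection_exists: "countable X \<Longrightarrow> \<exists>g. inj_on g X \<and> g ` X \<subseteq> S"
proof -
  assume X: "countable X"
  have "bij_betw (from_nat_into S) UNIV S" using countable_S infinite_S by (rule bij_betw_from_nat_into)
  then have "inj_on (from_nat_into S \<circ> to_nat_on X) X" "(from_nat_into S \<circ> to_nat_on X) ` X \<subseteq> S"
    using inj_on_to_nat_on[OF X] by (auto simp: bij_betw_def intro!: comp_inj_on intro: inj_on_subset)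
  then show ?thesis by blast
qed

lemma prob_space_law: "countable X \<Longrightarrow> prob_space (law X)"
  using injection_exists[of X] law_eq prob_space.prob_space_distr[OF prob_space_\<mu> relabel_measurable_\<mu>] by metis

lemma law_S: "law S = \<mu>"
proof -
  have "law S = distr \<mu> (Col S) (relabel id {..k} S)" by (rule law_eq) auto
  also have "\<dots> = \<mu>"
    using exchangeable permutes_id by (auto simp: exchangeable_hypergraph_def)
  finally show ?thesis .
qed

text \<open>With \<open>X = Y\<close> this is invariance under injections that need not be onto; the
  map \<open>\<tau>\<close> in \<open>cond_law_mask\<close> is such an injection.\<close>

lemma law_relabel:
  assumes Y: "countable Y" and g: "inj_on g X" "g ` X \<subseteq> Y"
  shows "distr (law Y) (Col X) (relabel g {..k} X) = law X"
proof -
  obtain h where h: "inj_on h Y" "h ` Y \<subseteq> S" using injection_exists[OF Y] by blast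
  have hg: "inj_on (h \<circ> g) X" "(h \<circ> g) ` X \<subseteq> S"
    using g h by (auto intro!: comp_inj_on intro: inj_on_subset)
  have "distr (law Y) (Col X) (relabel g {..k} X) = distr \<mu> (Col X) (relabel g {..k} X \<circ> relabel h {..k} Y)"
    unfolding law_eq[OF h] by (rule distr_distr[OF relabel_measurable[OF g] relabel_measurable_\<mu>[OF h]])
  also have "relabel g {..k} X \<circ> relabel h {..k} Y = relabel (h \<circ> g) {..k} X"
    by (rule ext) (simp add: relabel_relabel[OF g])
  also have "distr \<mu> (Col X) \<dots> = law X" by (rule law_eq[OF hg, symmetric])
  finally show ?thesis .
qed

lemma nn_integral_law_relabel:
  assumes Y: "countable Y" and g: "inj_on g X" "g ` X \<subseteq> Y" and f: "f \<in> borel_measurable (Col X)"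
  shows "(\<integral>\<^sup>+\<omega>. f (relabel g {..k} X \<omega>) \<partial>law Y) = (\<integral>\<^sup>+\<omega>. f \<omega> \<partial>law X)"
  using nn_integral_distr[OF relabel_measurable_law[OF g], of f] f law_relabel[OF Y g] by simp

definition enc :: "nat \<Rightarrow> ((nat + nat) list \<Rightarrow> 'a) \<Rightarrow> real" where
  "enc i = (SOME e. e \<in> borel_measurable (Col (augment {1..i})) \<and>
    (\<exists>d. d \<in> borel \<rightarrow>\<^sub>M Col (augment {1..i}) \<and> (\<forall>x\<in>space (Col (augment {1..i})). d (e x) = x)))"

definition dec :: "nat \<Rightarrow> real \<Rightarrow> ((nat + nat) list \<Rightarrow> 'a)" where
  "dec i = (SOME d. d \<in> borel \<rightarrow>\<^sub>M Col (augment {1..i}) \<and>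
    (\<forall>x\<in>space (Col (augment {1..i})). d (enc i x) = x))"

lemma enc_measurable: "enc i \<in> borel_measurable (Col (augment {1..i}))"
  and dec_measurable: "dec i \<in> borel \<rightarrow>\<^sub>M Col (augment {1..i})"
  and dec_enc: "x \<in> space (Col (augment {1..i})) \<Longrightarrow> dec i (enc i x) = x"
proof -
  have "countable (augment {1..i})" by (rule countable_augment) simp
  then have "\<exists>e. e \<in> borel_measurable (Col (augment {1..i})) \<and>
    (\<exists>d. d \<in> (borel :: real measure) \<rightarrow>\<^sub>M Col (augment {1..i}) \<and> (\<forall>x\<in>space (Col (augment {1..i})). d (e x) = x))"
    using borel_retract_Col unfolding borel_retract_def by blast
  from someI_ex[OF this, folded enc_def] have e: "enc i \<in> borel_measurable (Col (augment {1..i}))"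
    and d: "\<exists>d. d \<in> (borel :: real measure) \<rightarrow>\<^sub>M Col (augment {1..i}) \<and> (\<forall>x\<in>space (Col (augment {1..i})). d (enc i x) = x)"
    by blast+
  show "enc i \<in> borel_measurable (Col (augment {1..i}))" by (rule e)
  from someI_ex[OF d, folded dec_def] show "dec i \<in> borel \<rightarrow>\<^sub>M Col (augment {1..i})"
    and "x \<in> space (Col (augment {1..i})) \<Longrightarrow> dec i (enc i x) = x" by blast+
qed

abbreviation codes :: "nat set \<Rightarrow> 'x set \<Rightarrow> (('x + nat) list \<Rightarrow> 'a) \<Rightarrow> 'x list \<Rightarrow> real" where
  "codes \<equiv> readings k enc"

abbreviation Cod :: "nat set \<Rightarrow> 'x set \<Rightarrow> ('x list \<Rightarrow> real) measure" where
  "Cod \<equiv> colourings (\<lambda>_. borel)"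

lemma codes_measurable: "codes I X \<in> Col (augment X) \<rightarrow>\<^sub>M Cod I X"
  by (rule readings_measurable) (rule enc_measurable)

lemma countable_augment_interval: "countable (augment {1..i::nat})"
  by (rule countable_augment) simp

text \<open>A conditional law is unique only up to null sets, whereas covariance is wanted at every
  point. By invariance of the law each conjugate \<open>Q' \<sigma>\<close> of a conditional law is
  again one, hence so is their average, and a permutation merely reorders the terms of the
  average.\<close>

lemma covariant_conditional_law:
  "\<exists>Q. cond_law (law (augment {1..i})) (codes {..<i} {1..i}) (Cod {..<i} {1..i}) (\<lambda>\<omega>. \<omega>) (Col (augment {1..i})) Q \<and>
    (\<forall>\<sigma> z. \<sigma> permutes {1..i} \<and> z \<in> space (Cod {..<i} {1..i}) \<longrightarrow>
      Q (relabel \<sigma> {..<i} {1..i} z) = distr (Q z) (Col (augment {1..i})) (relabel (lift \<sigma>) {..k} (augment {1..i})))"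
proof -
  let ?V = "augment {1..i}" and ?N = "Cod {..<i} {1..i}" and ?X = "codes {..<i} {1..i}"
  let ?P = "{\<sigma>. \<sigma> permutes {1..i}}"
  interpret prob_space "law ?V" by (rule prob_space_law[OF countable_augment_interval])
  have X: "?X \<in> law ?V \<rightarrow>\<^sub>M ?N" using codes_measurable by (simp cong: measurable_cong_sets)
  have Y: "(\<lambda>\<omega>. \<omega>) \<in> law ?V \<rightarrow>\<^sub>M Col ?V" by (simp add: measurable_ident_sets)
  obtain Q0 where Q0: "cond_law (law ?V) ?X ?N (\<lambda>\<omega>. \<omega>) (Col ?V) Q0"
    using cond_law_exists[OF prob_space_axioms X Y borel_retract_Col[OF countable_augment_interval]] by blast
  note Q0m = cond_lawD(1)[OF Q0]
  have inj: "inj_on \<sigma> {1..i}" "\<sigma> ` {1..i} \<subseteq> {1..i}" if "\<sigma> permutes {1..i}" for \<sigma>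
    using that by (auto simp: permutes_inj_on permutes_image)
  have rN: "relabel \<sigma> {..<i} {1..i} \<in> ?N \<rightarrow>\<^sub>M ?N" if "\<sigma> permutes {1..i}" for \<sigma>
    by (rule relabel_measurable[OF inj[OF that]])
  have linj: "inj_on (lift \<sigma>) ?V" "lift \<sigma> ` ?V \<subseteq> ?V" if "\<sigma> permutes {1..i}" for \<sigma>
    using lift_augment(1)[OF inj(1)[OF that]] lift_augment(2)[OF inj(2)[OF that]] by auto
  have rV: "relabel (lift \<sigma>) {..k} ?V \<in> Col ?V \<rightarrow>\<^sub>M Col ?V" if "\<sigma> permutes {1..i}" for \<sigma>
    by (rule relabel_measurable[OF linj[OF that]])
  define Q' where "Q' \<sigma> z = distr (Q0 (relabel \<sigma> {..<i} {1..i} z)) (Col ?V) (relabel (lift (inv \<sigma>)) {..k} ?V)" for \<sigma> z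
  have Q'm: "Q' \<sigma> \<in> ?N \<rightarrow>\<^sub>M prob_algebra (Col ?V)" if \<sigma>: "\<sigma> permutes {1..i}" for \<sigma>
    unfolding Q'_def
    by (rule measurable_compose[OF rN[OF \<sigma>] measurable_compose[OF Q0m measurable_distr_prob_space[OF rV[OF permutes_inv[OF \<sigma>]]]]])
  have Q': "cond_law (law ?V) ?X ?N (\<lambda>\<omega>. \<omega>) (Col ?V) (Q' \<sigma>)" if \<sigma>: "\<sigma> permutes {1..i}" for \<sigma>
    unfolding cond_law_def
  proof (intro conjI ballI Q'm[OF \<sigma>])
    fix A B assume A: "A \<in> sets ?N" and B: "B \<in> sets (Col ?V)"
    note \<sigma>' = permutes_inv[OF \<sigma>]
    let ?s = "relabel (lift \<sigma>) {..k} ?V" and ?t = "relabel (lift (inv \<sigma>)) {..k} ?V"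
    let ?A = "relabel (inv \<sigma>) {..<i} {1..i} -` A \<inter> space ?N" and ?B = "?t -` B \<inter> space (Col ?V)"
    have A': "?A \<in> sets ?N" and B': "?B \<in> sets (Col ?V)"
      using measurable_sets[OF rN[OF \<sigma>'] A] measurable_sets[OF rV[OF \<sigma>'] B] by auto
    have ts: "?t (?s \<omega>) = \<omega>" if \<omega>: "\<omega> \<in> space (Col ?V)" for \<omega>
      unfolding relabel_relabel[OF linj[OF \<sigma>']]
    proof (rule relabel_ident[OF \<omega>])
      show "(lift \<sigma> \<circ> lift (inv \<sigma>)) x = x" for x
        using permutes_inverses[OF \<sigma>] by (cases x) auto
    qed
    have Xs: "?X (?s \<omega>) = relabel \<sigma> {..<i} {1..i} (?X \<omega>)" for \<omega>
      by (rule readings_relabel[OF inj[OF \<sigma>]])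
    have sV: "?s \<omega> \<in> space (Col ?V)" if "\<omega> \<in> space (Col ?V)" for \<omega> using that measurable_space[OF rV[OF \<sigma>]] by blast
    have XN: "?X \<omega> \<in> space ?N" if "\<omega> \<in> space (Col ?V)" for \<omega> using that measurable_space[OF codes_measurable] by blast
    have inA: "?X (?s \<omega>) \<in> ?A \<longleftrightarrow> ?X \<omega> \<in> A" if \<omega>: "\<omega> \<in> space (Col ?V)" for \<omega>
    proof -
      have "relabel (inv \<sigma>) {..<i} {1..i} (?X (?s \<omega>)) = ?X (?t (?s \<omega>))"
        by (rule readings_relabel[OF inj[OF \<sigma>'], symmetric])
      then show ?thesis using XN[OF sV[OF \<omega>]] by (simp add: ts[OF \<omega>])
    qed
    have "emeasure (law ?V) {\<omega> \<in> space (law ?V). ?X \<omega> \<in> A \<and> \<omega> \<in> B}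
        = emeasure (law ?V) (?s -` {\<omega> \<in> space (law ?V). ?X \<omega> \<in> ?A \<and> \<omega> \<in> ?B} \<inter> space (law ?V))"
      using sV inA by (intro arg_cong[of _ _ "emeasure (law ?V)"]) (auto simp: ts)
    also have "\<dots> = emeasure (distr (law ?V) (Col ?V) ?s) {\<omega> \<in> space (law ?V). ?X \<omega> \<in> ?A \<and> \<omega> \<in> ?B}"
    proof (rule emeasure_distr[symmetric])
      show "?s \<in> law ?V \<rightarrow>\<^sub>M Col ?V" by (rule relabel_measurable_law[OF linj[OF \<sigma>]])
      have "(?X -` ?A \<inter> space (Col ?V)) \<inter> ?B \<in> sets (Col ?V)"
        using measurable_sets[OF codes_measurable A'] B' by blast
      also have "(?X -` ?A \<inter> space (Col ?V)) \<inter> ?B = {\<omega> \<in> space (law ?V). ?X \<omega> \<in> ?A \<and> \<omega> \<in> ?B}" by auto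
      finally show "{\<omega> \<in> space (law ?V). ?X \<omega> \<in> ?A \<and> \<omega> \<in> ?B} \<in> sets (Col ?V)" .
    qed
    also have "\<dots> = emeasure (law ?V) {\<omega> \<in> space (law ?V). ?X \<omega> \<in> ?A \<and> \<omega> \<in> ?B}"
      by (simp only: law_relabel[OF countable_augment_interval linj[OF \<sigma>]])
    also have "\<dots> = (\<integral>\<^sup>+\<omega>. indicator ?A (?X \<omega>) * emeasure (Q0 (?X \<omega>)) ?B \<partial>law ?V)"
      by (rule cond_lawD(2)[OF Q0 A' B'])
    also have "\<dots> = (\<integral>\<^sup>+\<omega>. indicator ?A (?X (?s \<omega>)) * emeasure (Q0 (?X (?s \<omega>))) ?B \<partial>law ?V)"
    proof (rule nn_integral_law_relabel[OF countable_augment_interval linj[OF \<sigma>], symmetric])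
      show "(\<lambda>\<omega>. indicator ?A (?X \<omega>) * emeasure (Q0 (?X \<omega>)) ?B) \<in> borel_measurable (Col ?V)"
        by (intro borel_measurable_times_ennreal measurable_compose[OF codes_measurable]
            kernel_emeasure_measurable[OF Q0m B'] borel_measurable_indicator A')
    qed
    also have "\<dots> = (\<integral>\<^sup>+\<omega>. indicator A (?X \<omega>) * emeasure (Q' \<sigma> (?X \<omega>)) B \<partial>law ?V)"
    proof (rule nn_integral_cong)
      fix \<omega> assume "\<omega> \<in> space (law ?V)"
      then have \<omega>: "\<omega> \<in> space (Col ?V)" by simp
      have "emeasure (Q' \<sigma> (?X \<omega>)) B = emeasure (Q0 (?X (?s \<omega>))) ?B"
      proof -
        note kx = kernel_space[OF Q0m XN[OF sV[OF \<omega>]]]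
        have "?t \<in> Q0 (?X (?s \<omega>)) \<rightarrow>\<^sub>M Col ?V" using rV[OF \<sigma>'] by (simp cong: measurable_cong_sets[OF kx(2) refl])
        then show ?thesis unfolding Q'_def Xs[symmetric] using B by (simp add: emeasure_distr kx(3))
      qed
      then show "indicator ?A (?X (?s \<omega>)) * emeasure (Q0 (?X (?s \<omega>))) ?B = indicator A (?X \<omega>) * emeasure (Q' \<sigma> (?X \<omega>)) B"
        using inA[OF \<omega>] by (simp add: indicator_def)
    qed
    finally show "emeasure (law ?V) {\<omega> \<in> space (law ?V). ?X \<omega> \<in> A \<and> \<omega> \<in> B} =
      (\<integral>\<^sup>+\<omega>. indicator A (?X \<omega>) * emeasure (Q' \<sigma> (?X \<omega>)) B \<partial>law ?V)" .
  qed
  have P: "finite ?P" "?P \<noteq> {}" using finite_permutations[of "{1..i}"] permutes_id[of "{1..i}"] by (simp, blast)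
  obtain Q where Qm: "Q \<in> ?N \<rightarrow>\<^sub>M prob_algebra (Col ?V)"
    and Q: "\<And>z B. z \<in> space ?N \<Longrightarrow> B \<in> sets (Col ?V) \<Longrightarrow>
      emeasure (Q z) B = (\<Sum>\<sigma>\<in>?P. emeasure (Q' \<sigma> z) B) / of_nat (card ?P)"
    using kernel_average_exists[OF P, of Q' ?N "Col ?V"] Q'm by blast
  have card0: "of_nat (card ?P) \<noteq> (0::ennreal)" using P by (simp add: card_gt_0_iff)
  show ?thesis
  proof (intro exI[of _ Q] conjI allI impI)
    show "cond_law (law ?V) ?X ?N (\<lambda>\<omega>. \<omega>) (Col ?V) Q"
      unfolding cond_law_def
    proof (intro conjI ballI Qm)
      fix A B assume A: "A \<in> sets ?N" and B: "B \<in> sets (Col ?V)"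
      let ?e = "emeasure (law ?V) {\<omega> \<in> space (law ?V). ?X \<omega> \<in> A \<and> \<omega> \<in> B}"
      have meas: "(\<lambda>\<omega>. indicator A (?X \<omega>) * emeasure (Q' \<sigma> (?X \<omega>)) B) \<in> borel_measurable (law ?V)" if "\<sigma> \<in> ?P" for \<sigma>
        using that by (intro borel_measurable_times_ennreal measurable_compose[OF X]
            kernel_emeasure_measurable[OF Q'm B] borel_measurable_indicator A) simp
      have "(\<integral>\<^sup>+\<omega>. indicator A (?X \<omega>) * emeasure (Q (?X \<omega>)) B \<partial>law ?V)
        = (\<integral>\<^sup>+\<omega>. (\<Sum>\<sigma>\<in>?P. indicator A (?X \<omega>) * emeasure (Q' \<sigma> (?X \<omega>)) B) / of_nat (card ?P) \<partial>law ?V)"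
      proof (rule nn_integral_cong)
        fix \<omega> assume "\<omega> \<in> space (law ?V)"
        then have "?X \<omega> \<in> space ?N" using measurable_space[OF X] by blast
        from Q[OF this B]
        show "indicator A (?X \<omega>) * emeasure (Q (?X \<omega>)) B = (\<Sum>\<sigma>\<in>?P. indicator A (?X \<omega>) * emeasure (Q' \<sigma> (?X \<omega>)) B) / of_nat (card ?P)"
          by (simp add: sum_distrib_left ennreal_times_divide)
      qed
      also have "\<dots> = (\<Sum>\<sigma>\<in>?P. \<integral>\<^sup>+\<omega>. indicator A (?X \<omega>) * emeasure (Q' \<sigma> (?X \<omega>)) B \<partial>law ?V) / of_nat (card ?P)"
        by (subst nn_integral_divide) (intro borel_measurable_sum meas, simp_all only: nn_integral_sum[OF meas])
      also have "\<dots> = (\<Sum>\<sigma>\<in>?P. ?e) / of_nat (card ?P)"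
        using cond_lawD(2)[OF Q' A B] by simp
      also have "\<dots> = ?e"
        using card0 by (simp add: mult.commute[of "of_nat _"] mult_divide_eq_ennreal)
      finally show "?e = (\<integral>\<^sup>+\<omega>. indicator A (?X \<omega>) * emeasure (Q (?X \<omega>)) B \<partial>law ?V)" ..
    qed
    fix \<rho> z assume "\<rho> permutes {1..i} \<and> z \<in> space ?N"
    then have \<rho>: "\<rho> permutes {1..i}" and z: "z \<in> space ?N" by auto
    let ?z = "relabel \<rho> {..<i} {1..i} z" and ?r = "relabel (lift \<rho>) {..k} ?V"
    have z': "?z \<in> space ?N" using measurable_space[OF rN[OF \<rho>] z] .
    note kz = kernel_space[OF Qm z] and kz' = kernel_space[OF Qm z']
    show "Q ?z = distr (Q z) (Col ?V) ?r"
    proof (rule measure_eqI)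
      show "sets (Q ?z) = sets (distr (Q z) (Col ?V) ?r)" by (simp add: kz')
      fix B assume "B \<in> sets (Q ?z)"
      then have B: "B \<in> sets (Col ?V)" by (simp add: kz')
      let ?B = "?r -` B \<inter> space (Col ?V)"
      have B': "?B \<in> sets (Col ?V)" by (rule measurable_sets[OF rV[OF \<rho>] B])
      \<comment> \<open>Relabelling reverses composition: by \<open>\<rho>\<close> and then by
        \<open>\<sigma>\<close> is by \<open>\<rho> \<circ> \<sigma>\<close>. So the conjugates at
        \<open>?z\<close> are those at \<open>z\<close> with index translated by
        \<open>\<rho>\<close>, followed by the action on the target; summing over all permutations
        removes the translation.\<close>
      have eq: "emeasure (Q' \<sigma> ?z) B = emeasure (Q' (\<rho> \<circ> \<sigma>) z) ?B" if "\<sigma> \<in> ?P" for \<sigma>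
      proof -
        have \<sigma>: "\<sigma> permutes {1..i}" using that by simp
        have \<rho>\<sigma>: "\<rho> \<circ> \<sigma> permutes {1..i}" by (rule permutes_compose[OF \<sigma> \<rho>])
        let ?y = "relabel (\<rho> \<circ> \<sigma>) {..<i} {1..i} z"
        have y: "relabel \<sigma> {..<i} {1..i} ?z = ?y" by (rule relabel_relabel[OF inj[OF \<sigma>]])
        have ysp: "?y \<in> space ?N" using measurable_space[OF rN[OF \<rho>\<sigma>] z] .
        note ky = kernel_space[OF Q0m ysp]
        let ?t = "relabel (lift (inv (\<rho> \<circ> \<sigma>))) {..k} ?V"
        have tm: "?t \<in> Q0 ?y \<rightarrow>\<^sub>M Col ?V"
          using rV[OF permutes_inv[OF \<rho>\<sigma>]] by (simp cong: measurable_cong_sets[OF ky(2) refl])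
        have comp: "?r (?t \<omega>) = relabel (lift (inv \<sigma>)) {..k} ?V \<omega>" for \<omega> :: "(nat + nat) list \<Rightarrow> 'a"
          unfolding relabel_relabel[OF linj[OF \<rho>]]
        proof (rule relabel_cong)
          fix x
          have "inv (\<rho> \<circ> \<sigma>) (\<rho> j) = inv \<sigma> j" for j
            using permutes_inverses(2)[OF \<rho>] by (simp add: o_inv_distrib permutes_bij[OF \<rho>] permutes_bij[OF \<sigma>])
          then show "(lift (inv (\<rho> \<circ> \<sigma>)) \<circ> lift \<rho>) x = lift (inv \<sigma>) x" by (cases x) auto
        qed
        have "emeasure (Q' (\<rho> \<circ> \<sigma>) z) ?B = emeasure (distr (Q' (\<rho> \<circ> \<sigma>) z) (Col ?V) ?r) B"
          using rV[OF \<rho>] B unfolding Q'_def by (subst emeasure_distr) (simp_all cong: measurable_cong_sets)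
        also have "distr (Q' (\<rho> \<circ> \<sigma>) z) (Col ?V) ?r = distr (Q0 ?y) (Col ?V) (?r \<circ> ?t)"
          unfolding Q'_def by (rule distr_distr[OF rV[OF \<rho>] tm])
        also have "?r \<circ> ?t = (relabel (lift (inv \<sigma>)) {..k} ?V :: ((nat + nat) list \<Rightarrow> 'a) \<Rightarrow> _)"
          by (rule ext) (simp only: comp_apply comp)
        also have "distr (Q0 ?y) (Col ?V) \<dots> = Q' \<sigma> ?z" unfolding Q'_def y ..
        finally show ?thesis ..
      qed
      have "emeasure (Q ?z) B = (\<Sum>\<sigma>\<in>?P. emeasure (Q' (\<rho> \<circ> \<sigma>) z) ?B) / of_nat (card ?P)"
        unfolding Q[OF z' B] by (simp add: eq)
      also have "(\<Sum>\<sigma>\<in>?P. emeasure (Q' (\<rho> \<circ> \<sigma>) z) ?B) = (\<Sum>\<sigma>\<in>?P. emeasure (Q' \<sigma> z) ?B)"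
        by (rule setum_permutations_compose_left[OF \<rho>, symmetric])
      also have "\<dots> / of_nat (card ?P) = emeasure (Q z) ?B" by (rule Q[OF z B', symmetric])
      also have "\<dots> = emeasure (distr (Q z) (Col ?V) ?r) B"
        using rV[OF \<rho>] B by (subst emeasure_distr) (simp_all cong: measurable_cong_sets[OF kz(2) refl] add: kz)
      finally show "emeasure (Q ?z) B = emeasure (distr (Q z) (Col ?V) ?r) B" .
    qed
  qed
qed

end

section \<open>Conditional independence\<close>

text \<open>Drawing \<open>X\<close> and then \<open>Y\<close> from the kernel reproduces the joint
  law, since both measures agree on rectangles; \<open>H\<close> then maps the pair forward. In this
  form a conditional law becomes one step of the recipe.\<close>

lemma cond_law_bind:
  assumes M: "prob_space M" and X[measurable]: "X \<in> M \<rightarrow>\<^sub>M N" and Y[measurable]: "Y \<in> M \<rightarrow>\<^sub>M T"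
    and K: "cond_law M X N Y T K" and H[measurable]: "H \<in> N \<Otimes>\<^sub>M T \<rightarrow>\<^sub>M L"
  shows "distr M N X \<bind> (\<lambda>x. distr (K x) L (\<lambda>y. H (x, y))) = distr M L (\<lambda>\<omega>. H (X \<omega>, Y \<omega>))"
proof -
  interpret prob_space M by fact
  note Km = cond_lawD(1)[OF K]
  have [measurable]: "K \<in> N \<rightarrow>\<^sub>M subprob_algebra T" by (rule measurable_prob_algebraD[OF Km])
  have ne: "space (distr M N X) \<noteq> {}"
    using not_empty measurable_space[OF X] by auto
  have DX: "K \<in> distr M N X \<rightarrow>\<^sub>M subprob_algebra T" by simp
  have k2: "(\<lambda>x. distr (K x) L' (\<lambda>y. G (x, y))) \<in> distr M N X \<rightarrow>\<^sub>M subprob_algebra L'"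
    if [measurable]: "G \<in> N \<Otimes>\<^sub>M T \<rightarrow>\<^sub>M L'" for G and L' :: "'x measure"
  proof -
    have "(\<lambda>x. distr (K x) L' (\<lambda>y. G (x, y))) \<in> N \<rightarrow>\<^sub>M subprob_algebra L'"
      by (rule measurable_distr2[where M = T]) simp_all
    then show ?thesis by simp
  qed
  have em: "emeasure (distr M N X \<bind> (\<lambda>x. distr (K x) L' (\<lambda>y. G (x, y)))) E
      = (\<integral>\<^sup>+\<omega>. emeasure (K (X \<omega>)) {y \<in> space T. G (X \<omega>, y) \<in> E} \<partial>M)"
    if [measurable]: "G \<in> N \<Otimes>\<^sub>M T \<rightarrow>\<^sub>M L'" "E \<in> sets L'" for G and L' :: "'x measure" and E
  proof -
    have "emeasure (distr M N X \<bind> (\<lambda>x. distr (K x) L' (\<lambda>y. G (x, y)))) E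
      = (\<integral>\<^sup>+x. emeasure (distr (K x) L' (\<lambda>y. G (x, y))) E \<partial>distr M N X)"
      by (rule emeasure_bind[OF ne k2[OF that(1)] that(2)])
    also have "\<dots> = (\<integral>\<^sup>+\<omega>. emeasure (distr (K (X \<omega>)) L' (\<lambda>y. G (X \<omega>, y))) E \<partial>M)"
    proof (rule nn_integral_distr[OF X])
      have "(\<lambda>x. distr (K x) L' (\<lambda>y. G (x, y))) \<in> N \<rightarrow>\<^sub>M subprob_algebra L'" using k2[OF that(1)] by simp
      from measurable_compose[OF this measurable_emeasure_subprob_algebra[OF that(2)]]
      show "(\<lambda>x. emeasure (distr (K x) L' (\<lambda>y. G (x, y))) E) \<in> borel_measurable (distr M N X)" by simp
    qed
    also have "\<dots> = (\<integral>\<^sup>+\<omega>. emeasure (K (X \<omega>)) {y \<in> space T. G (X \<omega>, y) \<in> E} \<partial>M)"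
    proof (rule nn_integral_cong)
      fix \<omega> assume "\<omega> \<in> space M"
      then have x: "X \<omega> \<in> space N" by (rule measurable_space[OF X])
      note kx = kernel_space[OF Km x]
      have "(\<lambda>y. G (X \<omega>, y)) \<in> K (X \<omega>) \<rightarrow>\<^sub>M L'"
        using x that(1) by (simp cong: measurable_cong_sets[OF kx(2) refl])
      then show "emeasure (distr (K (X \<omega>)) L' (\<lambda>y. G (X \<omega>, y))) E = emeasure (K (X \<omega>)) {y \<in> space T. G (X \<omega>, y) \<in> E}"
        using that(2) by (subst emeasure_distr) (auto simp: kx intro!: arg_cong[of _ _ "emeasure _"])
    qed
    finally show ?thesis .
  qed
  define J where "J = distr M N X \<bind> (\<lambda>x. distr (K x) (N \<Otimes>\<^sub>M T) (\<lambda>y. (x, y)))"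
  have idm: "(\<lambda>p. p) \<in> N \<Otimes>\<^sub>M T \<rightarrow>\<^sub>M N \<Otimes>\<^sub>M T" by simp
  have sJ: "sets J = sets (N \<Otimes>\<^sub>M T)"
    unfolding J_def by (rule sets_bind) (use ne in auto)
  have J_eq: "distr M (N \<Otimes>\<^sub>M T) (\<lambda>\<omega>. (X \<omega>, Y \<omega>)) = J"
  proof (rule measure_eqI_generator_eq[OF Int_stable_pair_measure_generator[of N T], where \<Omega> = "space N \<times> space T" and A = "\<lambda>_. space N \<times> space T"])
    show "{a \<times> b |a b. a \<in> sets N \<and> b \<in> sets T} \<subseteq> Pow (space N \<times> space T)" by (rule pair_measure_closed)
    show "sets (distr M (N \<Otimes>\<^sub>M T) (\<lambda>\<omega>. (X \<omega>, Y \<omega>))) = sigma_sets (space N \<times> space T) {a \<times> b |a b. a \<in> sets N \<and> b \<in> sets T}"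
      by (simp add: sets_pair_measure)
    show "sets J = sigma_sets (space N \<times> space T) {a \<times> b |a b. a \<in> sets N \<and> b \<in> sets T}"
      unfolding sJ by (simp add: sets_pair_measure)
    fix E assume "E \<in> {a \<times> b |a b. a \<in> sets N \<and> b \<in> sets T}"
    then obtain A B where E: "E = A \<times> B" and [measurable]: "A \<in> sets N" "B \<in> sets T" by auto
    have "emeasure (distr M (N \<Otimes>\<^sub>M T) (\<lambda>\<omega>. (X \<omega>, Y \<omega>))) E = emeasure M {\<omega> \<in> space M. X \<omega> \<in> A \<and> Y \<omega> \<in> B}"
      unfolding E by (subst emeasure_distr) (auto intro!: arg_cong[of _ _ "emeasure M"])
    also have "\<dots> = (\<integral>\<^sup>+\<omega>. indicator A (X \<omega>) * emeasure (K (X \<omega>)) B \<partial>M)"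
      by (rule cond_lawD(2)[OF K]) simp_all
    also have "\<dots> = (\<integral>\<^sup>+\<omega>. emeasure (K (X \<omega>)) {y \<in> space T. (X \<omega>, y) \<in> E} \<partial>M)"
    proof (rule nn_integral_cong)
      fix \<omega>
      have "{y \<in> space T. (X \<omega>, y) \<in> E} = (if X \<omega> \<in> A then B else {})"
        unfolding E using sets.sets_into_space[OF \<open>B \<in> sets T\<close>] by auto
      then show "indicator A (X \<omega>) * emeasure (K (X \<omega>)) B = emeasure (K (X \<omega>)) {y \<in> space T. (X \<omega>, y) \<in> E}"
        by simp
    qed
    also have "\<dots> = emeasure J E"
      unfolding J_def by (rule em[OF idm, symmetric]) (simp add: E)
    finally show "emeasure (distr M (N \<Otimes>\<^sub>M T) (\<lambda>\<omega>. (X \<omega>, Y \<omega>))) E = emeasure J E" .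
  next
    show "emeasure (distr M (N \<Otimes>\<^sub>M T) (\<lambda>\<omega>. (X \<omega>, Y \<omega>))) (space N \<times> space T) \<noteq> \<infinity>" for i :: nat
      by (subst emeasure_distr) auto
  qed auto
  show ?thesis
  proof (rule measure_eqI)
    show "sets (distr M N X \<bind> (\<lambda>x. distr (K x) L (\<lambda>y. H (x, y)))) = sets (distr M L (\<lambda>\<omega>. H (X \<omega>, Y \<omega>)))"
      using ne by (subst sets_bind) auto
    fix E assume "E \<in> sets (distr M N X \<bind> (\<lambda>x. distr (K x) L (\<lambda>y. H (x, y))))"
    then have E[measurable]: "E \<in> sets L" using ne by (subst (asm) sets_bind) auto
    have HE: "H -` E \<inter> space (N \<Otimes>\<^sub>M T) \<in> sets (N \<Otimes>\<^sub>M T)" by measurable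
    have "emeasure (distr M N X \<bind> (\<lambda>x. distr (K x) L (\<lambda>y. H (x, y)))) E
      = (\<integral>\<^sup>+\<omega>. emeasure (K (X \<omega>)) {y \<in> space T. H (X \<omega>, y) \<in> E} \<partial>M)" by (rule em[OF H E])
    also have "\<dots> = (\<integral>\<^sup>+\<omega>. emeasure (K (X \<omega>)) {y \<in> space T. (X \<omega>, y) \<in> H -` E \<inter> space (N \<Otimes>\<^sub>M T)} \<partial>M)"
      using measurable_space[OF X]
      by (intro nn_integral_cong arg_cong[of _ _ "emeasure _"]) (auto simp: space_pair_measure)
    also have "\<dots> = emeasure J (H -` E \<inter> space (N \<Otimes>\<^sub>M T))"
      unfolding J_def by (rule em[OF idm HE, symmetric])
    also have "\<dots> = emeasure M ((\<lambda>\<omega>. (X \<omega>, Y \<omega>)) -` (H -` E \<inter> space (N \<Otimes>\<^sub>M T)) \<inter> space M)"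
      unfolding J_eq[symmetric] by (rule emeasure_distr[OF _ HE]) measurable
    also have "(\<lambda>\<omega>. (X \<omega>, Y \<omega>)) -` (H -` E \<inter> space (N \<Otimes>\<^sub>M T)) \<inter> space M = (\<lambda>\<omega>. H (X \<omega>, Y \<omega>)) -` E \<inter> space M"
      using measurable_space[OF X] measurable_space[OF Y] by (auto simp: space_pair_measure)
    also have "emeasure M \<dots> = emeasure (distr M L (\<lambda>\<omega>. H (X \<omega>, Y \<omega>))) E"
      by (rule emeasure_distr[symmetric]) measurable
    finally show "emeasure (distr M N X \<bind> (\<lambda>x. distr (K x) L (\<lambda>y. H (x, y)))) E = emeasure (distr M L (\<lambda>\<omega>. H (X \<omega>, Y \<omega>))) E" .
  qed
qed

text \<open>A tuple that misses a vertex of \<open>u\<close> is seen in full from a tuple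
  \<open>\<phi>\<close> of rank below \<open>i\<close>, an enumeration of the positions of the
  vertices of \<open>u\<close> that it uses. Hence its colour can be read off the code at
  \<open>\<phi>\<close>, at the place \<open>\<xi>'\<close>.\<close>

lemma vertices_factor:
  assumes e: "bij_betw e {1..i} u" and \<xi>: "distinct \<xi>" "set \<xi> \<subseteq> augment u" "\<not> Inl ` u \<subseteq> set \<xi>"
  shows "\<exists>\<phi> \<xi>'. \<phi> \<in> Injs (length \<phi>) {1..i} \<and> length \<phi> < i \<and>
    \<xi>' \<in> Injs (length \<xi>) (augment {1..length \<phi>}) \<and> map (lift e \<circ> vertex_at \<phi>) \<xi>' = \<xi>"
proof -
  define v where "v = {x \<in> {1..i}. Inl (e x) \<in> set \<xi>}"
  have "v \<subset> {1..i}"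
  proof -
    obtain y where y: "y \<in> u" "Inl y \<notin> set \<xi>" using \<xi>(3) by auto
    then obtain x where x: "x \<in> {1..i}" "e x = y" using e by (auto simp: bij_betw_def)
    then have "x \<notin> v" using y by (simp add: v_def)
    moreover have "v \<subseteq> {1..i}" by (auto simp: v_def)
    ultimately show ?thesis using x(1) by blast
  qed
  have "finite v" by (simp add: v_def)
  have "card v < card {1..i}" by (rule psubset_card_mono[OF _ \<open>v \<subset> {1..i}\<close>]) simp
  then have v: "finite v" "card v < i" using \<open>finite v\<close> by simp_all
  obtain \<phi> where \<phi>: "set \<phi> = v" "distinct \<phi>" using finite_distinct_list[OF v(1)] by blast
  have l: "length \<phi> < i" using distinct_card[OF \<phi>(2)] \<phi>(1) v(2) by simp
  have \<phi>I: "\<phi> \<in> Injs (length \<phi>) {1..i}" using \<phi> by (auto simp: Injs_def v_def)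
  let ?A = "augment {1..length \<phi>}" and ?\<theta> = "lift e \<circ> vertex_at \<phi>"
  have inj: "inj_on ?\<theta> ?A"
    using lift_augment(1)[of e "{1..i}"] e vertex_at_augment(1,3)[OF \<phi>I]
    by (intro comp_inj_on) (auto simp: bij_betw_def intro: inj_on_subset)
  have im: "set \<xi> \<subseteq> ?\<theta> ` ?A"
  proof
    fix x assume x: "x \<in> set \<xi>"
    show "x \<in> ?\<theta> ` ?A"
    proof (cases x)
      case (Inl s)
      then have "s \<in> u" using x \<xi>(2) by (auto simp: augment_def)
      then obtain j where j: "j \<in> {1..i}" "e j = s" using e by (auto simp: bij_betw_def)
      then have "j \<in> set \<phi>" using x Inl \<phi> by (auto simp: v_def)
      then obtain l where l: "l < length \<phi>" "\<phi> ! l = j" by (auto simp: in_set_conv_nth)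
      then have "?\<theta> (Inl (Suc l)) = x" using j Inl by (simp add: vertex_at_def)
      moreover have "Inl (Suc l) \<in> ?A" using l by (auto simp: augment_def)
      ultimately show ?thesis by (metis imageI)
    next
      case (Inr n)
      then have "?\<theta> (Inr n) = x" by (simp add: vertex_at_def)
      moreover have "Inr n \<in> ?A" by (auto simp: augment_def)
      ultimately show ?thesis by (metis imageI)
    qed
  qed
  define \<xi>' where "\<xi>' = map (inv_into ?A ?\<theta>) \<xi>"
  have "map ?\<theta> \<xi>' = \<xi>"
    unfolding \<xi>'_def map_map using im f_inv_into_f[of _ ?\<theta> ?A] by (intro map_idI) auto
  moreover have "\<xi>' \<in> Injs (length \<xi>) ?A"
  proof -
    have "distinct \<xi>'"
      unfolding \<xi>'_def distinct_map using \<xi>(1) inj_on_inv_into[OF im] by blast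
    moreover have "set \<xi>' \<subseteq> ?A"
    proof
      fix x assume "x \<in> set \<xi>'"
      then obtain y where y: "y \<in> set \<xi>" "x = inv_into ?A ?\<theta> y" unfolding \<xi>'_def set_map by (elim imageE)
      have "y \<in> ?\<theta> ` ?A" by (rule subsetD[OF im y(1)])
      then show "x \<in> ?A" unfolding y(2) by (rule inv_into_into)
    qed
    moreover have "length \<xi>' = length \<xi>" unfolding \<xi>'_def by simp
    ultimately show ?thesis unfolding Injs_def by simp
  qed
  ultimately show ?thesis using \<phi>I l by blast
qed

context exchangeable_colouring
begin

section \<open>Masking the colours of tuples through a given vertex set\<close>

abbreviation V :: "('s + nat) set" where "V \<equiv> augment S"

definition base :: "('s + nat) list \<Rightarrow> 'a" where
  "base = (SOME \<omega>. \<omega> \<in> space (Col V))"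

text \<open>Hidden entries are overwritten by the fixed colouring \<open>base\<close> instead of
  being dropped, so a masked colouring lies in \<open>Col V\<close> again and can be read and
  relabelled like any other.\<close>

definition masked :: "'s set \<Rightarrow> (('s + nat) list \<Rightarrow> 'a) \<Rightarrow> ('s + nat) list \<Rightarrow> 'a" where
  "masked u \<omega> = (\<lambda>\<psi>\<in>(\<Union>i\<in>{..k}. Injs i V). if Inl ` u \<subseteq> set \<psi> then base \<psi> else \<omega> \<psi>)"

lemma countable_V: "countable V"
  by (rule countable_augment[OF countable_S])

lemma prob_space_law_V: "prob_space (law V)"
  by (rule prob_space_law[OF countable_V])

lemma base_space: "base \<in> space (Col V)"
proof -
  have "space (Col V) \<noteq> {}" using prob_space.not_empty[OF prob_space_law_V] by simp
  then show ?thesis unfolding base_def by (simp add: some_in_eq)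
qed

lemma base_component: "\<psi> \<in> (\<Union>i\<in>{..k}. Injs i V) \<Longrightarrow> base \<psi> \<in> space (K (length \<psi>))"
  using base_space by (auto simp: colourings_def space_PiM PiE_iff)

lemma masked_measurable: "masked u \<in> Col V \<rightarrow>\<^sub>M Col V"
proof -
  have "masked u \<in> Col V \<rightarrow>\<^sub>M PiM (\<Union>i\<in>{..k}. Injs i V) (\<lambda>\<phi>. K (length \<phi>))"
    unfolding masked_def
  proof (rule measurable_restrict)
    fix \<psi> assume \<psi>: "\<psi> \<in> (\<Union>i\<in>{..k}. Injs i V)"
    show "(\<lambda>\<omega>. if Inl ` u \<subseteq> set \<psi> then base \<psi> else \<omega> \<psi>) \<in> Col V \<rightarrow>\<^sub>M K (length \<psi>)"
      using measurable_component_singleton[OF \<psi>, of "\<lambda>\<phi>. K (length \<phi>)"] base_component[OF \<psi>]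
      by (auto simp: colourings_def)
  qed
  then show ?thesis by (simp add: colourings_def)
qed

text \<open>The reading at \<open>\<phi>\<close> sees only tuples inside
  \<open>augment (set \<phi>)\<close>, and none of these runs through all of
  \<open>u\<close>.\<close>

lemma readings_mask:
  assumes \<phi>: "\<phi> \<in> (\<Union>i\<in>I. Injs i S)" "\<not> u \<subseteq> set \<phi>"
  shows "readings k r I S (masked u \<omega>) \<phi> = readings k r I S \<omega> \<phi>"
proof -
  have \<phi>': "\<phi> \<in> Injs (length \<phi>) S" using \<phi>(1) by (auto simp: Injs_def)
  let ?A = "augment {1..length \<phi>}"
  have "relabel (vertex_at \<phi>) {..k} ?A (masked u \<omega>) \<psi> = relabel (vertex_at \<phi>) {..k} ?A \<omega> \<psi>" for \<psi>
  proof (cases "\<psi> \<in> (\<Union>i\<in>{..k}. Injs i ?A)")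
    case True
    then have m: "map (vertex_at \<phi>) \<psi> \<in> (\<Union>i\<in>{..k}. Injs i V)"
      using map_in_Injs[OF vertex_at_augment(1,3)[OF \<phi>']] by blast
    have "set \<psi> \<subseteq> ?A" using True by (auto simp: Injs_def)
    then have "set (map (vertex_at \<phi>) \<psi>) \<subseteq> augment (set \<phi>)" using vertex_at_augment(2)[OF \<phi>'] by auto
    moreover have "\<not> Inl ` u \<subseteq> augment (set \<phi>)" using \<phi>(2) by (auto simp: augment_def)
    ultimately have "\<not> Inl ` u \<subseteq> set (map (vertex_at \<phi>) \<psi>)" by (meson order_trans)
    then show ?thesis using m True by (simp add: relabel_apply masked_def)
  next
    case False
    then show ?thesis by (simp add: relabel_def)
  qed
  then have "relabel (vertex_at \<phi>) {..k} ?A (masked u \<omega>) = relabel (vertex_at \<phi>) {..k} ?A \<omega>" by (rule ext)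
  then show ?thesis using \<phi>(1) by (simp add: readings_def)
qed

text \<open>
  The masked colouring hides exactly the colours of the tuples whose vertices contain all of \<open>u\<close>.
  An event depending on finitely many tuples from \<open>u\<close> and the auxiliary vertices is unaffected by an
  injection \<open>\<tau>\<close> that fixes \<open>u\<close> and the auxiliary vertices involved and sends everything else to
  unused auxiliary vertices. What \<open>\<tau>\<close> reads of the masked colouring is already known to the codes of
  the proper subtuples of \<open>u\<close>.
\<close>

lemma cond_law_mask:
  assumes u: "u \<subseteq> S" and e: "bij_betw e {1..i} u"
    and Q: "cond_law (law (augment {1..i})) (codes {..<i} {1..i}) (Cod {..<i} {1..i}) (\<lambda>\<omega>. \<omega>) (Col (augment {1..i})) Q"
  shows "cond_law (law V) (masked u) (Col V) (relabel (lift e) {..k} (augment {1..i})) (Col (augment {1..i}))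
    (\<lambda>y. Q (codes {..<i} {1..i} (relabel (lift e) {..k} (augment {1..i}) y)))"
proof -
  let ?A = "augment {1..i}" and ?N = "Cod {..<i} {1..i}" and ?z = "codes {..<i} {1..i}"
  let ?s = "relabel (lift e) {..k} (augment {1..i})"
  interpret prob_space "law V" by (rule prob_space_law_V)
  note Qm = cond_lawD(1)[OF Q]
  have ei: "inj_on e {1..i}" "e ` {1..i} \<subseteq> S" "e ` {1..i} = u" using e u by (auto simp: bij_betw_def)
  have le: "inj_on (lift e) ?A" "lift e ` ?A \<subseteq> V" "lift e ` ?A \<subseteq> augment u"
    using lift_augment(1)[OF ei(1)] lift_augment(2)[OF ei(2)] lift_augment(2)[OF equalityD1[OF ei(3)]] by auto
  have sm: "?s \<in> Col V \<rightarrow>\<^sub>M Col ?A" by (rule relabel_measurable[OF le(1,2)])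
  have zsm: "(\<lambda>y. ?z (?s y)) \<in> Col V \<rightarrow>\<^sub>M ?N" by (rule measurable_compose[OF sm codes_measurable])
  have maskm: "masked u \<in> law V \<rightarrow>\<^sub>M Col V" using masked_measurable by (simp cong: measurable_cong_sets)
  have zs: "?z (?s y) = relabel e {..<i} {1..i} (codes {..<i} S y)" for y
    by (rule readings_relabel[OF ei(1,2)])
  \<comment> \<open>A tuple of rank below \<open>i\<close> has too few vertices to contain
    \<open>u\<close>, so its code survives the masking.\<close>
  have zmask: "?z (?s (masked u y)) = ?z (?s y)" for y
  proof
    fix \<phi>
    show "?z (?s (masked u y)) \<phi> = ?z (?s y) \<phi>"
    proof (cases "\<phi> \<in> (\<Union>j\<in>{..<i}. Injs j {1..i})")
      case True
      then have m: "map e \<phi> \<in> (\<Union>j\<in>{..<i}. Injs j S)" using map_in_Injs[OF ei(1,2)] by blast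
      have "card (set (map e \<phi>)) < card u"
        using True bij_betw_same_card[OF e] card_length[of "map e \<phi>"] by (auto simp: Injs_def)
      moreover have "finite (set (map e \<phi>))" by simp
      ultimately have "\<not> u \<subseteq> set (map e \<phi>)" by (meson card_mono not_le)
      then show ?thesis unfolding zs using True m by (simp add: relabel_apply readings_mask del: set_map)
    next
      case False
      then show ?thesis unfolding zs by (simp add: relabel_def)
    qed
  qed
  let ?I = "\<Union>j\<in>{..k}. Injs j ?A" and ?K = "\<lambda>\<phi>::(nat + nat) list. K (length \<phi>)"
  show ?thesis
  proof (rule cond_law_generated[where G = "prod_algebra ?I ?K"])
    show "prob_space (law V)" by (rule prob_space_axioms)
    show "masked u \<in> law V \<rightarrow>\<^sub>M Col V" by (rule maskm)
    show "?s \<in> law V \<rightarrow>\<^sub>M Col ?A" using sm by (simp cong: measurable_cong_sets)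
    show "(\<lambda>y. Q (?z (?s y))) \<in> Col V \<rightarrow>\<^sub>M prob_algebra (Col ?A)" by (rule measurable_compose[OF zsm Qm])
    show "sets (Col ?A) = sigma_sets (space (Col ?A)) (prod_algebra ?I ?K)"
      by (simp add: colourings_def sets_PiM space_PiM)
    show "Int_stable (prod_algebra ?I ?K)" by (rule Int_stable_prod_algebra)
    show "prod_algebra ?I ?K \<subseteq> Pow (space (Col ?A))"
      using prod_algebra_sets_into_space[of ?I ?K] by (simp add: colourings_def space_PiM)
    fix A B assume A: "A \<in> sets (Col V)" and "B \<in> prod_algebra ?I ?K"
    then obtain J E where J: "finite J" "J \<subseteq> ?I" and E: "\<And>j. j \<in> J \<Longrightarrow> E j \<in> sets (?K j)"
      and B: "B = prod_emb ?I ?K J (Pi\<^sub>E J E)"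
      by (auto elim!: prod_algebraE)
    have Bs: "B \<in> sets (Col ?A)" unfolding B colourings_def by (rule sets_PiM_I) (use J E in auto)
    have "finite (\<Union>\<psi>\<in>J. set \<psi>)" using J(1) by auto
    then have "finite (Inr -` (\<Union>\<psi>\<in>J. set \<psi>) :: nat set)" by (rule finite_vimageI) simp
    then obtain m where m: "\<And>n \<psi>. \<psi> \<in> J \<Longrightarrow> Inr n \<in> set \<psi> \<Longrightarrow> n < m"
      unfolding finite_nat_set_iff_bounded by auto
    \<comment> \<open>Auxiliary vertices from \<open>m\<close> on do not occur in the event. Among
      them even offsets receive the vertices of \<open>S\<close> outside \<open>u\<close>, and odd
      offsets the auxiliary vertices from \<open>m\<close> on, which keeps \<open>\<tau>\<close>
      injective.\<close>
    define \<tau> where "\<tau> = case_sum (\<lambda>s. if s \<in> u then Inl s else Inr (m + 2 * to_nat_on S s))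
      (\<lambda>n. if n < m then Inr n else Inr (m + 2 * n + 1))"
    have \<tau>V: "\<tau> x \<in> augment u" for x by (cases x) (auto simp: \<tau>_def augment_def)
    have inj\<tau>: "inj_on \<tau> V"
    proof (rule inj_onI)
      fix x y assume "x \<in> V" "y \<in> V" "\<tau> x = \<tau> y"
      moreover have "to_nat_on S s = to_nat_on S t \<longleftrightarrow> s = t" if "s \<in> S" "t \<in> S" for s t
        using inj_on_to_nat_on[OF countable_S] that by (auto simp: inj_on_def)
      ultimately show "x = y"
        by (cases x; cases y) (auto simp: \<tau>_def augment_def split: if_splits; presburger)+
    qed
    have im\<tau>: "\<tau> ` V \<subseteq> V" 
    proof -
      have "augment u \<subseteq> V" using u by (auto simp: augment_def)
      then show ?thesis using \<tau>V by blast
    qed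
    have \<tau>fix: "map \<tau> (map (lift e) \<psi>) = map (lift e) \<psi>" if \<psi>: "\<psi> \<in> J" for \<psi>
    proof -
      have "\<tau> (lift e x) = lift e x" if x: "x \<in> set \<psi>" for x
      proof (cases x)
        case (Inl j)
        have "x \<in> ?A" using \<psi> J(2) x by (auto simp: Injs_def)
        then have "e j \<in> u" using Inl ei(3) by (auto simp: augment_def)
        then show ?thesis using Inl by (simp add: \<tau>_def)
      next
        case (Inr n)
        then show ?thesis using m[OF \<psi>] x by (simp add: \<tau>_def)
      qed
      then show ?thesis by simp
    qed
    let ?\<tau> = "relabel \<tau> {..k} V"
    have \<tau>m: "?\<tau> \<in> Col V \<rightarrow>\<^sub>M Col V" by (rule relabel_measurable[OF inj\<tau> im\<tau>])
    define F where "F = ?s -` B \<inter> space (Col V)"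
    have F: "F \<in> sets (Col V)" unfolding F_def by (rule measurable_sets[OF sm Bs])
    have F\<tau>: "?\<tau> \<omega> \<in> F \<longleftrightarrow> \<omega> \<in> F" if \<omega>: "\<omega> \<in> space (Col V)" for \<omega>
    proof -
      have \<omega>': "?\<tau> \<omega> \<in> space (Col V)" by (rule measurable_space[OF \<tau>m \<omega>])
      have "?s (?\<tau> \<omega>) \<psi> = ?s \<omega> \<psi>" if "\<psi> \<in> J" for \<psi>
      proof -
        have I: "\<psi> \<in> ?I" using that J(2) by blast
        then have "map (lift e) \<psi> \<in> (\<Union>j\<in>{..k}. Injs j V)" using map_in_Injs[OF le(1,2)] by blast
        then show ?thesis using I \<tau>fix[OF that] by (simp only: relabel_apply)
      qed
      moreover have "?s \<omega> \<in> space (PiM ?I ?K)" "?s (?\<tau> \<omega>) \<in> space (PiM ?I ?K)"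
        using measurable_space[OF sm \<omega>] measurable_space[OF sm \<omega>'] by (simp_all add: colourings_def)
      ultimately have "?s (?\<tau> \<omega>) \<in> B \<longleftrightarrow> ?s \<omega> \<in> B"
        unfolding B using J(2) by (auto simp: prod_emb_def space_PiM PiE_iff restrict_def extensional_def)
      then show ?thesis using \<omega> \<omega>' by (simp add: F_def)
    qed
    define p where "p z = (if z \<in> space ?N then measure (Q z) B else 0)" for z
    have pm: "p \<in> borel_measurable ?N"
    proof -
      have "(\<lambda>z. measure (Q z) B) \<in> borel_measurable ?N"
        by (rule measurable_compose[OF Qm measurable_measure_prob_algebra[OF Bs]])
      then show ?thesis by (rule measurable_cong[THEN iffD1, rotated]) (simp add: p_def)
    qed
    have p01: "0 \<le> p z" "p z \<le> 1" for z
      using kernel_space(1)[OF Qm, of z] prob_space.prob_le_1 by (auto simp: p_def)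
    have p_em: "ennreal (p z) = emeasure (Q z) B" if "z \<in> space ?N" for z
    proof -
      interpret Q: prob_space "Q z" by (rule kernel_space(1)[OF Qm that])
      show ?thesis using that by (simp add: p_def Q.emeasure_eq_measure)
    qed
    \<comment> \<open>A \<open>good\<close> pair for \<open>\<psi>\<close> is a tuple of rank below
      \<open>i\<close> from which \<open>map \<tau> \<psi>\<close> is visible, and the place at
      which it is seen.\<close>
    define good where "good \<psi> p \<longleftrightarrow> fst p \<in> Injs (length (fst p)) {1..i} \<and> length (fst p) < i \<and>
      snd p \<in> Injs (length \<psi>) (augment {1..length (fst p)}) \<and> map (lift e \<circ> vertex_at (fst p)) (snd p) = map \<tau> \<psi>"
      for \<psi> p
    have good: "\<exists>p. good \<psi> p" if \<psi>: "\<psi> \<in> (\<Union>j\<in>{..k}. Injs j V)" "\<not> Inl ` u \<subseteq> set \<psi>" for \<psi>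
    proof -
      have \<psi>': "distinct \<psi>" "set \<psi> \<subseteq> V" using \<psi>(1) by (auto simp: Injs_def)
      have "distinct (map \<tau> \<psi>)" using \<psi>' inj\<tau> by (auto simp: distinct_map intro: inj_on_subset)
      moreover have "set (map \<tau> \<psi>) \<subseteq> augment u" using \<tau>V by auto
      \<comment> \<open>The only vertex that \<open>\<tau>\<close> sends to \<open>Inl s\<close>
        with \<open>s\<close> in \<open>u\<close> is \<open>Inl s\<close> itself, so a tuple missing
        a vertex of \<open>u\<close> still misses it after \<open>\<tau>\<close>.\<close>
      moreover have "\<not> Inl ` u \<subseteq> set (map \<tau> \<psi>)"
      proof
        assume *: "Inl ` u \<subseteq> set (map \<tau> \<psi>)"
        have "Inl s \<in> set \<psi>" if s: "s \<in> u" for s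
        proof -
          have "Inl s \<in> set (map \<tau> \<psi>)" using * s by blast
          then obtain x where x: "x \<in> set \<psi>" "\<tau> x = Inl s" by auto
          have "x = Inl s" using x(2) by (auto simp: \<tau>_def split: sum.splits if_splits)
          then show ?thesis using x(1) by simp
        qed
        then show False using \<psi>(2) by blast
      qed
      ultimately show ?thesis using vertices_factor[OF e, of "map \<tau> \<psi>"] unfolding good_def by auto
    qed
    define c where "c \<psi> = (SOME p. good \<psi> p)" for \<psi>
    have c: "good \<psi> (c \<psi>)" if "\<psi> \<in> (\<Union>j\<in>{..k}. Injs j V)" "\<not> Inl ` u \<subseteq> set \<psi>" for \<psi>
      unfolding c_def using good[OF that] by (rule someI_ex)
    \<comment> \<open>Rebuilds the masked colouring pulled back along \<open>\<tau>\<close> from the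
      lower codes of \<open>u\<close>: the code at the chosen tuple is decoded and read at the
      chosen place. Entries through \<open>u\<close> are masked and equal \<open>base\<close>
      anyway.\<close>
    define \<Delta> where "\<Delta> z = (\<lambda>\<psi>\<in>(\<Union>j\<in>{..k}. Injs j V). if Inl ` u \<subseteq> set \<psi> then base \<psi>
      else dec (length (fst (c \<psi>))) (z (fst (c \<psi>))) (snd (c \<psi>)))" for z
    have \<Delta>m: "\<Delta> \<in> ?N \<rightarrow>\<^sub>M Col V"
      unfolding colourings_def[of K] \<Delta>_def
    proof (rule measurable_restrict)
      fix \<psi> assume \<psi>: "\<psi> \<in> (\<Union>j\<in>{..k}. Injs j V)"
      show "(\<lambda>z. if Inl ` u \<subseteq> set \<psi> then base \<psi> else dec (length (fst (c \<psi>))) (z (fst (c \<psi>))) (snd (c \<psi>))) \<in> ?N \<rightarrow>\<^sub>M K (length \<psi>)"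
      proof (cases "Inl ` u \<subseteq> set \<psi>")
        case True
        then show ?thesis using base_component[OF \<psi>] by simp
      next
        case False
        note g = c[OF \<psi> False, unfolded good_def]
        have "fst (c \<psi>) \<in> (\<Union>j\<in>{..<i}. Injs j {1..i})" using g by auto
        then have 1: "(\<lambda>z. z (fst (c \<psi>))) \<in> ?N \<rightarrow>\<^sub>M (borel :: real measure)"
          unfolding colourings_def by (rule measurable_component_singleton)
        have "length \<psi> \<le> k" using \<psi> by (auto simp: Injs_def)
        then have "snd (c \<psi>) \<in> (\<Union>j\<in>{..k}. Injs j (augment {1..length (fst (c \<psi>))}))" using g by auto
        then have 2: "(\<lambda>\<omega>. \<omega> (snd (c \<psi>))) \<in> Col (augment {1..length (fst (c \<psi>))}) \<rightarrow>\<^sub>M K (length (snd (c \<psi>)))"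
          unfolding colourings_def using measurable_component_singleton[of "snd (c \<psi>)" _ "\<lambda>\<phi>. K (length \<phi>)"] by simp
        have "length (snd (c \<psi>)) = length \<psi>" using g by (auto simp: Injs_def)
        then show ?thesis
          using measurable_compose[OF measurable_compose[OF 1 dec_measurable] 2] False by simp
      qed
    qed
    have \<Delta>: "masked u (?\<tau> \<omega>) = \<Delta> (?z (?s \<omega>))" if \<omega>: "\<omega> \<in> space (Col V)" for \<omega>
    proof
      fix \<psi>
      show "masked u (?\<tau> \<omega>) \<psi> = \<Delta> (?z (?s \<omega>)) \<psi>"
      proof (cases "\<psi> \<in> (\<Union>j\<in>{..k}. Injs j V) \<and> \<not> Inl ` u \<subseteq> set \<psi>")
        case True
        then have \<psi>: "\<psi> \<in> (\<Union>j\<in>{..k}. Injs j V)" "\<not> Inl ` u \<subseteq> set \<psi>" by auto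
        obtain \<phi> \<xi> where c\<psi>: "c \<psi> = (\<phi>, \<xi>)" by (cases "c \<psi>")
        from c[OF \<psi>] have g: "\<phi> \<in> Injs (length \<phi>) {1..i}" "length \<phi> < i"
          "\<xi> \<in> Injs (length \<psi>) (augment {1..length \<phi>})" "map (lift e \<circ> vertex_at \<phi>) \<xi> = map \<tau> \<psi>"
          unfolding good_def c\<psi> by auto
        have "length \<psi> \<le> k" using \<psi>(1) by (auto simp: Injs_def)
        then have \<xi>: "\<xi> \<in> (\<Union>j\<in>{..k}. Injs j (augment {1..length \<phi>}))" using g(3) by auto
        have s\<omega>: "?s \<omega> \<in> space (Col ?A)" by (rule measurable_space[OF sm \<omega>])
        have \<phi>I: "\<phi> \<in> (\<Union>j\<in>{..<i}. Injs j {1..i})" using g(1,2) by blast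
        have "?z (?s \<omega>) \<phi> = enc (length \<phi>) (relabel (vertex_at \<phi>) {..k} (augment {1..length \<phi>}) (?s \<omega>))"
          using \<phi>I by (simp add: readings_def)
        then have "dec (length \<phi>) (?z (?s \<omega>) \<phi>) = relabel (vertex_at \<phi>) {..k} (augment {1..length \<phi>}) (?s \<omega>)"
          using dec_enc[OF relabel_in_space[OF vertex_at_augment(1,3)[OF g(1)] s\<omega>]] by simp
        also have "\<dots> = relabel (lift e \<circ> vertex_at \<phi>) {..k} (augment {1..length \<phi>}) \<omega>"
          by (rule relabel_relabel[OF vertex_at_augment(1,3)[OF g(1)]])
        finally have "dec (length \<phi>) (?z (?s \<omega>) \<phi>) \<xi> = \<omega> (map \<tau> \<psi>)"
          by (simp only: relabel_apply[OF \<xi>] g(4))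
        then show ?thesis using \<psi> by (simp add: \<Delta>_def masked_def c\<psi> relabel_apply)
      qed (auto simp: \<Delta>_def masked_def)
    qed
    have set_int: "emeasure M {\<omega> \<in> space M. X \<omega> \<in> A \<and> \<omega> \<in> B} = (\<integral>\<^sup>+\<omega>. indicator A (X \<omega>) * indicator B \<omega> \<partial>M)"
      if "{\<omega> \<in> space M. X \<omega> \<in> A \<and> \<omega> \<in> B} \<in> sets M" for M :: "'m measure" and X :: "'m \<Rightarrow> 'n" and A B
    proof -
      have "emeasure M {\<omega> \<in> space M. X \<omega> \<in> A \<and> \<omega> \<in> B} = (\<integral>\<^sup>+\<omega>. indicator {\<omega> \<in> space M. X \<omega> \<in> A \<and> \<omega> \<in> B} \<omega> \<partial>M)"
        by (rule nn_integral_indicator[OF that, symmetric])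
      also have "\<dots> = (\<integral>\<^sup>+\<omega>. indicator A (X \<omega>) * indicator B \<omega> \<partial>M)"
        by (intro nn_integral_cong) (auto simp: indicator_def)
      finally show ?thesis .
    qed
    have ind: "(\<lambda>\<omega>. indicator A (masked u \<omega>) :: ennreal) \<in> borel_measurable (Col V)" if "A \<in> sets (Col V)" for A
      by (rule measurable_compose[OF masked_measurable borel_measurable_indicator[OF that]])
    have "(\<integral>\<^sup>+\<omega>. indicator A (masked u \<omega>) * indicator F \<omega> \<partial>law V) = (\<integral>\<^sup>+\<omega>. indicator A (masked u \<omega>) * ennreal (p (?z (?s \<omega>))) \<partial>law V)"
    \<comment> \<open>The large conditioning variable is the masked colouring, its image under
      \<open>\<tau>\<close> is \<open>X'\<close>, and the small one is the family of lower codes of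
      \<open>u\<close>. Equality of the joint laws comes from the invariance of \<open>law V\<close>
      under \<open>\<tau>\<close> and of \<open>F\<close> under \<open>?\<tau>\<close>.\<close>
    proof (rule conditional_probability_enlarge[where N = "Col V" and D = ?N and \<Delta> = \<Delta> and \<Gamma> = "\<lambda>y. ?z (?s y)" and X = "masked u"
          and X' = "\<lambda>\<omega>. masked u (?\<tau> \<omega>)" and Y = "\<lambda>\<omega>. ?z (?s \<omega>)" and p = p])
      show "prob_space (law V)" by (rule prob_space_axioms)
      show "masked u \<in> law V \<rightarrow>\<^sub>M Col V" by (rule maskm)
      show "(\<lambda>\<omega>. masked u (?\<tau> \<omega>)) \<in> law V \<rightarrow>\<^sub>M Col V"
        using measurable_compose[OF \<tau>m masked_measurable] by (simp cong: measurable_cong_sets)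
      show "(\<lambda>\<omega>. ?z (?s \<omega>)) \<in> law V \<rightarrow>\<^sub>M ?N" using zsm by (simp cong: measurable_cong_sets)
      show "F \<in> sets (law V)" using F by simp
      show "\<Delta> \<in> ?N \<rightarrow>\<^sub>M Col V" by (rule \<Delta>m)
      show "masked u (?\<tau> \<omega>) = \<Delta> (?z (?s \<omega>))" if "\<omega> \<in> space (law V)" for \<omega> using \<Delta> that by simp
      show "(\<lambda>y. ?z (?s y)) \<in> Col V \<rightarrow>\<^sub>M ?N" by (rule zsm)
      show "?z (?s \<omega>) = ?z (?s (masked u \<omega>))" for \<omega> by (rule zmask[symmetric])
      show "(\<integral>\<^sup>+\<omega>. indicator A (masked u \<omega>) \<partial>law V) = (\<integral>\<^sup>+\<omega>. indicator A (masked u (?\<tau> \<omega>)) \<partial>law V)" if "A \<in> sets (Col V)" for A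
        by (rule nn_integral_law_relabel[OF countable_V inj\<tau> im\<tau> ind[OF that], symmetric])
      show "(\<integral>\<^sup>+\<omega>. indicator A (masked u \<omega>) * indicator F \<omega> \<partial>law V) = (\<integral>\<^sup>+\<omega>. indicator A (masked u (?\<tau> \<omega>)) * indicator F \<omega> \<partial>law V)" if "A \<in> sets (Col V)" for A
      proof -
        have "(\<integral>\<^sup>+\<omega>. indicator A (masked u \<omega>) * indicator F \<omega> \<partial>law V) = (\<integral>\<^sup>+\<omega>. indicator A (masked u (?\<tau> \<omega>)) * indicator F (?\<tau> \<omega>) \<partial>law V)"
          by (rule nn_integral_law_relabel[OF countable_V inj\<tau> im\<tau>, symmetric])
            (intro borel_measurable_times_ennreal ind[OF that] borel_measurable_indicator F)
        also have "\<dots> = (\<integral>\<^sup>+\<omega>. indicator A (masked u (?\<tau> \<omega>)) * indicator F \<omega> \<partial>law V)"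
          using F\<tau> by (intro nn_integral_cong) (simp add: indicator_def)
        finally show ?thesis .
      qed
      show "p \<in> borel_measurable ?N" by (rule pm)
      show "0 \<le> p z" "p z \<le> 1" for z by (rule p01)+
      show "(\<integral>\<^sup>+\<omega>. indicator A (?z (?s \<omega>)) * indicator F \<omega> \<partial>law V) = (\<integral>\<^sup>+\<omega>. indicator A (?z (?s \<omega>)) * ennreal (p (?z (?s \<omega>))) \<partial>law V)"
        if A: "A \<in> sets ?N" for A
      proof -
        have iA: "(\<lambda>\<omega>. indicator A (?z \<omega>) :: ennreal) \<in> borel_measurable (Col ?A)"
          by (rule measurable_compose[OF codes_measurable borel_measurable_indicator[OF A]])
        have "(\<integral>\<^sup>+\<omega>. indicator A (?z (?s \<omega>)) * indicator F \<omega> \<partial>law V) = (\<integral>\<^sup>+\<omega>. indicator A (?z (?s \<omega>)) * indicator B (?s \<omega>) \<partial>law V)"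
          by (intro nn_integral_cong) (simp add: F_def indicator_def)
        also have "\<dots> = (\<integral>\<^sup>+\<omega>. indicator A (?z \<omega>) * indicator B \<omega> \<partial>law ?A)"
          by (rule nn_integral_law_relabel[OF countable_V le(1,2)])
            (intro borel_measurable_times_ennreal iA borel_measurable_indicator Bs)
        also have "\<dots> = emeasure (law ?A) {\<omega> \<in> space (law ?A). ?z \<omega> \<in> A \<and> \<omega> \<in> B}"
        proof (rule set_int[symmetric])
          have "{\<omega> \<in> space (law ?A). ?z \<omega> \<in> A \<and> \<omega> \<in> B} = (?z -` A \<inter> space (Col ?A)) \<inter> B"
            using sets.sets_into_space[OF Bs] by auto
          then show "{\<omega> \<in> space (law ?A). ?z \<omega> \<in> A \<and> \<omega> \<in> B} \<in> sets (law ?A)"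
            using measurable_sets[OF codes_measurable A] Bs by auto
        qed
        also have "\<dots> = (\<integral>\<^sup>+\<omega>. indicator A (?z \<omega>) * emeasure (Q (?z \<omega>)) B \<partial>law ?A)"
          by (rule cond_lawD(2)[OF Q A Bs])
        also have "\<dots> = (\<integral>\<^sup>+\<omega>. indicator A (?z \<omega>) * ennreal (p (?z \<omega>)) \<partial>law ?A)"
          by (intro nn_integral_cong) (simp add: p_em measurable_space[OF codes_measurable])
        also have "\<dots> = (\<integral>\<^sup>+\<omega>. indicator A (?z (?s \<omega>)) * ennreal (p (?z (?s \<omega>))) \<partial>law V)"
          by (rule nn_integral_law_relabel[OF countable_V le(1,2), symmetric])
            (intro borel_measurable_times_ennreal iA measurable_compose[OF measurable_compose[OF codes_measurable pm] measurable_ennreal])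
        finally show ?thesis .
      qed
    qed (rule A)
    moreover have "(\<integral>\<^sup>+\<omega>. indicator A (masked u \<omega>) * ennreal (p (?z (?s \<omega>))) \<partial>law V)
        = (\<integral>\<^sup>+\<omega>. indicator A (masked u \<omega>) * emeasure (Q (?z (?s (masked u \<omega>)))) B \<partial>law V)"
      by (intro nn_integral_cong) (simp add: p_em zmask measurable_space[OF zsm])
    moreover have "(\<integral>\<^sup>+\<omega>. indicator A (masked u \<omega>) * indicator F \<omega> \<partial>law V) = emeasure (law V) {\<omega> \<in> space (law V). masked u \<omega> \<in> A \<and> ?s \<omega> \<in> B}"
    proof -
      have eq: "{\<omega> \<in> space (law V). masked u \<omega> \<in> A \<and> \<omega> \<in> F} = {\<omega> \<in> space (law V). masked u \<omega> \<in> A \<and> ?s \<omega> \<in> B}"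
        by (auto simp: F_def)
      have "{\<omega> \<in> space (law V). masked u \<omega> \<in> A \<and> \<omega> \<in> F} = (masked u -` A \<inter> space (Col V)) \<inter> F"
        by (auto simp: F_def)
      then have "{\<omega> \<in> space (law V). masked u \<omega> \<in> A \<and> \<omega> \<in> F} \<in> sets (law V)"
        using measurable_sets[OF masked_measurable A] F by auto
      from set_int[OF this] show ?thesis unfolding eq by simp
    qed
    ultimately show "emeasure (law V) {\<omega> \<in> space (law V). masked u \<omega> \<in> A \<and> ?s \<omega> \<in> B}
        = (\<integral>\<^sup>+\<omega>. indicator A (masked u \<omega>) * emeasure (Q (?z (?s (masked u \<omega>)))) B \<partial>law V)"
      by simp
  qed
qed

end

section \<open>The recipe\<close>

lemma standard_borel_real: "standard_borel (borel :: real measure)"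
  unfolding standard_borel_def
proof (intro exI[of _ euclidean] conjI)
  show "completely_metrizable_space (euclidean :: real topology)" by (rule completely_metrizable_space_euclidean)
  show "separable_space (euclidean :: real topology)"
  proof -
    obtain D :: "real set" where D: "countable D" "\<forall>X. open X \<longrightarrow> X \<noteq> {} \<longrightarrow> (\<exists>d\<in>D. d \<in> X)"
      using countable_dense_exists by (elim exE conjE)
    have "x \<in> euclidean closure_of D" for x
      unfolding in_closure_of using D(2) by (metis UNIV_I empty_iff open_openin topspace_euclidean)
    then have "euclidean closure_of D = UNIV" by blast
    then show ?thesis using D(1) by (auto simp: separable_space_def)
  qed
qed (simp_all add: borel_def)

text \<open>Sorts the values by image set; the gluing map in \<open>step_law\<close> undoes
  this.\<close>

definition split_orbits :: "nat \<Rightarrow> 's set \<Rightarrow> ('s list \<Rightarrow> 't) \<Rightarrow> 's set \<Rightarrow> 's list \<Rightarrow> 't" where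
  "split_orbits i X w = (\<lambda>u\<in>nsets X i. restrict w (Injs i u))"

lemma split_orbits_measurable:
  "split_orbits i X \<in> colourings (\<lambda>_. T) {i} X \<rightarrow>\<^sub>M PiM (nsets X i) (\<lambda>u. colourings (\<lambda>_. T) {i} u)"
  unfolding split_orbits_def
proof (rule measurable_restrict)
  fix u assume "u \<in> nsets X i"
  then have "(\<Union>j\<in>{i}. Injs j u) \<subseteq> (\<Union>j\<in>{i}. Injs j X)" by (auto simp: nsets_def Injs_def)
  from measurable_restrict_subset[OF this, of "\<lambda>_. T"]
  show "(\<lambda>w. restrict w (Injs i u)) \<in> colourings (\<lambda>_. T) {i} X \<rightarrow>\<^sub>M colourings (\<lambda>_. T) {i} u"
    by (simp add: colourings_def)
qed

lemma set_in_nsets: "\<phi> \<in> Injs i X \<Longrightarrow> set \<phi> \<in> nsets X i"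
  by (auto simp: Injs_def nsets_def distinct_card)

lemma glue_measurable:
  "(\<lambda>w. \<lambda>\<phi>\<in>Injs i X. w (set \<phi>) \<phi>) \<in> PiM (nsets X i) (\<lambda>u. colourings (\<lambda>_. T) {i} u) \<rightarrow>\<^sub>M colourings (\<lambda>_. T) {i} X"
proof -
  have "(\<lambda>w. \<lambda>\<phi>\<in>(\<Union>j\<in>{i}. Injs j X). w (set \<phi>) \<phi>) \<in> PiM (nsets X i) (\<lambda>u. colourings (\<lambda>_. T) {i} u) \<rightarrow>\<^sub>M colourings (\<lambda>_. T) {i} X"
    unfolding colourings_def[of _ _ X]
  proof (rule measurable_restrict)
    fix \<phi> assume "\<phi> \<in> (\<Union>j\<in>{i}. Injs j X)"
    then have \<phi>: "\<phi> \<in> Injs i X" by simp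
    then have \<phi>': "\<phi> \<in> (\<Union>j\<in>{i}. Injs j (set \<phi>))" by (simp add: Injs_def)
    have "(\<lambda>x. x \<phi>) \<in> colourings (\<lambda>_. T) {i} (set \<phi>) \<rightarrow>\<^sub>M T"
      unfolding colourings_def by (rule measurable_component_singleton[OF \<phi>'])
    from measurable_compose[OF measurable_component_singleton[OF set_in_nsets[OF \<phi>], of "\<lambda>u. colourings (\<lambda>_. T) {i} u"] this]
    show "(\<lambda>w. w (set \<phi>) \<phi>) \<in> PiM (nsets X i) (\<lambda>u. colourings (\<lambda>_. T) {i} u) \<rightarrow>\<^sub>M T" .
  qed
  then show ?thesis by simp
qed

context exchangeable_colouring
begin

section \<open>The kernels and one step of the recipe\<close>

definition level_law :: "nat \<Rightarrow> (nat list \<Rightarrow> real) \<Rightarrow> ((nat + nat) list \<Rightarrow> 'a) measure" where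
  "level_law i = (SOME Q.
    cond_law (law (augment {1..i})) (codes {..<i} {1..i}) (Cod {..<i} {1..i}) (\<lambda>\<omega>. \<omega>) (Col (augment {1..i})) Q \<and>
    (\<forall>\<sigma> z. \<sigma> permutes {1..i} \<and> z \<in> space (Cod {..<i} {1..i}) \<longrightarrow>
      Q (relabel \<sigma> {..<i} {1..i} z) = distr (Q z) (Col (augment {1..i})) (relabel (lift \<sigma>) {..k} (augment {1..i}))))"

lemma level_law:
  "cond_law (law (augment {1..i})) (codes {..<i} {1..i}) (Cod {..<i} {1..i}) (\<lambda>\<omega>. \<omega>) (Col (augment {1..i})) (level_law i)"
  "\<sigma> permutes {1..i} \<Longrightarrow> z \<in> space (Cod {..<i} {1..i}) \<Longrightarrow>
    level_law i (relabel \<sigma> {..<i} {1..i} z) = distr (level_law i z) (Col (augment {1..i})) (relabel (lift \<sigma>) {..k} (augment {1..i}))"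
  using someI_ex[OF covariant_conditional_law[of i], folded level_law_def] by blast+

text \<open>All kernels are images of \<open>level_law\<close>, the law of the full colouring around
  an i-set. The parameters cover two cases: codes (\<open>enc\<close>) at ranks below
  \<open>k\<close>, and only the colour of the tuple itself (\<open>own_colour\<close>) at rank
  \<open>k\<close>.\<close>

definition kernel ::
    "nat \<Rightarrow> 't measure \<Rightarrow> (nat \<Rightarrow> ((nat + nat) list \<Rightarrow> 'a) \<Rightarrow> 't) \<Rightarrow> (nat list \<Rightarrow> real) \<Rightarrow> (nat list \<Rightarrow> 't) measure" where
  "kernel i T r z = distr (level_law i z) (colourings (\<lambda>_. T) {i} {1..i}) (readings k r {i} {1..i})"

context
  fixes i :: nat and T :: "'t measure" and r :: "nat \<Rightarrow> ((nat + nat) list \<Rightarrow> 'a) \<Rightarrow> 't"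
  assumes r: "r i \<in> Col (augment {1..i}) \<rightarrow>\<^sub>M T"
begin

lemma readings_level_measurable:
  "readings k r {i} X \<in> Col (augment X) \<rightarrow>\<^sub>M colourings (\<lambda>_. T) {i} X"
  by (rule readings_measurable) (use r in simp)

text \<open>The covariance of \<open>level_law\<close> passes to its image because readings commute
  with relabelling.\<close>

lemma covariant_kernel: "covariant_kernel (\<lambda>_. borel) i T (kernel i T r)"
  unfolding covariant_kernel_def
proof (intro conjI allI impI)
  note Qm = cond_lawD(1)[OF level_law(1)[of i]]
  show "kernel i T r \<in> Cod {..<i} {1..i} \<rightarrow>\<^sub>M prob_algebra (colourings (\<lambda>_. T) {i} {1..i})"
    unfolding kernel_def
    by (rule measurable_compose[OF Qm measurable_distr_prob_space[OF readings_level_measurable]])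
  fix \<sigma> z assume "\<sigma> permutes {1..i} \<and> z \<in> space (Cod {..<i} {1..i})"
  then have \<sigma>: "\<sigma> permutes {1..i}" and z: "z \<in> space (Cod {..<i} {1..i})" by auto
  let ?C = "colourings (\<lambda>_. T) {i} {1..i}" and ?A = "augment {1..i}" and ?R = "readings k r {i} {1..i}"
  have inj: "inj_on \<sigma> {1..i}" "\<sigma> ` {1..i} \<subseteq> {1..i}" using \<sigma> by (auto simp: permutes_inj_on permutes_image)
  note kz = kernel_space[OF Qm z]
  have lm: "relabel (lift \<sigma>) {..k} ?A \<in> level_law i z \<rightarrow>\<^sub>M Col ?A"
    using relabel_measurable[OF lift_augment(1)[OF inj(1)] lift_augment(2)[OF inj(2)], of "{..k}" K]
    by (simp cong: measurable_cong_sets[OF kz(2) refl])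
  have Rm: "?R \<in> level_law i z \<rightarrow>\<^sub>M ?C" using readings_level_measurable by (simp cong: measurable_cong_sets[OF kz(2) refl])
  have "kernel i T r (relabel \<sigma> {..<i} {1..i} z) = distr (distr (level_law i z) (Col ?A) (relabel (lift \<sigma>) {..k} ?A)) ?C ?R"
    unfolding kernel_def level_law(2)[OF \<sigma> z] ..
  also have "\<dots> = distr (level_law i z) ?C (?R \<circ> relabel (lift \<sigma>) {..k} ?A)"
    by (rule distr_distr[OF readings_level_measurable lm])
  also have "?R \<circ> relabel (lift \<sigma>) {..k} ?A = relabel \<sigma> {i} {1..i} \<circ> ?R"
    by (rule ext) (simp only: comp_apply readings_relabel[OF inj])
  also have "distr (level_law i z) ?C \<dots> = distr (distr (level_law i z) ?C ?R) ?C (relabel \<sigma> {i} {1..i})"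
    by (rule distr_distr[OF relabel_measurable[OF inj] Rm, symmetric])
  finally show "kernel i T r (relabel \<sigma> {..<i} {1..i} z) = distr (kernel i T r z) ?C (relabel \<sigma> {i} {1..i})"
    unfolding kernel_def .
qed

abbreviation orbit_law :: "'s set \<Rightarrow> ('s list \<Rightarrow> real) \<Rightarrow> ('s list \<Rightarrow> 't) measure" where
  "orbit_law \<equiv> law_on i T (kernel i T r)"

text \<open>\<open>cond_law_mask\<close> pushed forward twice: by the readings on
  \<open>{1..i}\<close>, and by renumbering from \<open>{1..i}\<close> back to
  \<open>u\<close>.\<close>

lemma cond_law_orbit:
  assumes u: "u \<in> nsets S i"
  shows "cond_law (law V) (masked u) (Col V) (\<lambda>\<omega>. restrict (readings k r {i} S \<omega>) (Injs i u))
    (colourings (\<lambda>_. T) {i} u) (\<lambda>y. orbit_law u (codes {..<i} S y))"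
proof -
  \<comment> \<open>The very enumeration that \<open>law_on\<close> selects, so that the two
    transported laws coincide literally.\<close>
  define e where "e = (SOME e. bij_betw e {1..i} u)"
  have "finite u" "card u = i" and uS: "u \<subseteq> S" using u by (auto simp: nsets_def)
  then have "\<exists>e. bij_betw e {1..i} u"
    by (intro finite_same_card_bij) auto
  then have e: "bij_betw e {1..i} u" unfolding e_def by (rule someI_ex)
  let ?A = "augment {1..i}" and ?s = "relabel (lift e) {..k} (augment {1..i})" and ?R = "readings k r {i} {1..i}"
  let ?C = "colourings (\<lambda>_. T) {i}"
  have ei: "inj_on e {1..i}" "e ` {1..i} \<subseteq> S" "e ` {1..i} = u" using e uS by (auto simp: bij_betw_def)
  have ie: "bij_betw (inv_into {1..i} e) u {1..i}" by (rule bij_betw_inv_into[OF e])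
  then have ie': "inj_on (inv_into {1..i} e) u" "inv_into {1..i} e ` u \<subseteq> {1..i}" by (auto simp: bij_betw_def)
  have mm: "masked u \<in> law V \<rightarrow>\<^sub>M Col V" using masked_measurable by (simp cong: measurable_cong_sets)
  have sm: "?s \<in> law V \<rightarrow>\<^sub>M Col ?A"
    by (rule relabel_measurable_law[OF lift_augment(1)[OF ei(1)] lift_augment(2)[OF ei(2)]])
  note 1 = cond_law_mask[OF uS e level_law(1)]
  note 2 = cond_law_distr[OF 1 readings_level_measurable mm sm]
  have Rsm: "(\<lambda>\<omega>. ?R (?s \<omega>)) \<in> law V \<rightarrow>\<^sub>M ?C {1..i}" by (rule measurable_compose[OF sm readings_level_measurable])
  note 3 = cond_law_distr[OF 2 relabel_measurable[OF ie'] mm Rsm]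
  have eq1: "relabel (inv_into {1..i} e) {i} u (?R (?s \<omega>)) = restrict (readings k r {i} S \<omega>) (Injs i u)" for \<omega>
  proof -
    have "relabel (inv_into {1..i} e) {i} u (?R (?s \<omega>)) = relabel (e \<circ> inv_into {1..i} e) {i} u (readings k r {i} S \<omega>)"
      unfolding readings_relabel[OF ei(1,2)] by (rule relabel_relabel[OF ie'])
    also have "\<dots> = relabel id {i} u (readings k r {i} S \<omega>)"
      by (rule relabel_cong) (simp add: ei(3) f_inv_into_f)
    also have "\<dots> = restrict (readings k r {i} S \<omega>) (Injs i u)" by (simp add: relabel_def)
    finally show ?thesis .
  qed
  have eq2: "distr (distr (level_law i (codes {..<i} {1..i} (?s y))) (?C {1..i}) ?R) (?C u) (relabel (inv_into {1..i} e) {i} u)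
      = orbit_law u (codes {..<i} S y)" for y
    unfolding law_on_def e_def[symmetric] transported_law_def kernel_def readings_relabel[OF ei(1,2)] ..
  show ?thesis using 3 unfolding eq1 eq2 .
qed

lemma orbit_law_measurable:
  assumes u: "u \<in> nsets S i"
  shows "orbit_law u \<in> Cod {..<i} S \<rightarrow>\<^sub>M prob_algebra (colourings (\<lambda>_. T) {i} u)"
proof -
  define e where "e = (SOME e. bij_betw e {1..i} u)"
  have "finite u" "card u = i" and uS: "u \<subseteq> S" using u by (auto simp: nsets_def)
  then have "\<exists>e. bij_betw e {1..i} u"
    by (intro finite_same_card_bij) auto
  then have e: "bij_betw e {1..i} u" unfolding e_def by (rule someI_ex)
  then have ei: "inj_on e {1..i}" "e ` {1..i} \<subseteq> S" using uS by (auto simp: bij_betw_def)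
  have ie': "inj_on (inv_into {1..i} e) u" "inv_into {1..i} e ` u \<subseteq> {1..i}"
    using bij_betw_inv_into[OF e] by (auto simp: bij_betw_def)
  have km: "kernel i T r \<in> Cod {..<i} {1..i} \<rightarrow>\<^sub>M prob_algebra (colourings (\<lambda>_. T) {i} {1..i})"
    using covariant_kernel unfolding covariant_kernel_def by blast
  show ?thesis
    unfolding law_on_def e_def[symmetric] transported_law_def
    by (rule measurable_compose[OF relabel_measurable[OF ei] measurable_compose[OF km measurable_distr_prob_space[OF relabel_measurable[OF ie']]]])
qed

lemma orbit_readings_measurable:
  assumes u: "u \<subseteq> S"
  shows "(\<lambda>\<omega>. restrict (readings k r {i} S \<omega>) (Injs i u)) \<in> Col V \<rightarrow>\<^sub>M colourings (\<lambda>_. T) {i} u"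
proof -
  have "(\<lambda>\<omega>. relabel id {i} u (readings k r {i} S \<omega>)) \<in> Col V \<rightarrow>\<^sub>M colourings (\<lambda>_. T) {i} u"
    by (rule measurable_compose[OF readings_level_measurable relabel_measurable]) (use u in auto)
  then show ?thesis by (simp add: relabel_def)
qed

text \<open>The orbits are split off one at a time, the others being functions of the colouring masked at \<open>u\<close>.\<close>

lemma orbits_independent:
  assumes F: "finite F" "F \<subseteq> nsets S i" and B: "\<And>u. u \<in> F \<Longrightarrow> B u \<in> sets (colourings (\<lambda>_. T) {i} u)"
    and g: "g \<in> borel_measurable (Cod {..<i} S)"
  shows "(\<integral>\<^sup>+\<omega>. g (codes {..<i} S \<omega>) * (\<Prod>u\<in>F. indicator (B u) (restrict (readings k r {i} S \<omega>) (Injs i u))) \<partial>law V)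
    = (\<integral>\<^sup>+\<omega>. g (codes {..<i} S \<omega>) * (\<Prod>u\<in>F. emeasure (orbit_law u (codes {..<i} S \<omega>)) (B u)) \<partial>law V)"
  using F B g
proof (induction F arbitrary: g rule: finite_induct)
  case empty
  then show ?case by simp
next
  case (insert u F)
  let ?z = "codes {..<i} S" and ?w = "\<lambda>u \<omega>. restrict (readings k r {i} S \<omega>) (Injs i u)"
  have u: "u \<in> nsets S i" and BU: "B u \<in> sets (colourings (\<lambda>_. T) {i} u)"
    using insert.prems by auto
  have Fn: "v \<in> nsets S i" "B v \<in> sets (colourings (\<lambda>_. T) {i} v)" if "v \<in> F" for v
    using insert.prems that by auto
  have uf: "finite u" "card u = i" "u \<subseteq> S" using u by (auto simp: nsets_def)
  have wm: "?w v \<in> Col V \<rightarrow>\<^sub>M colourings (\<lambda>_. T) {i} v" if "v \<in> nsets S i" for v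
    using that by (intro orbit_readings_measurable) (auto simp: nsets_def)
  have iw: "(\<lambda>\<omega>. indicator (B v) (?w v \<omega>) :: ennreal) \<in> borel_measurable (Col V)" if "v \<in> nsets S i" "B v \<in> sets (colourings (\<lambda>_. T) {i} v)" for v
    by (rule measurable_compose[OF wm[OF that(1)] borel_measurable_indicator[OF that(2)]])
  \<comment> \<open>The contribution of everything except the orbit of \<open>u\<close>. It reads
    only tuples that do not contain \<open>u\<close>, hence is unchanged by masking and may serve as
    a test function for the conditional law of that orbit.\<close>
  define h where "h y = g (?z y) * (\<Prod>v\<in>F. indicator (B v) (?w v y))" for y
  have hm: "h \<in> borel_measurable (Col V)"
    unfolding h_def using Fn
    by (intro borel_measurable_times_ennreal borel_measurable_prod_ennreal iw measurable_compose[OF codes_measurable insert.prems(3)]) auto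
  have zmask: "?z (masked u \<omega>) = ?z \<omega>" for \<omega>
  proof
    fix \<phi>
    show "?z (masked u \<omega>) \<phi> = ?z \<omega> \<phi>"
    proof (cases "\<phi> \<in> (\<Union>j\<in>{..<i}. Injs j S)")
      case True
      then have "card (set \<phi>) < card u" using card_length[of \<phi>] uf(2) by (auto simp: Injs_def)
      then have "\<not> u \<subseteq> set \<phi>" by (meson List.finite_set card_mono not_le)
      then show ?thesis using True by (intro readings_mask)
    qed (simp add: readings_def)
  qed
  have wmask: "?w v (masked u \<omega>) = ?w v \<omega>" if v: "v \<in> F" for v \<omega>
  proof
    fix \<phi>
    show "?w v (masked u \<omega>) \<phi> = ?w v \<omega> \<phi>"
    proof (cases "\<phi> \<in> Injs i v")
      case True
      have vf: "finite v" "card v = i" "v \<subseteq> S" using Fn(1)[OF v] by (auto simp: nsets_def)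
      have "\<not> u \<subseteq> set \<phi>"
      proof
        assume "u \<subseteq> set \<phi>"
        then have "u \<subseteq> v" using True by (auto simp: Injs_def)
        then have "u = v" using card_subset_eq[OF vf(1)] uf(2) vf(2) by simp
        then show False using v insert.hyps(2) by simp
      qed
      moreover have "\<phi> \<in> (\<Union>j\<in>{i}. Injs j S)" using True vf(3) by (auto simp: Injs_def)
      ultimately show ?thesis using True by (simp add: readings_mask)
    qed simp
  qed
  have hmask: "h (masked u \<omega>) = h \<omega>" for \<omega>
    unfolding h_def by (simp add: zmask wmask)
  note cl = cond_law_orbit[OF u]
  have mm: "masked u \<in> law V \<rightarrow>\<^sub>M Col V" using masked_measurable by (simp cong: measurable_cong_sets)
  have em: "(\<lambda>z. emeasure (orbit_law v z) (B v)) \<in> borel_measurable (Cod {..<i} S)" if "v \<in> nsets S i" "B v \<in> sets (colourings (\<lambda>_. T) {i} v)" for v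
    by (rule kernel_emeasure_measurable[OF orbit_law_measurable[OF that(1)] that(2)])
  have ez: "(\<lambda>\<omega>. emeasure (orbit_law u (?z \<omega>)) (B u)) \<in> borel_measurable (Col V)"
    by (rule measurable_compose[OF codes_measurable em[OF u BU]])
  have "(\<integral>\<^sup>+\<omega>. g (?z \<omega>) * (\<Prod>v\<in>insert u F. indicator (B v) (?w v \<omega>)) \<partial>law V)
      = (\<integral>\<^sup>+\<omega>. h (masked u \<omega>) * indicator (B u) (?w u \<omega>) \<partial>law V)"
    unfolding hmask using insert.hyps by (intro nn_integral_cong) (simp add: h_def ac_simps)
  also have "\<dots> = (\<integral>\<^sup>+\<omega>. h (masked u \<omega>) * emeasure (orbit_law u (?z \<omega>)) (B u) \<partial>law V)"
  proof (rule nn_integral_eq_of_set_integral_eq[OF mm mm])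
    show "(\<lambda>\<omega>. indicator (B u) (?w u \<omega>) :: ennreal) \<in> borel_measurable (law V)"
      using iw[OF u BU] by (simp cong: measurable_cong_sets)
    show "(\<lambda>\<omega>. emeasure (orbit_law u (?z \<omega>)) (B u)) \<in> borel_measurable (law V)"
      using ez by (simp cong: measurable_cong_sets)
    show "h \<in> borel_measurable (Col V)" by (rule hm)
    fix A assume A: "A \<in> sets (Col V)"
    have "(\<integral>\<^sup>+\<omega>. indicator A (masked u \<omega>) * indicator (B u) (?w u \<omega>) \<partial>law V)
      = (\<integral>\<^sup>+\<omega>. indicator {\<omega> \<in> space (law V). masked u \<omega> \<in> A \<and> ?w u \<omega> \<in> B u} \<omega> \<partial>law V)"
      by (intro nn_integral_cong) (simp add: indicator_def)
    also have "\<dots> = emeasure (law V) {\<omega> \<in> space (law V). masked u \<omega> \<in> A \<and> ?w u \<omega> \<in> B u}"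
    proof (rule nn_integral_indicator)
      have "{\<omega> \<in> space (law V). masked u \<omega> \<in> A \<and> ?w u \<omega> \<in> B u} = (masked u -` A \<inter> space (Col V)) \<inter> (?w u -` B u \<inter> space (Col V))"
        by auto
      also have "\<dots> \<in> sets (Col V)"
        by (intro sets.Int measurable_sets[OF masked_measurable A] measurable_sets[OF wm[OF u] BU])
      finally show "{\<omega> \<in> space (law V). masked u \<omega> \<in> A \<and> ?w u \<omega> \<in> B u} \<in> sets (law V)" by simp
    qed
    also have "\<dots> = (\<integral>\<^sup>+\<omega>. indicator A (masked u \<omega>) * emeasure (orbit_law u (?z (masked u \<omega>))) (B u) \<partial>law V)"
      by (rule cond_lawD(2)[OF cl A BU])
    finally show "(\<integral>\<^sup>+\<omega>. indicator A (masked u \<omega>) * indicator (B u) (?w u \<omega>) \<partial>law V)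
      = (\<integral>\<^sup>+\<omega>. indicator A (masked u \<omega>) * emeasure (orbit_law u (?z \<omega>)) (B u) \<partial>law V)"
      unfolding zmask .
  qed
  also have "\<dots> = (\<integral>\<^sup>+\<omega>. (g (?z \<omega>) * emeasure (orbit_law u (?z \<omega>)) (B u)) * (\<Prod>v\<in>F. indicator (B v) (?w v \<omega>)) \<partial>law V)"
    unfolding hmask by (intro nn_integral_cong) (simp add: h_def ac_simps)
  also have "\<dots> = (\<integral>\<^sup>+\<omega>. (g (?z \<omega>) * emeasure (orbit_law u (?z \<omega>)) (B u)) * (\<Prod>v\<in>F. emeasure (orbit_law v (?z \<omega>)) (B v)) \<partial>law V)"
    \<comment> \<open>The factor of \<open>u\<close> has become a function of the lower codes and is
      absorbed into \<open>g\<close>; this is why the induction keeps \<open>g\<close>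
      arbitrary.\<close>
    by (rule insert.IH[of "\<lambda>z. g z * emeasure (orbit_law u z) (B u)"])
      (use insert.prems in \<open>auto intro!: borel_measurable_times_ennreal em[OF u BU]\<close>)
  also have "\<dots> = (\<integral>\<^sup>+\<omega>. g (?z \<omega>) * (\<Prod>v\<in>insert u F. emeasure (orbit_law v (?z \<omega>)) (B v)) \<partial>law V)"
    using insert.hyps by (intro nn_integral_cong) (simp add: ac_simps)
  finally show ?case .
qed

text \<open>On a finite cylinder the product kernel is a finite product of orbit laws, so
  \<open>orbits_independent\<close> gives the identity; finite cylinders generate. The conditioning
  is on the lower codes of all of \<open>S\<close>, although the factor of \<open>u\<close> depends
  only on those inside \<open>u\<close>.\<close>

lemma cond_law_step:
  "cond_law (law V) (codes {..<i} S) (Cod {..<i} S) (readings k r {i} S) (colourings (\<lambda>_. T) {i} S)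
    (step_law i T (kernel i T r) S)"
proof -
  let ?n = "nsets S i" and ?C = "\<lambda>u. colourings (\<lambda>_. T) {i} (u :: 's set)"
  let ?z = "codes {..<i} S" and ?W = "\<lambda>\<omega>. split_orbits i S (readings k r {i} S \<omega>)"
  let ?L = "\<lambda>z. PiM ?n (\<lambda>u. orbit_law u z)"
  have zm: "?z \<in> law V \<rightarrow>\<^sub>M Cod {..<i} S" using codes_measurable by (simp cong: measurable_cong_sets)
  have Wm: "?W \<in> law V \<rightarrow>\<^sub>M PiM ?n ?C"
    using measurable_compose[OF readings_level_measurable split_orbits_measurable] by (simp cong: measurable_cong_sets)
  have gen: "sets (PiM ?n ?C) = sigma_sets (space (PiM ?n ?C)) (prod_algebra ?n ?C)"
    "Int_stable (prod_algebra ?n ?C)" "prod_algebra ?n ?C \<subseteq> Pow (space (PiM ?n ?C))"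
    using prod_algebra_sets_into_space[of ?n ?C] Int_stable_prod_algebra by (simp_all add: sets_PiM space_PiM)
  have Lem: "emeasure (?L z) (prod_emb ?n ?C J (Pi\<^sub>E J E)) = (\<Prod>u\<in>J. emeasure (orbit_law u z) (E u))"
    if z: "z \<in> space (Cod {..<i} S)" and J: "finite J" "J \<subseteq> ?n" and E: "\<And>u. u \<in> J \<Longrightarrow> E u \<in> sets (?C u)" for z J E
  proof -
    have "prod_emb ?n ?C J (Pi\<^sub>E J E) = prod_emb ?n (\<lambda>u. orbit_law u z) J (Pi\<^sub>E J E)"
      using kernel_space(3)[OF orbit_law_measurable z] by (auto simp: prod_emb_def PiE_iff)
    moreover have "emeasure (?L z) (prod_emb ?n (\<lambda>u. orbit_law u z) J (Pi\<^sub>E J E)) = (\<Prod>u\<in>J. emeasure (orbit_law u z) (E u))"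
      using J E kernel_space[OF orbit_law_measurable z]
      by (intro emeasure_PiM_emb) auto
    ultimately show ?thesis by simp
  qed
  have Lm: "?L \<in> Cod {..<i} S \<rightarrow>\<^sub>M prob_algebra (PiM ?n ?C)"
  proof (rule measurable_prob_algebra_generated[OF gen])
    fix z assume z: "z \<in> space (Cod {..<i} S)"
    show "prob_space (?L z)" by (rule prob_space_PiM) (rule kernel_space(1)[OF orbit_law_measurable z])
    show "sets (?L z) = sets (PiM ?n ?C)"
      by (rule sets_PiM_cong) (simp_all add: kernel_space(2)[OF orbit_law_measurable z])
  next
    fix B assume "B \<in> prod_algebra ?n ?C"
    then obtain J E where J: "finite J" "J \<subseteq> ?n" and E: "\<And>u. u \<in> J \<Longrightarrow> E u \<in> sets (?C u)"
      and B: "B = prod_emb ?n ?C J (Pi\<^sub>E J E)" by (auto elim!: prod_algebraE)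
    have "(\<lambda>z. \<Prod>u\<in>J. emeasure (orbit_law u z) (E u)) \<in> borel_measurable (Cod {..<i} S)"
      using J E by (intro borel_measurable_prod_ennreal kernel_emeasure_measurable[OF orbit_law_measurable]) auto
    then show "(\<lambda>z. emeasure (?L z) B) \<in> borel_measurable (Cod {..<i} S)"
      by (rule measurable_cong[THEN iffD1, rotated]) (simp add: B Lem J E)
  qed
  have "cond_law (law V) ?z (Cod {..<i} S) ?W (PiM ?n ?C) ?L"
  proof (rule cond_law_generated[OF prob_space_law_V zm Wm Lm gen])
    fix A B assume A: "A \<in> sets (Cod {..<i} S)" and "B \<in> prod_algebra ?n ?C"
    then obtain J E where J: "finite J" "J \<subseteq> ?n" and E: "\<And>u. u \<in> J \<Longrightarrow> E u \<in> sets (?C u)"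
      and B: "B = prod_emb ?n ?C J (Pi\<^sub>E J E)" by (auto elim!: prod_algebraE)
    have Bs: "B \<in> sets (PiM ?n ?C)" unfolding B by (rule sets_PiM_I) (use J E in auto)
    have WB: "?W \<omega> \<in> B \<longleftrightarrow> (\<forall>u\<in>J. restrict (readings k r {i} S \<omega>) (Injs i u) \<in> E u)" if "\<omega> \<in> space (law V)" for \<omega>
    proof -
      have "?W \<omega> \<in> space (PiM ?n ?C)" using measurable_space[OF Wm that] .
      then have "?W \<omega> \<in> B \<longleftrightarrow> (\<forall>u\<in>J. ?W \<omega> u \<in> E u)"
        unfolding B using J(2) by (auto simp: prod_emb_def space_PiM PiE_iff restrict_def extensional_def)
      also have "\<dots> \<longleftrightarrow> (\<forall>u\<in>J. restrict (readings k r {i} S \<omega>) (Injs i u) \<in> E u)"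
        using J(2) by (intro ball_cong refl) (auto simp: split_orbits_def)
      finally show ?thesis .
    qed
    have "emeasure (law V) {\<omega> \<in> space (law V). ?z \<omega> \<in> A \<and> ?W \<omega> \<in> B}
      = (\<integral>\<^sup>+\<omega>. indicator {\<omega> \<in> space (law V). ?z \<omega> \<in> A \<and> ?W \<omega> \<in> B} \<omega> \<partial>law V)"
    proof (rule nn_integral_indicator[symmetric])
      have "{\<omega> \<in> space (law V). ?z \<omega> \<in> A \<and> ?W \<omega> \<in> B} = (?z -` A \<inter> space (law V)) \<inter> (?W -` B \<inter> space (law V))" by auto
      also have "\<dots> \<in> sets (law V)" by (intro sets.Int measurable_sets[OF zm A] measurable_sets[OF Wm Bs])
      finally show "{\<omega> \<in> space (law V). ?z \<omega> \<in> A \<and> ?W \<omega> \<in> B} \<in> sets (law V)" .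
    qed
    also have "\<dots> = (\<integral>\<^sup>+\<omega>. indicator A (?z \<omega>) * (\<Prod>u\<in>J. indicator (E u) (restrict (readings k r {i} S \<omega>) (Injs i u))) \<partial>law V)"
    proof (rule nn_integral_cong)
      fix \<omega> assume \<omega>: "\<omega> \<in> space (law V)"
      have "(\<Prod>u\<in>J. indicator (E u) (restrict (readings k r {i} S \<omega>) (Injs i u))) = (of_bool (?W \<omega> \<in> B) :: ennreal)"
      proof (cases "?W \<omega> \<in> B")
        case True
        then show ?thesis using WB[OF \<omega>] by (simp add: indicator_def)
      next
        case False
        then obtain u where "u \<in> J" "restrict (readings k r {i} S \<omega>) (Injs i u) \<notin> E u" using WB[OF \<omega>] by blast
        then show ?thesis using False J(1) by (auto simp: prod_zero_iff indicator_def)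
      qed
      then show "indicator {\<omega> \<in> space (law V). ?z \<omega> \<in> A \<and> ?W \<omega> \<in> B} \<omega>
        = indicator A (?z \<omega>) * (\<Prod>u\<in>J. indicator (E u) (restrict (readings k r {i} S \<omega>) (Injs i u)) :: ennreal)"
        using \<omega> by (simp add: indicator_def)
    qed
    also have "\<dots> = (\<integral>\<^sup>+\<omega>. indicator A (?z \<omega>) * (\<Prod>u\<in>J. emeasure (orbit_law u (?z \<omega>)) (E u)) \<partial>law V)"
      by (rule orbits_independent[OF J E borel_measurable_indicator[OF A]])
    also have "\<dots> = (\<integral>\<^sup>+\<omega>. indicator A (?z \<omega>) * emeasure (?L (?z \<omega>)) B \<partial>law V)"
      by (intro nn_integral_cong) (simp add: B Lem[OF measurable_space[OF zm] J E])
    finally show "emeasure (law V) {\<omega> \<in> space (law V). ?z \<omega> \<in> A \<and> ?W \<omega> \<in> B}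
      = (\<integral>\<^sup>+\<omega>. indicator A (?z \<omega>) * emeasure (?L (?z \<omega>)) B \<partial>law V)" .
  qed
  from cond_law_distr[OF this glue_measurable zm Wm]
  have "cond_law (law V) ?z (Cod {..<i} S) (\<lambda>\<omega>. \<lambda>\<phi>\<in>Injs i S. ?W \<omega> (set \<phi>) \<phi>) (?C S) (step_law i T (kernel i T r) S)"
    unfolding step_law_def .
  moreover have "(\<lambda>\<phi>\<in>Injs i S. ?W \<omega> (set \<phi>) \<phi>) = readings k r {i} S \<omega>" for \<omega>
  proof
    fix \<phi>
    show "(\<lambda>\<phi>\<in>Injs i S. ?W \<omega> (set \<phi>) \<phi>) \<phi> = readings k r {i} S \<omega> \<phi>"
    proof (cases "\<phi> \<in> Injs i S")
      case True
      then have "\<phi> \<in> Injs i (set \<phi>)" by (simp add: Injs_def)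
      then show ?thesis using True set_in_nsets[OF True] by (simp add: split_orbits_def)
    qed (simp add: readings_def)
  qed
  ultimately show ?thesis by simp
qed

end

section \<open>Assembling the recipe\<close>

text \<open>\<open>augment {1..0}\<close> consists of the auxiliary vertices alone: the code at the
  empty tuple records the colouring among them.\<close>

definition root_law :: "real measure" where
  "root_law = distr (law V) borel (\<lambda>\<omega>. enc 0 (relabel (vertex_at []) {..k} (augment {1..0}) \<omega>))"

lemma enc_root_measurable:
  "(\<lambda>\<omega>. enc 0 (relabel (vertex_at []) {..k} (augment {1..0}) \<omega>)) \<in> borel_measurable (law V)"
proof -
  have "[] \<in> Injs 0 S" by (simp add: Injs_def)
  from measurable_compose[OF relabel_measurable[OF vertex_at_augment(1,3)[OF this]] enc_measurable[of 0]]
  show ?thesis by (simp cong: measurable_cong_sets)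
qed

lemma prob_space_root_law: "prob_space root_law"
  unfolding root_law_def by (rule prob_space.prob_space_distr[OF prob_space_law_V enc_root_measurable])

lemma codes_measurable_law: "codes I S \<in> law V \<rightarrow>\<^sub>M Cod I S"
  using codes_measurable by (simp cong: measurable_cong_sets)

text \<open>The recipe run with these kernels reproduces the true joint law of the codes: each step
  draws the codes of the next rank from their conditional law given all lower ones.\<close>

lemma z_law_eq:
  "z_law (\<lambda>_. borel) root_law (\<lambda>i. kernel i borel enc) S i = distr (law V) (Cod {..i} S) (codes {..i} S)"
proof (induction i)
  case 0
  have m: "(\<lambda>z. \<lambda>\<phi>\<in>Injs 0 S. z) \<in> (borel :: real measure) \<rightarrow>\<^sub>M Cod {..0} S"
  proof -
    have "(\<lambda>z. \<lambda>\<phi>\<in>(\<Union>j\<in>{..0}. Injs j S). z) \<in> (borel :: real measure) \<rightarrow>\<^sub>M Cod {..0} S"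
      unfolding colourings_def by (rule measurable_restrict) simp
    then show ?thesis by simp
  qed
  have "z_law (\<lambda>_. borel) root_law (\<lambda>i. kernel i borel enc) S 0
    = distr (law V) (Cod {..0} S) ((\<lambda>z. \<lambda>\<phi>\<in>Injs 0 S. z) \<circ> (\<lambda>\<omega>. enc 0 (relabel (vertex_at []) {..k} (augment {1..0}) \<omega>)))"
    unfolding z_law.simps root_law_def by (rule distr_distr[OF m enc_root_measurable])
  also have "(\<lambda>z. \<lambda>\<phi>\<in>Injs 0 S. z) \<circ> (\<lambda>\<omega>. enc 0 (relabel (vertex_at []) {..k} (augment {1..0}) \<omega>)) = codes {..0} S"
    by (auto simp: fun_eq_iff readings_def Injs_def restrict_def)
  finally show ?case .
next
  case (Suc i)
  let ?I = "\<Union>j\<in>{..i}. Injs j S" and ?J = "Injs (Suc i) S"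
  have *: "{..<Suc i} = {..i}" by (rule lessThan_Suc_atMost)
  have cl: "cond_law (law V) (codes {..i} S) (Cod {..i} S) (codes {Suc i} S) (Cod {Suc i} S)
    (step_law (Suc i) borel (kernel (Suc i) borel enc) S)"
    using cond_law_step[of enc "Suc i" borel, OF enc_measurable] unfolding * .
  have H: "merge ?I ?J \<in> Cod {..i} S \<Otimes>\<^sub>M Cod {Suc i} S \<rightarrow>\<^sub>M Cod {..Suc i} S"
  proof -
    have "(\<Union>j\<in>{..Suc i}. Injs j S) = ?I \<union> ?J" by (auto simp: le_Suc_eq)
    then show ?thesis unfolding colourings_def by (simp add: measurable_merge)
  qed
  have "z_law (\<lambda>_. borel) root_law (\<lambda>i. kernel i borel enc) S (Suc i)
    = distr (law V) (Cod {..i} S) (codes {..i} S) \<bind> (\<lambda>z. distr (step_law (Suc i) borel (kernel (Suc i) borel enc) S z)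
      (Cod {..Suc i} S) (\<lambda>w. merge ?I ?J (z, w)))"
    unfolding z_law.simps Suc.IH ..
  also have "\<dots> = distr (law V) (Cod {..Suc i} S) (\<lambda>\<omega>. merge ?I ?J (codes {..i} S \<omega>, codes {Suc i} S \<omega>))"
    by (rule cond_law_bind[OF prob_space_law_V codes_measurable_law codes_measurable_law cl H])
  also have "(\<lambda>\<omega>. merge ?I ?J (codes {..i} S \<omega>, codes {Suc i} S \<omega>)) = codes {..Suc i} S"
    by (auto simp: fun_eq_iff merge_def readings_def restrict_def le_Suc_eq)
  finally show ?case .
qed

text \<open>The map \<open>\<kappa> i\<close>: in the colouring seen from \<open>\<phi>\<close>, the
  tuple \<open>(1, ..., i)\<close> is \<open>\<phi>\<close> itself, so its entry is the colour of
  \<open>\<phi>\<close>.\<close>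

definition decode :: "nat \<Rightarrow> real \<Rightarrow> 'a" where
  "decode i x = dec i x (map Inl [1..<Suc i])"

abbreviation own_colour :: "nat \<Rightarrow> ((nat + nat) list \<Rightarrow> 'a) \<Rightarrow> 'a" where
  "own_colour i \<omega> \<equiv> \<omega> (map Inl [1..<Suc i])"

lemma vertices_Injs: "map Inl [1..<Suc i] \<in> Injs i (augment {1..i})"
  by (auto simp: Injs_def augment_def distinct_map simp del: upt_Suc)

lemma own_colour_measurable: "i \<le> k \<Longrightarrow> own_colour i \<in> Col (augment {1..i}) \<rightarrow>\<^sub>M K i"
proof -
  assume "i \<le> k"
  then have "map Inl [1..<Suc i] \<in> (\<Union>j\<in>{..k}. Injs j (augment {1..i}))" using vertices_Injs by blast
  from measurable_component_singleton[OF this, of "\<lambda>\<phi>. K (length \<phi>)"]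
  show ?thesis by (simp add: colourings_def del: upt_Suc)
qed

lemma decode_measurable: "i \<le> k \<Longrightarrow> decode i \<in> borel \<rightarrow>\<^sub>M K i"
  unfolding decode_def by (rule measurable_compose[OF dec_measurable own_colour_measurable])

lemma own_colour_vertex_at:
  assumes \<phi>: "\<phi> \<in> Injs i S" and i: "i \<le> k"
  shows "own_colour i (relabel (vertex_at \<phi>) {..k} (augment {1..i}) \<omega>) = \<omega> (map Inl \<phi>)"
proof -
  have "map Inl [1..<Suc i] \<in> (\<Union>j\<in>{..k}. Injs j (augment {1..i}))" using vertices_Injs i by blast
  moreover have "map (vertex_at \<phi>) (map Inl [1..<Suc i]) = map Inl \<phi>"
    using \<phi> by (intro nth_equalityI) (auto simp: Injs_def vertex_at_def simp del: upt_Suc)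
  ultimately show ?thesis by (simp only: relabel_apply)
qed

text \<open>Decoded codes and last colours together are the colours of the tuples in
  \<open>S\<close> under \<open>law V\<close>. Pulling \<open>law V\<close> back along
  \<open>Inl\<close> gives \<open>law S\<close>, which is \<open>\<mu>\<close>.\<close>

lemma recipe_law_eq:
  assumes k: "k \<ge> 1"
  shows "recipe_law k K (\<lambda>_. borel) decode root_law (\<lambda>i. kernel i borel enc) (kernel k (K k) own_colour) S = \<mu>"
proof -
  let ?I = "\<Union>j\<in>{..<k}. Injs j S" and ?J = "Injs k S"
  let ?z = "codes {..<k} S" and ?w = "readings k own_colour {k} S"
  have *: "{..k - 1} = {..<k}" using k by auto
  have r: "own_colour k \<in> Col (augment {1..k}) \<rightarrow>\<^sub>M K k" by (rule own_colour_measurable) simp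
  have wm: "?w \<in> law V \<rightarrow>\<^sub>M colourings (\<lambda>_. K k) {k} S"
    using readings_level_measurable[of own_colour k "K k", OF r] by (simp cong: measurable_cong_sets)
  let ?H = "\<lambda>(z, w). merge ?I ?J (\<lambda>\<phi>. decode (length \<phi>) (z \<phi>), w)"
  have H: "?H \<in> Cod {..<k} S \<Otimes>\<^sub>M colourings (\<lambda>_. K k) {k} S \<rightarrow>\<^sub>M Col S"
  proof -
    \<comment> \<open>The recipe decodes without restricting to \<open>?I\<close>. Since
      \<open>merge\<close> consults its first argument on \<open>?I\<close> only, the restricted
      version, which lies in the product space, gives the same result.\<close>
    have d: "(\<lambda>z. \<lambda>\<phi>\<in>?I. decode (length \<phi>) (z \<phi>)) \<in> Cod {..<k} S \<rightarrow>\<^sub>M PiM ?I (\<lambda>\<phi>. K (length \<phi>))"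
    proof (rule measurable_restrict)
      fix \<phi> assume \<phi>: "\<phi> \<in> ?I"
      then have "length \<phi> \<le> k" by (auto simp: Injs_def)
      have "(\<lambda>z. z \<phi>) \<in> Cod {..<k} S \<rightarrow>\<^sub>M borel"
        unfolding colourings_def by (rule measurable_component_singleton[OF \<phi>])
      from measurable_compose[OF this decode_measurable[OF \<open>length \<phi> \<le> k\<close>]]
      show "(\<lambda>z. decode (length \<phi>) (z \<phi>)) \<in> Cod {..<k} S \<rightarrow>\<^sub>M K (length \<phi>)" .
    qed
    have c: "colourings (\<lambda>_. K k) {k} S = PiM ?J (\<lambda>\<phi>. K (length \<phi>))"
      unfolding colourings_def by (rule PiM_cong) (auto simp: Injs_def)
    have U: "(\<Union>j\<in>{..k}. Injs j S) = ?I \<union> ?J" by (auto simp: le_less)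
    have "(\<lambda>p. merge ?I ?J ((\<lambda>\<phi>\<in>?I. decode (length \<phi>) (fst p \<phi>)), snd p)) \<in> Cod {..<k} S \<Otimes>\<^sub>M PiM ?J (\<lambda>\<phi>. K (length \<phi>)) \<rightarrow>\<^sub>M PiM (?I \<union> ?J) (\<lambda>\<phi>. K (length \<phi>))"
      by (rule measurable_compose[OF measurable_Pair[OF measurable_compose[OF measurable_fst d] measurable_snd] measurable_merge])
    also have "(\<lambda>p. merge ?I ?J ((\<lambda>\<phi>\<in>?I. decode (length \<phi>) (fst p \<phi>)), snd p)) = ?H"
      by (auto simp: fun_eq_iff merge_def)
    finally show ?thesis unfolding c colourings_def[of K] U .
  qed
  have "recipe_law k K (\<lambda>_. borel) decode root_law (\<lambda>i. kernel i borel enc) (kernel k (K k) own_colour) S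
    = distr (law V) (Cod {..<k} S) ?z \<bind> (\<lambda>z. distr (step_law k (K k) (kernel k (K k) own_colour) S z) (Col S) (\<lambda>w. ?H (z, w)))"
    unfolding recipe_law_def z_law_eq * by simp
  also have "\<dots> = distr (law V) (Col S) (\<lambda>\<omega>. ?H (?z \<omega>, ?w \<omega>))"
    by (rule cond_law_bind[OF prob_space_law_V codes_measurable_law wm cond_law_step[of own_colour k "K k", OF r] H])
  also have "\<dots> = distr (law V) (Col S) (relabel Inl {..k} S)"
  proof (rule distr_cong[OF refl refl])
    fix \<omega> assume "\<omega> \<in> space (law V)"
    then have \<omega>: "\<omega> \<in> space (Col V)" by simp
    show "?H (?z \<omega>, ?w \<omega>) = relabel Inl {..k} S \<omega>"
    proof
      fix \<phi>
      consider "\<phi> \<in> ?I" | "\<phi> \<notin> ?I" "\<phi> \<in> ?J" | "\<phi> \<notin> ?I" "\<phi> \<notin> ?J" by blast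
      then show "?H (?z \<omega>, ?w \<omega>) \<phi> = relabel Inl {..k} S \<omega> \<phi>"
      proof cases
        case 1
        then have \<phi>: "\<phi> \<in> Injs (length \<phi>) S" "length \<phi> \<le> k" by (auto simp: Injs_def)
        then have m: "\<phi> \<in> (\<Union>j\<in>{..k}. Injs j S)" by blast
        have "decode (length \<phi>) (?z \<omega> \<phi>) = \<omega> (map Inl \<phi>)"
          using 1 relabel_in_space[OF vertex_at_augment(1,3)[OF \<phi>(1)] \<omega>] own_colour_vertex_at[OF \<phi>]
          by (simp add: readings_def decode_def dec_enc del: upt_Suc)
        then show ?thesis using 1 by (simp add: merge_def relabel_apply[OF m])
      next
        case 2
        then have m: "\<phi> \<in> (\<Union>j\<in>{..k}. Injs j S)" by blast
        have "length \<phi> = k" using 2 by (simp add: Injs_def)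
        then have "?w \<omega> \<phi> = \<omega> (map Inl \<phi>)"
          using 2 own_colour_vertex_at[OF 2(2)] by (simp add: readings_def del: upt_Suc)
        then show ?thesis using 2 by (simp add: merge_def relabel_apply[OF m])
      next
        case 3
        then have "\<phi> \<notin> (\<Union>j\<in>{..k}. Injs j S)" by (auto simp: le_less)
        then show ?thesis using 3 by (simp add: merge_def relabel_def)
      qed
    qed
  qed
  also have "\<dots> = law S"
    by (rule law_relabel[OF countable_V]) (auto simp: augment_def)
  finally show ?thesis by (simp add: law_S)
qed

lemma ingredients_exist:
  "ingredients k K (\<lambda>_. borel) decode root_law (\<lambda>i. kernel i borel enc) (kernel k (K k) own_colour)"
  unfolding ingredients_def
proof (intro conjI allI impI ballI)
  show "standard_borel (borel :: real measure)" by (rule standard_borel_real)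
  show "prob_space root_law" by (rule prob_space_root_law)
  show "sets root_law = sets borel" by (simp add: root_law_def)
  show "decode i \<in> borel \<rightarrow>\<^sub>M K i" if "i < k" for i
    by (rule decode_measurable) (use that in simp)
  show "covariant_kernel (\<lambda>_. borel) i borel (kernel i borel enc)" for i
    by (rule covariant_kernel) (rule enc_measurable)
  show "covariant_kernel (\<lambda>_. borel) k (K k) (kernel k (K k) own_colour)"
    by (rule covariant_kernel) (rule own_colour_measurable, simp)
qed

end

theorem theorem3p21:
  fixes S :: "'s set" and k :: nat and K :: "nat \<Rightarrow> 'a measure"
    and \<mu> :: "('s list \<Rightarrow> 'a) measure"
  assumes "countable S" and "infinite S" and "k \<ge> 1"
    and "palette k K"
    and "exchangeable_hypergraph k K S \<mu>"
  shows "\<exists>(Z :: nat \<Rightarrow> real measure) \<kappa> \<mu>0 P Pk.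
    ingredients k K Z \<kappa> \<mu>0 P Pk \<and> yields k K Z \<kappa> \<mu>0 P Pk S \<mu>"
proof -
  interpret exchangeable_colouring k K S \<mu>
    by (rule exchangeable_colouring.intro) (use assms in auto)
  have "yields k K (\<lambda>_. borel) decode root_law (\<lambda>i. kernel i borel enc) (kernel k (K k) own_colour) S \<mu>"
    unfolding yields_def by (rule recipe_law_eq[OF assms(3)])
  from conjI[OF ingredients_exist this] show ?thesis by (intro exI)
qed

end
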